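(* Let $N\ge 1$ and let $(\Phi_j)_{0\le j\le N}$, $(\Psi_x)_{0\le x\le N}$ be a compatible pair of families of parameter arrays over $\mathbb{C}$ (see context), where $$\Phi_j=(t_x ,t^\star_x(j),\,x=0,\dots,N-j;\ f_x(j), g_x(j),\,x=1,\dots,N-j),$$ $$\Psi_x=(\theta_j(x) ,\theta^\star_j,\,j=0,\dots,N-x;\ \varphi_j(x), \phi_j(x),\,j=1,\dots,N-x),$$ with $t_x$ independent of $j$ and $\theta_j^\star$ independent of $x$. Then the coefficients $C^{\epsilon,\epsilon'}_{i,j}$ and $D^{\epsilon,\epsilon'}_{x,y}$ in the definition of compatibility are uniquely determined, and there exist a $\mathbb{C}$-vector space $V$ of dimension $\binom{N+2}{2}$, endomorphisms $X,Y,X^\star,Y^\star$ of $V$, and two bases $\{V_{x,y}\}_{(x,y)\in\mathcal D}$ and $\{V^\star_{i,j}\}_{(i,j)\in\mathcal D}$ of $V$ such that $(H,H^\star)$ with $H=\mathrm{span}(X,Y)$, $H^\star=\mathrm{span}(X^\star,Y^\star)$ is a factorized $A_2$-Leonard pair with basis $(X,Y;X^\star,Y^\star)$, with $V_{(x,y)}=\mathbb{C}V_{x,y}$ and $V^\star_{(i,j)}=\mathbb{C}V^\star_{i,j}$, and such that (vectors with index outside $\mathcal D$ being $0$), for $(x,y)\in\mathcal D$, $$X V_{x,y}= t_x V_{x,y},\qquad Y V_{x,y}= \theta_y(x) V_{x,y},\qquad X^\star V_{x,y} =\sum_{(\epsilon,\epsilon')\in A_2} D^{\epsilon,\epsilon'}_{x,y}V_{x+\epsilon,y+\epsilon'},$$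 $$Y^\star V_{x,y}=b_{y-1}(\Psi_x^\star) V_{x,y-1}+a_{y}(\Psi_x^\star) V_{x,y}+ c_{y+1}(\Psi_x^\star) V_{x,y+1},$$ and, for $(i,j)\in\mathcal D$, $$X V^\star_{i,j}=b_{i-1}(\Phi_j) V^\star_{i-1,j}+ a_{i}(\Phi_j) V^\star_{i,j}+c_{i+1}(\Phi_j) V^\star_{i+1,j},\qquad Y V^\star_{i,j} =\sum_{(\epsilon,\epsilon')\in A_2} C^{\epsilon,\epsilon'}_{i,j}V^\star_{i+\epsilon,j+\epsilon'},$$ $$X^\star V^\star_{i,j}= t^\star_i(j) V^\star_{i,j},\qquad Y^\star V^\star_{i,j}= \theta_j^\star V^\star_{i,j},$$ and the change of basis is $$V^\star_{i,j}=\sum_{x=0}^{N-j}\sum_{y=0}^{N-x} p_{xi}(\Phi_j)\,p_{yj}(\Psi_x)\, V_{x,y}.$$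
   Context: **Factorized $A_2$-Leonard pairs.** $N\ge1$ is an integer, $\mathcal D=\{(x,y)\in\mathbb{Z}_{\ge0}^2 : x+y\le N\}$, $A_2=\{(0,0),(1,-1),(1,0),(0,1),(-1,1),(-1,0),(0,-1)\}$; $\lambda,\chi\in\mathcal D$ are adjacent if $\lambda-\chi\in A_2$. Let $V$ be a $\mathbb{C}$-vector space. $(H,H^\star)$ is an $A_2$-Leonard pair on $\mathcal D$ if: (i) $H$ and (ii) $H^\star$ are two-dimensional subspaces of $\mathrm{End}(V)$, each consisting of diagonalizable, mutually commuting elements; (iii) there is a bijection $\lambda\mapsto V_\lambda$ from $\mathcal D$ to the common eigenspaces of $H$ with $H^\star V_\lambda\subseteq\sum_{\chi\in\mathcal D,\ \chi\text{ adjacent to }\lambda}V_\chi$; (iv) there is a bijection $\lambda\mapsto V^\star_\lambda$ from $\mathcal D$ to the common eigenspaces of $H^\star$ with $HV^\star_\lambda\subseteq\sum_{\chi\in\mathcal D,\ \chi\text{ adjacent to }\lambda}V^\star_\chi$; (v) there is no subspace $W\neq 0,V$ of $V$ with $HW\subseteq W$ and $H^\star W\subseteq W$; (vi) $\dim V_\lambda=\dim V^\star_\lambda=1$ for all $\lambda\in\mathcal D$; (vii) there is a non-degenerate symmetric bilinear form $\langle\,,\rangle$ on $V$ with $\langle V_\lambda,V_\chi\rangle=0=\langle V^\star_\lambda,V^\star_\chi\rangle$ for $\lambda\ne\chi$. It is a *factorized* $A_2$-Leonard pair with basis $(X,Y;X^\star,Y^\star)$ if moreover $X,Y$ is a basis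 of $H$, $X^\star,Y^\star$ is a basis of $H^\star$, and: (viii) $X$ acts on $V_{(x,y)}$ as a scalar $t_x$ and $Y^\star$ acts on $V^\star_{(i,j)}$ as a scalar $\theta^\star_j$, the $t_x$ ($0\le x\le N$) being pairwise distinct and the $\theta^\star_j$ ($0\le j\le N$) pairwise distinct; (ix) $[X,Y^\star]=0$; (x) each common eigenspace of $X$ and $Y^\star$ has dimension one; (xi) $\langle V^\star_{(i+1,j)},XV^\star_{(i,j)}\rangle\ne0$ and $\langle V^\star_{(i,j)},XV^\star_{(i+1,j)}\rangle\neq0$ for $(i,j),(i+1,j)\in\mathcal D$, and $\langle V_{(x,y+1)},Y^\star V_{(x,y)}\rangle\ne0$ and $\langle V_{(x,y)},Y^\star V_{(x,y+1)}\rangle\ne0$ for $(x,y),(x,y+1)\in\mathcal D$ (for subspaces, $\langle U,W\rangle\neq0$ means the form is not identically zero on $U\times W$). **Parameter arrays.** A parameter array of diameter $d\ge0$ is a tuple $\Phi=(\theta_i,\theta^\star_i,i=0,\dots,d;\varphi_j,\phi_j,j=1,\dots,d)$ of complex numbers such that: all $\varphi_i,\phi_i$ are nonzero; the $\theta_i$ are pairwise distinct and the $\theta_i^\star$ are pairwise distinct; for $1\le i\le d$, with $\vartheta_i=\sum_{h=0}^{i-1}\frac{\theta_h-\theta_{d-h}}{\theta_0-\theta_d}$, one has $\varphi_i=\phi_1\vartheta_i+(\theta^\star_i-\theta^\star_0)(\theta_{i-1}-\theta_d)$ and $\phi_i=\varphi_1\vartheta_i+(\theta^\star_i-\theta^\star_0)(\theta_{d-i+1}-\theta_0)$;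 and $\frac{\theta_{i-2}-\theta_{i+1}}{\theta_{i-1}-\theta_i}$ and $\frac{\theta^\star_{i-2}-\theta^\star_{i+1}}{\theta^\star_{i-1}-\theta^\star_i}$ are equal and independent of $i$ for $2\le i\le d-1$. (These are exactly the parameter arrays of Leonard systems over $\mathbb C$.) Set $\Phi^\star=(\theta^\star_i,\theta_i,i=0,\dots,d;\varphi_j,\phi_{d-j+1},j=1,\dots,d)$, again a parameter array. With $\varphi_0=\varphi_{d+1}=0$ (the corresponding terms being omitted), define $$a_i(\Phi)=\theta_i+\tfrac{\varphi_i}{\theta^\star_i-\theta^\star_{i-1}}+\tfrac{\varphi_{i+1}}{\theta^\star_i-\theta^\star_{i+1}},\quad b_i(\Phi)=\varphi_{i+1}\frac{\prod_{h=0}^{i-1}(\theta^\star_i-\theta^\star_h)}{\prod_{h=0}^{i}(\theta^\star_{i+1}-\theta^\star_h)},\quad c_i(\Phi)=\phi_i\frac{\prod_{h=0}^{d-i-1}(\theta^\star_i-\theta^\star_{d-h})}{\prod_{h=0}^{d-i}(\theta^\star_{i-1}-\theta^\star_{d-h})},$$ with $b_{-1}=b_d=c_0=c_{d+1}=0$. Define $$u_i(\lambda)=\sum_{k=0}^i\prod_{j=0}^{k-1}\frac{(\lambda-\theta_j)(\theta^\star_i-\theta^\star_j)}{\varphi_{j+1}},\qquad k_i(\Phi)=\prod_{h=1}^i\frac{\varphi_h}{\phi_h}\cdot\frac{\prod_{h=1}^d(\theta^\star_0-\theta^\star_h)}{\prod_{0\le h\le d,\,h\ne i}(\theta^\star_i-\theta^\star_h)},$$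 $$p_{xi}(\Phi)=k_i(\Phi)u_i(\theta_x)\ (0\le x,i\le d),\qquad \nu(\Phi)=\prod_{h=1}^d\frac{(\theta_0-\theta_h)(\theta^\star_0-\theta^\star_h)}{\phi_h}.$$ **Compatibility.** Families $(\Phi_j)$, $(\Psi_x)$ of parameter arrays of the displayed form ($\Phi_j$ of diameter $N-j$, $\Psi_x$ of diameter $N-x$) are *compatible* if there are complex numbers $C^{\epsilon,\epsilon'}_{i,j}$ ($(i,j)\in\mathcal D$, independent of $x,y$) and $D^{\epsilon,\epsilon'}_{x,y}$ ($(x,y)\in\mathcal D$, independent of $i,j$), $(\epsilon,\epsilon')\in A_2$ (a superscript $\pm$ stands for $\pm1$; coefficients are set to $0$ when the shifted index $(i+\epsilon,j+\epsilon')$, resp. $(x+\epsilon,y+\epsilon')$, is not in $\mathcal D$), such that for $(i,j)\in\mathcal D$: $$c_{j+1}(\Psi_x)p_{xi}(\Phi_j)=\sum_{\epsilon=-1,0}C^{\epsilon,+}_{i,j}p_{x,i+\epsilon}(\Phi_{j+1})\quad(0\le x\le N-j-1),$$ $$a_j(\Psi_x)p_{xi}(\Phi_j)=\sum_{\epsilon=0,\pm1}C^{\epsilon,0}_{i,j}p_{x,i+\epsilon}(\Phi_j)\quad(0\le x\le N-j),$$ $$b_{j-1}(\Psi_x)p_{xi}(\Phi_j)=\sum_{\epsilon=0,+1}C^{\epsilon,-}_{i,j}p_{x,i+\epsilon}(\Phi_{j-1})\quad(j\ge1,\ 0\le x\le N-j+1),$$ (the last left-hand side being $0$ for $x=N-j+1$);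 for $(x,y)\in\mathcal D$: $$c_{x+1}(\Phi_j^\star)p_{jy}(\Psi_x^\star)=\frac{\nu(\Psi_x)}{\nu(\Psi_{x+1})}\sum_{\epsilon'=-1,0}D^{+,\epsilon'}_{x,y}p_{j,y+\epsilon'}(\Psi^\star_{x+1})\quad(0\le j\le N-x-1),$$ $$a_x(\Phi_j^\star)p_{jy}(\Psi_x^\star)=\sum_{\epsilon'=0,\pm1}D^{0,\epsilon'}_{x,y}p_{j,y+\epsilon'}(\Psi^\star_x)\quad(0\le j\le N-x),$$ $$b_{x-1}(\Phi_j^\star)p_{jy}(\Psi_x^\star)=\frac{\nu(\Psi_x)}{\nu(\Psi_{x-1})}\sum_{\epsilon'=0,+1}D^{-,\epsilon'}_{x,y}p_{j,y+\epsilon'}(\Psi^\star_{x-1})\quad(x\ge1,\ 0\le j\le N-x+1),$$ (the last left-hand side being $0$ for $j=N-x+1$); and if there are functions $F,G$ on $\mathcal D$, $F$ nowhere zero, with $$\frac{k_i(\Phi_j)}{k_x(\Phi^\star_j)}\,\frac{k_j(\Psi_x)}{k_y(\Psi_x^\star)}\,F(x,y)=\frac{G(i,j)}{\nu(\Psi_x)\nu(\Phi_j)}\qquad\text{for all }(x,y),(i,j)\in\mathcal D\text{ with }x+j\le N.$$ *)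

theory Defs
  imports Complex_Main "HOL-Library.Function_Algebras"
begin

definition dom2 :: "nat \<Rightarrow> (nat \<times> nat) set" where
  "dom2 N = {(x, y). x + y \<le> N}"

definition A2 :: "(int \<times> int) set" where
  "A2 = {(0,0), (1,-1), (1,0), (0,1), (-1,1), (-1,0), (0,-1)}"

definition adjacent :: "nat \<times> nat \<Rightarrow> nat \<times> nat \<Rightarrow> bool" where
  "adjacent l m \<longleftrightarrow> (int (fst l) - int (fst m), int (snd l) - int (snd m)) \<in> A2"

definition shift_in :: "nat \<Rightarrow> nat \<times> nat \<Rightarrow> int \<times> int \<Rightarrow> bool" where
  "shift_in N l e \<longleftrightarrow> 0 \<le> int (fst l) + fst e \<and> 0 \<le> int (snd l) + snd e \<and>
     (int (fst l) + fst e) + (int (snd l) + snd e) \<le> int N"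

text \<open>The member of the family \<open>U\<close> with index \<open>l + e\<close>; vectors with index outside
  \<^term>\<open>dom2 N\<close> are \<open>0\<close>.\<close>

definition shifted :: "nat \<Rightarrow> (nat \<times> nat \<Rightarrow> 'v::zero) \<Rightarrow> nat \<times> nat \<Rightarrow> int \<times> int \<Rightarrow> 'v" where
  "shifted N U l e =
     (if shift_in N l e then U (nat (int (fst l) + fst e), nat (int (snd l) + snd e)) else 0)"

text \<open>Only the values \<open>theta i\<close>, \<open>theta_star i\<close> for \<open>i \<le> diam\<close> and \<open>vphi i\<close>, \<open>phi i\<close> for
  \<open>1 \<le> i \<le> diam\<close> are meaningful.\<close>

record param_array =
  diam :: nat
  theta :: "nat \<Rightarrow> complex"
  theta_star :: "nat \<Rightarrow> complex"
  vphi :: "nat \<Rightarrow> complex"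
  phi :: "nat \<Rightarrow> complex"

definition vartheta :: "param_array \<Rightarrow> nat \<Rightarrow> complex" where
  "vartheta P i =
     (\<Sum>h<i. (theta P h - theta P (diam P - h)) / (theta P 0 - theta P (diam P)))"

definition is_param_array :: "param_array \<Rightarrow> bool" where
  "is_param_array P \<longleftrightarrow>
     (\<forall>i\<in>{1..diam P}. vphi P i \<noteq> 0 \<and> phi P i \<noteq> 0) \<and>
     inj_on (theta P) {..diam P} \<and> inj_on (theta_star P) {..diam P} \<and>
     (\<forall>i\<in>{1..diam P}.
        vphi P i = phi P 1 * vartheta P i
          + (theta_star P i - theta_star P 0) * (theta P (i - 1) - theta P (diam P)) \<and>
        phi P i = vphi P 1 * vartheta P i
          + (theta_star P i - theta_star P 0) * (theta P (diam P - i + 1) - theta P 0)) \<and>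
     (\<exists>r. \<forall>i. 2 \<le> i \<and> i + 1 \<le> diam P \<longrightarrow>
        (theta P (i - 2) - theta P (i + 1)) / (theta P (i - 1) - theta P i) = r \<and>
        (theta_star P (i - 2) - theta_star P (i + 1))
          / (theta_star P (i - 1) - theta_star P i) = r)"

definition dual :: "param_array \<Rightarrow> param_array" where
  "dual P = \<lparr> diam = diam P, theta = theta_star P, theta_star = theta P,
              vphi = vphi P, phi = (\<lambda>j. phi P (diam P - j + 1)) \<rparr>"

definition coeff_a :: "param_array \<Rightarrow> nat \<Rightarrow> complex" where
  "coeff_a P i = theta P i
     + (if 1 \<le> i then vphi P i / (theta_star P i - theta_star P (i - 1)) else 0)
     + (if i < diam P then vphi P (i + 1) / (theta_star P i - theta_star P (i + 1)) else 0)"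

text \<open>The index \<open>-1\<close> does not occur: wherever \<open>b\<^sub>-\<^sub>1\<close> is written in the literature,
  it multiplies a vector with index outside \<^term>\<open>dom2 N\<close>.\<close>

definition coeff_b :: "param_array \<Rightarrow> nat \<Rightarrow> complex" where
  "coeff_b P i = (if i < diam P then
       vphi P (i + 1) * ((\<Prod>h<i. theta_star P i - theta_star P h)
         / (\<Prod>h\<le>i. theta_star P (i + 1) - theta_star P h))
     else 0)"

definition coeff_c :: "param_array \<Rightarrow> nat \<Rightarrow> complex" where
  "coeff_c P i = (if 1 \<le> i \<and> i \<le> diam P then
       phi P i * ((\<Prod>h<diam P - i. theta_star P i - theta_star P (diam P - h))
         / (\<Prod>h\<le>diam P - i. theta_star P (i - 1) - theta_star P (diam P - h)))
     else 0)"

definition u_fun :: "param_array \<Rightarrow> nat \<Rightarrow> complex \<Rightarrow> complex" where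
  "u_fun P i z =
     (\<Sum>k\<le>i. \<Prod>j<k. (z - theta P j) * (theta_star P i - theta_star P j) / vphi P (j + 1))"

definition k_par :: "param_array \<Rightarrow> nat \<Rightarrow> complex" where
  "k_par P i = (\<Prod>h=1..i. vphi P h / phi P h) *
     ((\<Prod>h=1..diam P. theta_star P 0 - theta_star P h)
       / (\<Prod>h\<in>{..diam P} - {i}. theta_star P i - theta_star P h))"

definition p_par :: "param_array \<Rightarrow> nat \<Rightarrow> nat \<Rightarrow> complex" where
  "p_par P x i = k_par P i * u_fun P i (theta P x)"

definition nu_par :: "param_array \<Rightarrow> complex" where
  "nu_par P =
     (\<Prod>h=1..diam P. (theta P 0 - theta P h) * (theta_star P 0 - theta_star P h) / phi P h)"

text \<open>\<open>C (e, e') (i, j)\<close> stands for $C^{e,e'}_{i,j}$. In the sums below a term whose shifted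
  index is not in \<^term>\<open>dom2 N\<close> has a zero coefficient, so the value of \<^const>\<open>nat\<close> at a
  negative argument is irrelevant.\<close>

definition compat_coeffs ::
    "nat \<Rightarrow> (nat \<Rightarrow> param_array) \<Rightarrow> (nat \<Rightarrow> param_array) \<Rightarrow>
     (int \<times> int \<Rightarrow> nat \<times> nat \<Rightarrow> complex) \<Rightarrow> (int \<times> int \<Rightarrow> nat \<times> nat \<Rightarrow> complex) \<Rightarrow> bool" where
  "compat_coeffs N \<Phi> \<Psi> C D \<longleftrightarrow>
     (\<forall>e\<in>A2. \<forall>l\<in>dom2 N. \<not> shift_in N l e \<longrightarrow> C e l = 0 \<and> D e l = 0) \<and>
     (\<forall>(i, j)\<in>dom2 N.
        (\<forall>x. x + j + 1 \<le> N \<longrightarrow>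
           coeff_c (\<Psi> x) (j + 1) * p_par (\<Phi> j) x i =
           (\<Sum>e\<in>{-1, 0}. C (e, 1) (i, j) * p_par (\<Phi> (j + 1)) x (nat (int i + e)))) \<and>
        (\<forall>x. x + j \<le> N \<longrightarrow>
           coeff_a (\<Psi> x) j * p_par (\<Phi> j) x i =
           (\<Sum>e\<in>{-1, 0, 1}. C (e, 0) (i, j) * p_par (\<Phi> j) x (nat (int i + e)))) \<and>
        (\<forall>x. 1 \<le> j \<and> x + j \<le> N + 1 \<longrightarrow>
           coeff_b (\<Psi> x) (j - 1) * p_par (\<Phi> j) x i =
           (\<Sum>e\<in>{0, 1}. C (e, -1) (i, j) * p_par (\<Phi> (j - 1)) x (nat (int i + e))))) \<and>
     (\<forall>(x, y)\<in>dom2 N.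
        (\<forall>j. j + x + 1 \<le> N \<longrightarrow>
           coeff_c (dual (\<Phi> j)) (x + 1) * p_par (dual (\<Psi> x)) j y =
           nu_par (\<Psi> x) / nu_par (\<Psi> (x + 1)) *
           (\<Sum>e\<in>{-1, 0}. D (1, e) (x, y) * p_par (dual (\<Psi> (x + 1))) j (nat (int y + e)))) \<and>
        (\<forall>j. j + x \<le> N \<longrightarrow>
           coeff_a (dual (\<Phi> j)) x * p_par (dual (\<Psi> x)) j y =
           (\<Sum>e\<in>{-1, 0, 1}. D (0, e) (x, y) * p_par (dual (\<Psi> x)) j (nat (int y + e)))) \<and>
        (\<forall>j. 1 \<le> x \<and> j + x \<le> N + 1 \<longrightarrow>
           coeff_b (dual (\<Phi> j)) (x - 1) * p_par (dual (\<Psi> x)) j y =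
           nu_par (\<Psi> x) / nu_par (\<Psi> (x - 1)) *
           (\<Sum>e\<in>{0, 1}. D (-1, e) (x, y) * p_par (dual (\<Psi> (x - 1))) j (nat (int y + e)))))"

definition compatible ::
    "nat \<Rightarrow> (nat \<Rightarrow> param_array) \<Rightarrow> (nat \<Rightarrow> param_array) \<Rightarrow> bool" where
  "compatible N \<Phi> \<Psi> \<longleftrightarrow>
     (\<exists>C D. compat_coeffs N \<Phi> \<Psi> C D) \<and>
     (\<exists>F G :: nat \<times> nat \<Rightarrow> complex.
        (\<forall>l\<in>dom2 N. F l \<noteq> 0) \<and>
        (\<forall>(x, y)\<in>dom2 N. \<forall>(i, j)\<in>dom2 N. x + j \<le> N \<longrightarrow>
           k_par (\<Phi> j) i / k_par (dual (\<Phi> j)) x * (k_par (\<Psi> x) j / k_par (dual (\<Psi> x)) y)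
             * F (x, y)
           = G (i, j) / (nu_par (\<Psi> x) * nu_par (\<Phi> j))))"

text \<open>Since the dimension of the space varies with \<open>N\<close>, a complex vector space is given by a
  carrier \<open>V\<close> that is a subspace of an ambient type with scalar multiplication \<open>scale\<close>.\<close>

locale complex_space =
  vector_space scale for scale :: "complex \<Rightarrow> 'v::ab_group_add \<Rightarrow> 'v" (infixr "*s" 75) +
  fixes V :: "'v set"
  assumes subspace_carrier: "subspace V"
begin

sublocale maps: vector_space "\<lambda>c (f::'v \<Rightarrow> 'v) v. c *s f v"
  by unfold_locales (auto simp: fun_eq_iff algebra_simps)

text \<open>An endomorphism of \<open>V\<close> is represented by the function that extends it by \<open>0\<close> outside
  \<open>V\<close>. In this way endomorphisms are equal iff they agree on \<open>V\<close>, and $\mathrm{End}(V)$ is a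
  linear subspace, closed under composition, of the space of all maps.\<close>

definition endos :: "('v \<Rightarrow> 'v) set" where
  "endos = {f. (\<forall>v\<in>V. f v \<in> V) \<and> (\<forall>u\<in>V. \<forall>v\<in>V. f (u + v) = f u + f v) \<and>
               (\<forall>c. \<forall>v\<in>V. f (c *s v) = c *s f v) \<and> (\<forall>v. v \<notin> V \<longrightarrow> f v = 0)}"

definition basis_family :: "(nat \<times> nat \<Rightarrow> 'v) \<Rightarrow> (nat \<times> nat) set \<Rightarrow> bool" where
  "basis_family U I \<longleftrightarrow> inj_on U I \<and> independent (U ` I) \<and> span (U ` I) = V"

definition diagonalizable :: "('v \<Rightarrow> 'v) \<Rightarrow> bool" where
  "diagonalizable f \<longleftrightarrow>
     (\<exists>B. independent B \<and> span B = V \<and> (\<forall>b\<in>B. \<exists>c. f b = c *s b))"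

definition common_eigenspace :: "('v \<Rightarrow> 'v) set \<Rightarrow> 'v set \<Rightarrow> bool" where
  "common_eigenspace H W \<longleftrightarrow>
     W \<noteq> {0} \<and> (\<exists>ev. W = {v\<in>V. \<forall>h\<in>H. h v = ev h *s v})"

definition nondeg_sym_bilinear_form :: "('v \<Rightarrow> 'v \<Rightarrow> complex) \<Rightarrow> bool" where
  "nondeg_sym_bilinear_form form \<longleftrightarrow>
     (\<forall>u\<in>V. \<forall>v\<in>V. \<forall>w\<in>V. form (u + v) w = form u w + form v w) \<and>
     (\<forall>c. \<forall>u\<in>V. \<forall>w\<in>V. form (c *s u) w = c * form u w) \<and>
     (\<forall>u\<in>V. \<forall>w\<in>V. form u w = form w u) \<and>
     (\<forall>u\<in>V. (\<forall>w\<in>V. form u w = 0) \<longrightarrow> u = 0)"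

definition form_nonzero :: "('v \<Rightarrow> 'v \<Rightarrow> complex) \<Rightarrow> 'v set \<Rightarrow> 'v set \<Rightarrow> bool" where
  "form_nonzero form U W \<longleftrightarrow> (\<exists>u\<in>U. \<exists>w\<in>W. form u w \<noteq> 0)"

definition diagonalizable_plane :: "('v \<Rightarrow> 'v) set \<Rightarrow> bool" where
  "diagonalizable_plane H \<longleftrightarrow>
     H \<subseteq> endos \<and> maps.subspace H \<and> maps.dim H = 2 \<and>
     (\<forall>h\<in>H. diagonalizable h) \<and> (\<forall>g\<in>H. \<forall>h\<in>H. g \<circ> h = h \<circ> g)"

text \<open>\<open>(H, Hs)\<close> is an $A_2$-Leonard pair iff this holds for some labellings \<open>E\<close>, \<open>Es\<close> of the
  common eigenspaces and some bilinear form. These data are arguments because the factorized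
  case imposes further conditions on the same ones.\<close>

definition A2_leonard_pair ::
    "nat \<Rightarrow> ('v \<Rightarrow> 'v) set \<Rightarrow> ('v \<Rightarrow> 'v) set \<Rightarrow>
     (nat \<times> nat \<Rightarrow> 'v set) \<Rightarrow> (nat \<times> nat \<Rightarrow> 'v set) \<Rightarrow> ('v \<Rightarrow> 'v \<Rightarrow> complex) \<Rightarrow> bool" where
  "A2_leonard_pair N H Hs E Es form \<longleftrightarrow>
     diagonalizable_plane H \<and> diagonalizable_plane Hs \<and>
     bij_betw E (dom2 N) {W. common_eigenspace H W} \<and>
     (\<forall>l\<in>dom2 N. \<forall>h\<in>Hs. h ` E l \<subseteq> span (\<Union>m\<in>{m\<in>dom2 N. adjacent m l}. E m)) \<and>
     bij_betw Es (dom2 N) {W. common_eigenspace Hs W} \<and>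
     (\<forall>l\<in>dom2 N. \<forall>h\<in>H. h ` Es l \<subseteq> span (\<Union>m\<in>{m\<in>dom2 N. adjacent m l}. Es m)) \<and>
     \<not> (\<exists>W. subspace W \<and> W \<subseteq> V \<and> W \<noteq> {0} \<and> W \<noteq> V \<and> (\<forall>h\<in>H \<union> Hs. h ` W \<subseteq> W)) \<and>
     (\<forall>l\<in>dom2 N. dim (E l) = 1 \<and> dim (Es l) = 1) \<and>
     nondeg_sym_bilinear_form form \<and>
     (\<forall>l\<in>dom2 N. \<forall>m\<in>dom2 N. l \<noteq> m \<longrightarrow>
        \<not> form_nonzero form (E l) (E m) \<and> \<not> form_nonzero form (Es l) (Es m))"

text \<open>\<open>(H, Hs)\<close> is a factorized $A_2$-Leonard pair with basis \<open>(X, Y; Xs, Ys)\<close>, the common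
  eigenspaces being labelled by \<open>E\<close> and \<open>Es\<close>.\<close>

definition factorized_A2_leonard_pair ::
    "nat \<Rightarrow> ('v \<Rightarrow> 'v) set \<Rightarrow> ('v \<Rightarrow> 'v) set \<Rightarrow>
     ('v \<Rightarrow> 'v) \<Rightarrow> ('v \<Rightarrow> 'v) \<Rightarrow> ('v \<Rightarrow> 'v) \<Rightarrow> ('v \<Rightarrow> 'v) \<Rightarrow>
     (nat \<times> nat \<Rightarrow> 'v set) \<Rightarrow> (nat \<times> nat \<Rightarrow> 'v set) \<Rightarrow> bool" where
  "factorized_A2_leonard_pair N H Hs X Y Xs Ys E Es \<longleftrightarrow>
     (\<exists>form. A2_leonard_pair N H Hs E Es form \<and>
        X \<noteq> Y \<and> maps.independent {X, Y} \<and> maps.span {X, Y} = H \<and>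
        Xs \<noteq> Ys \<and> maps.independent {Xs, Ys} \<and> maps.span {Xs, Ys} = Hs \<and>
        (\<exists>t. inj_on t {..N} \<and> (\<forall>(x, y)\<in>dom2 N. \<forall>v\<in>E (x, y). X v = t x *s v)) \<and>
        (\<exists>s. inj_on s {..N} \<and> (\<forall>(i, j)\<in>dom2 N. \<forall>v\<in>Es (i, j). Ys v = s j *s v)) \<and>
        X \<circ> Ys = Ys \<circ> X \<and>
        (\<forall>W. common_eigenspace {X, Ys} W \<longrightarrow> dim W = 1) \<and>
        (\<forall>i j. (i, j) \<in> dom2 N \<and> (i + 1, j) \<in> dom2 N \<longrightarrow>
           form_nonzero form (Es (i + 1, j)) (X ` Es (i, j)) \<and>
           form_nonzero form (Es (i, j)) (X ` Es (i + 1, j))) \<and>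
        (\<forall>x y. (x, y) \<in> dom2 N \<and> (x, y + 1) \<in> dom2 N \<longrightarrow>
           form_nonzero form (E (x, y + 1)) (Ys ` E (x, y)) \<and>
           form_nonzero form (E (x, y)) (Ys ` E (x, y + 1))))"

end

text \<open>The ambient space in which the existence of \<open>V\<close> is asserted. It is infinite-dimensional,
  so it contains a copy of every finite-dimensional complex vector space.\<close>

type_synonym ambient = "nat \<times> nat \<Rightarrow> complex"

definition ascale :: "complex \<Rightarrow> ambient \<Rightarrow> ambient" (infixr "*a" 75) where
  "c *a v = (\<lambda>l. c * v l)"

lemma vector_space_ascale: "vector_space ascale"
  by unfold_locales (auto simp: ascale_def fun_eq_iff algebra_simps)

end

theory Submission
  imports Defs
begin

text \<open>
  Let $V$ have a basis $V_{x,y}$ and put $W_{x,j} = \sum_y p_{yj}(\Psi_x) V_{x,y}$ and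
  $V^\star_{i,j} = \sum_x p_{xi}(\Phi_j) W_{x,j}$. For a parameter array $\Phi$ the matrix $p(\Phi)$
  satisfies a three-term recurrence in each index, and $p(\Phi)\,p(\Phi^\star) = \nu(\Phi)$. Hence the three
  families are bases, $X$ and $Y^\star$ are diagonal on $W_{x,j}$, and $Y$ and $X^\star$ act tridiagonally
  there. The compatibility equations say precisely that the latter two actions, carried over to
  $V^\star_{i,j}$ and $V_{x,y}$, have the coefficients $C$ and $D$. The condition on $F$ and $G$ provides a
  bilinear form for which all three bases are orthogonal. A subspace invariant under all operators is
  spanned by basis vectors of either kind, and the nonzero coefficients $b_i$, $c_i$ connect all of
  them, so it is trivial.

  The facts on parameter arrays follow from the recurrences of $\theta$ and $\theta^\star$ alone. In the
  split basis the Askey--Wilson relation says that, for fixed $i$, the defect of the three-term recurrence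
  of $u_i$ is a solution of a second-order recurrence in the Newton index $k$; it vanishes for large $k$ and
  therefore everywhere. This gives $a_i$ and $b_i$, and applying it to $\Phi^{\downarrow}$ gives $c_i$.
\<close>

section \<open>Three-term recurrences with constant coefficients\<close>

text \<open>The formulas of a parameter array degenerate at its two ends, and closed forms of its
  sequences depend on whether \<beta> is 2, -2 or neither. Both difficulties are avoided by
  extending all sequences to infinite solutions of \<open>rec3\<close>, where the identities needed
  are polynomial consequences of the recurrence. A solution with unknown constant term has three
  degrees of freedom; its values at 0, 1 and d determine it, because \<open>th i - th 0\<close> is a
  solution without zeros in 1..d. The linear relations between \<theta>, its dual and their partial
  sums are proved in this way. The form can exist because the norm of \<open>WW (x, j)\<close> has
  two expressions: F(x, 0) k_j(\<Psi>_x) \<nu>(\<Psi>_x), and a factor depending on j alone times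
  the dual weight of \<Phi>_j at x. The condition on F and G at y = 0, i = 0 equates them. The
  quotients of \<nu> in the equations for D come from inverting p(\<Psi>_x): the expansion of
  \<open>UU (x, y)\<close> in the vectors \<open>WW (x, j)\<close> carries the factor 1 /
  \<nu>(\<Psi>_x).\<close>

definition rec3 :: "complex \<Rightarrow> complex \<Rightarrow> (nat \<Rightarrow> complex) \<Rightarrow> bool" where
  "rec3 \<beta> \<gamma> s \<longleftrightarrow> (\<forall>k. s (Suc (Suc k)) = \<beta> * s (Suc k) - s k + \<gamma>)"

lemma rec3D: "rec3 \<beta> \<gamma> s \<Longrightarrow> s (Suc (Suc k)) = \<beta> * s (Suc k) - s k + \<gamma>"
  by (simp add: rec3_def)

fun rec3_seq :: "complex \<Rightarrow> complex \<Rightarrow> complex \<Rightarrow> complex \<Rightarrow> nat \<Rightarrow> complex" where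
  "rec3_seq \<beta> \<gamma> a b 0 = a"
| "rec3_seq \<beta> \<gamma> a b (Suc 0) = b"
| "rec3_seq \<beta> \<gamma> a b (Suc (Suc n)) = \<beta> * rec3_seq \<beta> \<gamma> a b (Suc n) - rec3_seq \<beta> \<gamma> a b n + \<gamma>"

text \<open>Once the data are continued by the recurrence, later identities carry no range condition
  on the index. The values beyond \<open>m\<close> have no meaning of their own.\<close>

lemma rec3_extend:
  assumes "\<And>i. i + 2 \<le> m \<Longrightarrow> f (i + 2) = \<beta> * f (i + 1) - f i + \<gamma>"
  obtains s where "rec3 \<beta> \<gamma> s" "\<And>i. i \<le> m \<Longrightarrow> s i = f i"
proof
  show "rec3 \<beta> \<gamma> (rec3_seq \<beta> \<gamma> (f 0) (f 1))"
    by (simp add: rec3_def)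
  show "rec3_seq \<beta> \<gamma> (f 0) (f 1) i = f i" if "i \<le> m" for i
    using that
  proof (induction i rule: induct_nat_012)
    case (ge2 n)
    then show ?case using assms[of n] by simp
  qed auto
qed

lemma rec3_shift: "rec3 \<beta> \<gamma> s \<Longrightarrow> rec3 \<beta> ((\<beta> - 2) * a + \<gamma>) (\<lambda>k. s (Suc k) - a)"
  by (simp add: rec3_def algebra_simps)

lemma rec3_lincomb:
  assumes "rec3 \<beta> \<gamma> s" "rec3 \<beta> \<delta> t"
  shows "rec3 \<beta> (a * \<gamma> + b * \<delta>) (\<lambda>k. a * s k + b * t k)"
  unfolding rec3_def[of _ _ "\<lambda>k. a * s k + b * t k"]
  by (simp add: rec3D[OF assms(1)] rec3D[OF assms(2)] algebra_simps)

text \<open>The right-hand side is a discrete Wronskian. It grows by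
  \<open>\<gamma> * t i - \<delta> * s i\<close> at each step, and so does the left-hand side: both
  members of \<open>step\<close> solve the homogeneous recurrence with the same two initial
  values.\<close>

lemma rec3_wronskian:
  assumes s: "rec3 \<beta> \<gamma> s" "s 0 = 0" and t: "rec3 \<beta> \<delta> t" "t 0 = 0"
  shows "t 1 * s (Suc i) - t (Suc i) * s 1 = t i * s (Suc i) - t (Suc i) * s i"
proof -
  have step: "t 1 * (s (Suc i) - s i) - s 1 * (t (Suc i) - t i) = \<gamma> * t i - \<delta> * s i" for i
  proof (induction i rule: induct_nat_012)
    case (ge2 n)
    then show ?case
      using rec3D[OF s(1), of n] rec3D[OF s(1), of "Suc n"] rec3D[OF t(1), of n] rec3D[OF t(1), of "Suc n"]
      by algebra
  qed (use s t rec3D[OF s(1), of 0] rec3D[OF t(1), of 0] in \<open>simp_all add: algebra_simps\<close>)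
  show ?thesis
  proof (induction i)
    case (Suc i)
    then show ?case
      using step[of "Suc i"] rec3D[OF s(1), of i] rec3D[OF t(1), of i] by algebra
  qed (simp add: s t)
qed

text \<open>Three zeros at 0, 1 and d need not force a solution with free constant term to vanish.
  They do so if some solution \<open>D\<close> vanishes at 0 but nowhere in 1..d: the Wronskian
  relation then reads \<open>D (Suc n) * Z n = 0\<close>, and the zero at d is propagated
  downwards.\<close>

lemma rec3_eq_zero:
  assumes D: "rec3 \<beta> \<delta> D" "D 0 = 0" "\<And>i. 1 \<le> i \<Longrightarrow> i \<le> d \<Longrightarrow> D i \<noteq> 0"
    and Z: "rec3 \<beta> \<gamma> Z" "Z 0 = 0" "Z 1 = 0" "Z d = 0" and "i \<le> d"
  shows "Z i = 0"
  using \<open>i \<le> d\<close>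
proof (induction i rule: inc_induct)
  case (step n)
  have "D (Suc n) * Z n = 0"
    using rec3_wronskian[OF Z(1,2) D(1,2), of n] Z step by simp
  then show ?case using D(3)[of "Suc n"] step by simp
qed (use Z in simp)

lemma rec3_invariant:
  assumes "rec3 \<beta> \<gamma> s"
  shows "s i * s (Suc (Suc i)) - (s (Suc i) ^ 2 - \<gamma> * s (Suc i))
       = s 0 * s (Suc (Suc 0)) - (s (Suc 0) ^ 2 - \<gamma> * s (Suc 0))"
proof (induction i)
  case (Suc i)
  then show ?case using rec3D[OF assms, of i] rec3D[OF assms, of "Suc i"] by algebra
qed simp

text \<open>Both sides are the value at (s (i + 1), s (k + 1)) of the symmetric polynomial x^2 -
  \<beta> x y + y^2 - \<gamma> (x + y) + \<rho>, where \<rho> is the invariant above. As a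
  polynomial in y with x = s (i + 1) its roots are s i and s (i + 2).\<close>

lemma rec3_symmetric_factor:
  assumes s: "rec3 \<beta> \<gamma> s"
  shows "(s (Suc k) - s i) * (s (Suc k) - s (Suc (Suc i)))
       = (s (Suc i) - s k) * (s (Suc i) - s (Suc (Suc k)))"
  using rec3_invariant[OF s, of i] rec3_invariant[OF s, of k] rec3D[OF s, of i] rec3D[OF s, of k]
  by algebra

text \<open>A component of the Askey--Wilson relation in a split basis: the left-hand side \<open>E k\<close> is
  independent of \<open>k\<close> for every \<open>T\<close>. Since \<open>E k\<close> and \<open>E (k + 1)\<close> agree at \<open>T = s (k + 2)\<close> and have
  the same leading coefficient, only their linear coefficients have to be compared.\<close>

lemma askey_wilson_split:
  fixes e s S :: "nat \<Rightarrow> complex" and p u v w :: complex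
  assumes e: "rec3 \<beta> \<gamma> e" and s: "rec3 \<beta> \<gamma>' s" and S: "rec3 \<beta> c S"
  defines "F \<equiv> \<lambda>k. p * S k + (s (Suc k) - u) * (e k - v)"
  defines "l \<equiv> \<lambda>k T. F k + e (Suc k) * (T - s k)"
  defines "E \<equiv> \<lambda>k T. (T - s (Suc k)) * l (Suc (Suc k)) T
     + (s (Suc (Suc k)) + s (Suc k) - \<beta> * T - \<gamma>') * l (Suc k) T + (T - s (Suc (Suc k))) * l k T"
  shows "E (Suc k) T = E k T"
  unfolding E_def l_def F_def
  using rec3D[OF e, of k] rec3D[OF e, of "Suc k"] rec3D[OF e, of "Suc (Suc k)"]
    rec3D[OF s, of k] rec3D[OF s, of "Suc k"] rec3D[OF s, of "Suc (Suc k)"]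
    rec3D[OF S, of k] rec3D[OF S, of "Suc k"]
  by algebra

section \<open>Parameter arrays\<close>

lemma diam_dual [simp]: "diam (dual P) = diam P"
  and theta_dual [simp]: "theta (dual P) = theta_star P"
  and theta_star_dual [simp]: "theta_star (dual P) = theta P"
  and vphi_dual [simp]: "vphi (dual P) = vphi P"
  and phi_dual [simp]: "phi (dual P) j = phi P (diam P - j + 1)"
  by (simp_all add: dual_def)

lemmas dual_simps = diam_dual theta_dual theta_star_dual vphi_dual phi_dual

locale leonard_array =
  fixes P :: param_array
  assumes PA: "is_param_array P"
begin

abbreviation "d \<equiv> diam P"
abbreviation "th \<equiv> theta P"
abbreviation "st \<equiv> theta_star P"
abbreviation "vp \<equiv> vphi P"
abbreviation "ph \<equiv> phi P"

lemma param_array_conds: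
  "\<forall>i. 1 \<le> i \<and> i \<le> d \<longrightarrow> vp i \<noteq> 0 \<and> ph i \<noteq> 0"
  "inj_on th {..d}" "inj_on st {..d}"
  "\<forall>i. 1 \<le> i \<and> i \<le> d \<longrightarrow>
     vp i = ph 1 * vartheta P i + (st i - st 0) * (th (i - 1) - th d) \<and>
     ph i = vp 1 * vartheta P i + (st i - st 0) * (th (d - i + 1) - th 0)"
  using PA unfolding is_param_array_def Ball_def atLeastAtMost_iff by - (elim conjE, assumption)+

lemma vp_nz: "1 \<le> i \<Longrightarrow> i \<le> d \<Longrightarrow> vp i \<noteq> 0"
  and ph_nz: "1 \<le> i \<Longrightarrow> i \<le> d \<Longrightarrow> ph i \<noteq> 0"
  using param_array_conds(1) by auto

lemma th_eq_iff: "i \<le> d \<Longrightarrow> j \<le> d \<Longrightarrow> th i = th j \<longleftrightarrow> i = j"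
  and st_eq_iff: "i \<le> d \<Longrightarrow> j \<le> d \<Longrightarrow> st i = st j \<longleftrightarrow> i = j"
  using param_array_conds(2,3) by (auto simp: inj_on_def)

lemma vp_eq: "1 \<le> i \<Longrightarrow> i \<le> d \<Longrightarrow>
    vp i = ph 1 * vartheta P i + (st i - st 0) * (th (i - 1) - th d)"
  using param_array_conds(4) by blast

lemma ph_eq: "1 \<le> i \<Longrightarrow> i \<le> d \<Longrightarrow>
    ph i = vp 1 * vartheta P i + (st i - st 0) * (th (d - i + 1) - th 0)"
  using param_array_conds(4) by blast

lemma param_array_ratio:
  obtains r where
    "\<And>i. 2 \<le> i \<Longrightarrow> i + 1 \<le> d \<Longrightarrow> (th (i - 2) - th (i + 1)) / (th (i - 1) - th i) = r"
    "\<And>i. 2 \<le> i \<Longrightarrow> i + 1 \<le> d \<Longrightarrow> (st (i - 2) - st (i + 1)) / (st (i - 1) - st i) = r"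
  using PA unfolding is_param_array_def by blast

abbreviation S :: "nat \<Rightarrow> complex" where "S i \<equiv> \<Sum>h<i. th h - th (d - h)"
abbreviation S' :: "nat \<Rightarrow> complex" where "S' i \<equiv> \<Sum>h<i. st h - st (d - h)"

lemma vartheta_eq: "vartheta P i = S i / (th 0 - th d)"
  by (simp add: vartheta_def sum_divide_distrib)

text \<open>The summand changes sign under h \<mapsto> d - h, so the full sum vanishes and
  complementary partial sums agree.\<close>

lemma sum_reflect:
  fixes f :: "nat \<Rightarrow> complex"
  shows "(\<Sum>h<Suc d. f h - f (d - h)) = 0"
    and "i \<le> Suc d \<Longrightarrow> (\<Sum>h<Suc d - i. f h - f (d - h)) = (\<Sum>h<i. f h - f (d - h))"
proof -
  show *: "(\<Sum>h<Suc d. f h - f (d - h)) = 0"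
    using sum.nat_diff_reindex[of f "Suc d"] by (simp add: sum_subtractf)
  assume i: "i \<le> Suc d"
  define g where "g h = f h - f (d - h)" for h
  have "sum g {..<Suc d} = sum g {..<i} + sum g {i..<Suc d}"
    using i by (metis lessThan_atLeast0 le0 sum.atLeastLessThan_concat)
  moreover have "sum g {i..<Suc d} = (\<Sum>h<Suc d - i. g (d - h))"
    by (rule sum.reindex_bij_witness[of _ "\<lambda>h. d - h" "\<lambda>h. d - h"]) auto
  moreover have "(\<Sum>h<Suc d - i. g (d - h)) = - sum g {..<Suc d - i}"
    unfolding g_def by (auto simp: sum_negf[symmetric] intro!: sum.cong)
  ultimately show "(\<Sum>h<Suc d - i. f h - f (d - h)) = (\<Sum>h<i. f h - f (d - h))"
    using * unfolding g_def by simp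
qed

text \<open>The sequences of a parameter array extend to solutions of linear recurrences without end
  conditions; \<open>e\<close> and \<open>s\<close> also contain a value with index \<open>-1\<close>, so they are shifted by one.\<close>

lemma extended_sequences:
  assumes "1 \<le> d"
  obtains \<beta> \<gamma> \<gamma>' c c' e s R R'
  where "rec3 \<beta> \<gamma> e" "rec3 \<beta> \<gamma>' s" "rec3 \<beta> c R" "rec3 \<beta> c' R'"
    "\<And>i. i \<le> d \<Longrightarrow> e (Suc i) = th i" "\<And>i. i \<le> d \<Longrightarrow> s (Suc i) = st i"
    "\<And>i. i \<le> Suc d \<Longrightarrow> R i = S i" "\<And>i. i \<le> Suc d \<Longrightarrow> R' i = S' i"
proof -
  obtain r where r: "\<And>i. 2 \<le> i \<Longrightarrow> i + 1 \<le> d \<Longrightarrow> (th (i - 2) - th (i + 1)) / (th (i - 1) - th i) = r"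
    "\<And>i. 2 \<le> i \<Longrightarrow> i + 1 \<le> d \<Longrightarrow> (st (i - 2) - st (i + 1)) / (st (i - 1) - st i) = r"
    using param_array_ratio by blast
  \<comment> \<open>The equality of the ratios with r says exactly that f (i + 1) - (r - 1) f i + f
    (i - 1) does not depend on i.\<close>
  define \<beta> where "\<beta> = r - 1"
  have step: "\<exists>\<gamma> c e R. rec3 \<beta> \<gamma> e \<and> rec3 \<beta> c R \<and> (\<forall>i\<le>d. e (Suc i) = f i) \<and>
      (\<forall>i\<le>Suc d. R i = (\<Sum>h<i. f h - f (d - h)))"
    if f: "\<forall>i. 2 \<le> i \<and> i + 1 \<le> d \<longrightarrow> f (i - 2) - f (i + 1) = r * (f (i - 1) - f i)"
    for f :: "nat \<Rightarrow> complex"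
  proof -
    \<comment> \<open>For d = 1 the entry \<open>f 2\<close> lies outside the array. Any constant
      serves in this case, since the value at index -1 is adapted to it.\<close>
    define \<gamma> where "\<gamma> = f 0 - \<beta> * f 1 + f (Suc (Suc 0))"
    have rec: "f (i + 2) = \<beta> * f (i + 1) - f i + \<gamma>" if "i + 2 \<le> d" for i
      using that
    proof (induction i)
      case (Suc i)
      then have "f (Suc (Suc i)) = (r - 1) * f (Suc i) - f i + \<gamma>"
        by (simp add: \<beta>_def)
      moreover have "f i - f (Suc (Suc (Suc i))) = r * (f (Suc i) - f (Suc (Suc i)))"
        using f[rule_format, of "i + 2"] Suc.prems by simp
      ultimately have "f (Suc (Suc (Suc i))) = (r - 1) * f (Suc (Suc i)) - f (Suc i) + \<gamma>"
        by algebra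
      then show ?case by (simp add: \<beta>_def)
    qed (simp add: \<gamma>_def algebra_simps)
    define f' where "f' i = (case i of 0 \<Rightarrow> \<beta> * f 0 - f 1 + \<gamma> | Suc i \<Rightarrow> f i)" for i
    have "f' (i + 2) = \<beta> * f' (i + 1) - f' i + \<gamma>" if "i + 2 \<le> Suc d" for i
      using that rec[of "i - 1"] by (cases i) (simp_all add: f'_def)
    then obtain e where e: "rec3 \<beta> \<gamma> e" "\<And>i. i \<le> Suc d \<Longrightarrow> e i = f' i"
      using rec3_extend[of "Suc d" f' \<beta> \<gamma>] by blast
    define \<delta> where "\<delta> h = f h - f (d - h)" for h
    \<comment> \<open>The reversed sequence obeys the same recurrence, so \<gamma> cancels. The
      partial sums of \<delta> acquire a constant \<open>c\<close> of their own.\<close>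
    have \<delta>: "\<delta> (i + 2) = \<beta> * \<delta> (i + 1) - \<delta> i" if "i + 2 \<le> d" for i
    proof -
      have "d - (i + 2) + 2 = d - i" "d - (i + 2) + 1 = d - (i + 1)" using that by auto
      then show ?thesis
        using rec[of i] rec[of "d - (i + 2)"] that unfolding \<delta>_def by (simp add: algebra_simps)
    qed
    define c where "c = sum \<delta> {..<Suc (Suc 0)} - \<beta> * sum \<delta> {..<1}"
    have "sum \<delta> {..<i + 2} = \<beta> * sum \<delta> {..<i + 1} - sum \<delta> {..<i} + c" if "i + 2 \<le> Suc d" for i
      using that
    proof (induction i)
      case (Suc i)
      then show ?case using \<delta>[of i] by (simp, algebra)
    qed (simp add: c_def)
    then obtain R where "rec3 \<beta> c R" "\<And>i. i \<le> Suc d \<Longrightarrow> R i = sum \<delta> {..<i}"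
      using rec3_extend[of "Suc d" "\<lambda>i. sum \<delta> {..<i}" \<beta> c] by blast
    moreover have "e (Suc i) = f i" if "i \<le> d" for i
      using e(2)[of "Suc i"] that by (simp add: f'_def)
    ultimately show ?thesis
      using e(1) unfolding \<delta>_def by blast
  qed
  have "\<forall>i. 2 \<le> i \<and> i + 1 \<le> d \<longrightarrow> th (i - 2) - th (i + 1) = r * (th (i - 1) - th i)"
  proof (intro allI impI)
    fix i
    assume i: "2 \<le> i \<and> i + 1 \<le> d"
    then have "i - 1 \<le> d" "i \<le> d" "i - 1 \<noteq> i" by auto
    then have "th (i - 1) - th i \<noteq> 0" using th_eq_iff by simp
    then show "th (i - 2) - th (i + 1) = r * (th (i - 1) - th i)"
      using r(1)[of i] i by (simp add: divide_eq_eq)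
  qed
  note A = step[OF this]
  have "\<forall>i. 2 \<le> i \<and> i + 1 \<le> d \<longrightarrow> st (i - 2) - st (i + 1) = r * (st (i - 1) - st i)"
  proof (intro allI impI)
    fix i
    assume i: "2 \<le> i \<and> i + 1 \<le> d"
    then have "i - 1 \<le> d" "i \<le> d" "i - 1 \<noteq> i" by auto
    then have "st (i - 1) - st i \<noteq> 0" using st_eq_iff by simp
    then show "st (i - 2) - st (i + 1) = r * (st (i - 1) - st i)"
      using r(2)[of i] i by (simp add: divide_eq_eq)
  qed
  note B = step[OF this]
  from A obtain \<gamma> c e R where "rec3 \<beta> \<gamma> e" "rec3 \<beta> c R" "\<forall>i\<le>d. e (Suc i) = th i" "\<forall>i\<le>Suc d. R i = S i"
    by blast
  moreover from B obtain \<gamma>' c' s R' where "rec3 \<beta> \<gamma>' s" "rec3 \<beta> c' R'" "\<forall>i\<le>d. s (Suc i) = st i"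
    "\<forall>i\<le>Suc d. R' i = S' i"
    by blast
  ultimately show ?thesis using that[of \<beta> \<gamma> e \<gamma>' s c R c' R'] by simp
qed

lemma vartheta_1: "1 \<le> d \<Longrightarrow> vartheta P 1 = 1"
  using th_eq_iff[of 0 d] by (simp add: vartheta_def)

lemma vartheta_reflect: "i \<le> Suc d \<Longrightarrow> vartheta P (Suc d - i) = vartheta P i"
  using sum_reflect(2)[of i th] unfolding vartheta_eq by simp

text \<open>The combination of the two partial sums whose vanishing is claimed solves the
  recurrence. It is zero at 0, at 1, and by reflection at d, which is enough by
  \<open>rec3_eq_zero\<close>.\<close>

lemma vartheta_dual: "i \<le> d \<Longrightarrow> vartheta (dual P) i = vartheta P i"
proof (cases "1 \<le> d")
  case True
  assume i: "i \<le> d"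
  obtain \<beta> \<gamma> \<gamma>' c c' e s R R'
  where *: "rec3 \<beta> \<gamma> e" "rec3 \<beta> \<gamma>' s" "rec3 \<beta> c R" "rec3 \<beta> c' R'"
    "\<And>i. i \<le> d \<Longrightarrow> e (Suc i) = th i" "\<And>i. i \<le> d \<Longrightarrow> s (Suc i) = st i"
    "\<And>i. i \<le> Suc d \<Longrightarrow> R i = S i" "\<And>i. i \<le> Suc d \<Longrightarrow> R' i = S' i"
    by (rule extended_sequences[OF True]) blast
  have nz: "th 0 - th d \<noteq> 0" "st 0 - st d \<noteq> 0"
    using th_eq_iff[of 0 d] st_eq_iff[of 0 d] True by auto
  have "(st 0 - st d) * R i + (- (th 0 - th d)) * R' i = 0"
  proof (rule rec3_eq_zero[OF rec3_shift[OF *(1), of "th 0"] _ _ rec3_lincomb[OF *(3,4)] _ _ _ i])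
    show "e (Suc i) - th 0 \<noteq> 0" if "1 \<le> i" "i \<le> d" for i
      using * that th_eq_iff[of i 0] by simp
    have "R d = th 0 - th d" "R' d = st 0 - st d"
      using * sum_reflect(2)[of 1 th] sum_reflect(2)[of 1 st] True by simp_all
    then show "(st 0 - st d) * R d + - (th 0 - th d) * R' d = 0"
      by algebra
  qed (use * True in \<open>auto simp: algebra_simps\<close>)
  then have "S' i / (st 0 - st d) = S i / (th 0 - th d)"
    using nz *(7)[of i] *(8)[of i] i by (simp add: frac_eq_eq algebra_simps)
  then show ?thesis
    unfolding vartheta_eq vartheta_def[of "dual P"] by (simp add: sum_divide_distrib)
next
  case False
  assume "i \<le> d"
  with False have "i = 0" by simp
  then show ?thesis by (simp add: vartheta_def)
qed

text \<open>This controls how the coefficient a_i changes when \<open>vp\<close> is replaced by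
  \<open>ph\<close>. Substituting the defining equations leaves the Wronskian relation between
  \<open>S\<close> and \<open>st i - st 0\<close>.\<close>

lemma vp_minus_ph:
  assumes i: "1 \<le> i" "i \<le> d"
  shows "vp i - ph i = (st i - st (i - 1)) * S i"
proof -
  obtain \<beta> \<gamma> \<gamma>' c c' e s R R'
  where *: "rec3 \<beta> \<gamma> e" "rec3 \<beta> \<gamma>' s" "rec3 \<beta> c R" "rec3 \<beta> c' R'"
    "\<And>i. i \<le> d \<Longrightarrow> e (Suc i) = th i" "\<And>i. i \<le> d \<Longrightarrow> s (Suc i) = st i"
    "\<And>i. i \<le> Suc d \<Longrightarrow> R i = S i" "\<And>i. i \<le> Suc d \<Longrightarrow> R' i = S' i"
    by (rule extended_sequences[OF le_trans[OF i]]) blast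
  obtain j where j: "i = Suc j" using i by (cases i) auto
  have nz: "th 0 - th d \<noteq> 0" using th_eq_iff[of 0 d] i by auto
  have eq: "(st 1 - st 0) * S i - (st i - st 0) * S 1 = (st j - st 0) * S i - (st i - st 0) * S j"
    using rec3_wronskian[OF *(3) _ rec3_shift[OF *(2), of "st 0"], of j] * i j by simp
  have v1: "ph 1 - vp 1 = (st 1 - st 0) * (th d - th 0)"
    using ph_eq[of 1] vartheta_1 i by (simp add: algebra_simps)
  have V: "(th 0 - th d) * vartheta P i = S i" using nz vartheta_eq by simp
  have ij: "i - 1 = j" "d - i + 1 = d - j" using j i by auto
  have "vp i - ph i = (ph 1 - vp 1) * vartheta P i
      + (st i - st 0) * ((th j - th (d - j)) + (th 0 - th d))"
    using vp_eq[OF i] ph_eq[OF i] unfolding ij by algebra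
  also have "\<dots> = - (st 1 - st 0) * S i + (st i - st 0) * (S i - S j + S 1)"
  proof -
    have "S i = S j + (th j - th (d - j))" "S 1 = th 0 - th d" using j by simp_all
    then show ?thesis using v1 V by algebra
  qed
  also have "\<dots> = (st i - st j) * S i"
    using eq by algebra
  finally show ?thesis using j by simp
qed

text \<open>This is the defining equation of \<open>vp\<close> for the dual array. The two formulas
  for \<open>vp i\<close> differ by (ph 1 - ph d) * vartheta P i and a term quadratic in \<theta>
  and its dual. The Wronskian \<open>W\<close> makes the latter linear, and the remaining linear
  relation is \<open>Z\<close>.\<close>

lemma vp_eq_dual:
  assumes i: "1 \<le> i" "i \<le> d"
  shows "vp i = ph d * vartheta P i + (th i - th 0) * (st (i - 1) - st d)"
proof -
  obtain \<beta> \<gamma> \<gamma>' c c' e s R R'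
  where *: "rec3 \<beta> \<gamma> e" "rec3 \<beta> \<gamma>' s" "rec3 \<beta> c R" "rec3 \<beta> c' R'"
    "\<And>i. i \<le> d \<Longrightarrow> e (Suc i) = th i" "\<And>i. i \<le> d \<Longrightarrow> s (Suc i) = st i"
    "\<And>i. i \<le> Suc d \<Longrightarrow> R i = S i" "\<And>i. i \<le> Suc d \<Longrightarrow> R' i = S' i"
    by (rule extended_sequences[OF le_trans[OF i]]) blast
  have d: "1 \<le> d" using i by simp
  have nz: "th 0 - th d \<noteq> 0" using th_eq_iff[of 0 d] d by auto
  obtain j where j: "i = Suc j" using i by (cases i) auto
  \<comment> \<open>\<open>A\<close> equals ph 1 - ph d. The three coefficients below are the
    entries of a cross product: they are chosen so that the combination of \<open>R\<close>,
    \<open>st i - st 0\<close> and \<open>th i - th 0\<close> vanishes at 1 and at d, while at 0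
    every summand vanishes.\<close>
  define A where "A = (st 1 - st 0) * (th d - th 0) - (st d - st 0) * (th 1 - th 0)"
  have "1 * (A * R i + (- (th 0 - th d) * (th d - th 1)) * (s (Suc i) - st 0))
      + ((th 0 - th d) * (st d - st 1)) * (e (Suc i) - th 0) = 0"
  proof (rule rec3_eq_zero[OF rec3_shift[OF *(1), of "th 0"] _ _
        rec3_lincomb[OF rec3_lincomb[OF *(3) rec3_shift[OF *(2)]] rec3_shift[OF *(1)]] _ _ _ i(2)])
    show "e (Suc i) - th 0 \<noteq> 0" if "1 \<le> i" "i \<le> d" for i
      using * that th_eq_iff[of i 0] by simp
    have "R d = th 0 - th d"
      using * sum_reflect(2)[of 1 th] d by simp
    moreover have "e (Suc d) = th d" "s (Suc d) = st d" using * by simp_all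
    ultimately show "1 * (A * R d + (- (th 0 - th d) * (th d - th 1)) * (s (Suc d) - st 0))
      + ((th 0 - th d) * (st d - st 1)) * (e (Suc d) - th 0) = 0"
      unfolding A_def by algebra
  qed (use * d in \<open>auto simp: A_def algebra_simps\<close>)
  moreover have "R i = (th 0 - th d) * vartheta P i" "s (Suc i) = st i" "e (Suc i) = th i"
    using * i nz by (simp_all add: vartheta_eq)
  ultimately have "(th 0 - th d) * (A * vartheta P i) =
     (th 0 - th d) * ((th d - th 1) * (st i - st 0) - (st d - st 1) * (th i - th 0))"
    by algebra
  then have Z: "A * vartheta P i = (th d - th 1) * (st i - st 0) - (st d - st 1) * (th i - th 0)"
    using nz by (metis mult_left_cancel)
  have W: "(st 1 - st 0) * (th i - th 0) - (st i - st 0) * (th 1 - th 0)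
      = (st j - st 0) * (th i - th 0) - (st i - st 0) * (th j - th 0)"
    using rec3_wronskian[OF rec3_shift[OF *(1), of "th 0"] _ rec3_shift[OF *(2), of "st 0"], of j]
      * i j by simp
  have "vartheta P d = 1" "d - 1 + 1 = d" "d - d + 1 = 1"
    using vartheta_reflect[of 1] vartheta_1 d by simp_all
  then have "ph d = vp 1 + (st d - st 0) * (th 1 - th 0)" "ph 1 = vp 1 + (st 1 - st 0) * (th d - th 0)"
    using ph_eq[of 1] ph_eq[of d] d vartheta_1 by simp_all
  moreover have "vp i = ph 1 * vartheta P i + (st i - st 0) * (th j - th d)"
    using vp_eq[OF i] j by simp
  ultimately have "vp i = ph d * vartheta P i + (th i - th 0) * (st j - st d)"
    using Z W unfolding A_def by algebra
  then show ?thesis using j by simp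
qed

lemma dual_param_array: "is_param_array (dual P)"
proof -
  obtain r where r: "\<And>i. 2 \<le> i \<Longrightarrow> i + 1 \<le> d \<Longrightarrow> (th (i - 2) - th (i + 1)) / (th (i - 1) - th i) = r"
    "\<And>i. 2 \<le> i \<Longrightarrow> i + 1 \<le> d \<Longrightarrow> (st (i - 2) - st (i + 1)) / (st (i - 1) - st i) = r"
    using param_array_ratio by blast
  have *: "ph (d - i + 1) \<noteq> 0"
    "vp i = ph (d - 1 + 1) * vartheta (dual P) i + (th i - th 0) * (st (i - 1) - st d)"
    "ph (d - i + 1) = vp 1 * vartheta (dual P) i + (th i - th 0) * (st (d - i + 1) - st 0)"
    if i: "1 \<le> i" "i \<le> d" for i
  proof -
    show "ph (d - i + 1) \<noteq> 0" using ph_nz[of "d - i + 1"] i by simp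
    have "d - 1 + 1 = d" using i by simp
    then show "vp i = ph (d - 1 + 1) * vartheta (dual P) i + (th i - th 0) * (st (i - 1) - st d)"
      using vp_eq_dual[OF i] vartheta_dual[OF i(2)] by metis
    have j: "d - (d - i + 1) + 1 = i" "d - i + 1 = Suc d - i" using i by auto
    have "ph (d - i + 1) = vp 1 * vartheta P (d - i + 1) + (st (d - i + 1) - st 0) * (th i - th 0)"
      using ph_eq[of "d - i + 1"] i unfolding j(1) by simp
    moreover have "vartheta P (d - i + 1) = vartheta (dual P) i"
      using vartheta_dual[OF i(2)] vartheta_reflect[of i] i unfolding j(2) by simp
    ultimately show "ph (d - i + 1) = vp 1 * vartheta (dual P) i + (th i - th 0) * (st (d - i + 1) - st 0)"
      by (metis mult.commute)
  qed
  show ?thesis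
    unfolding is_param_array_def dual_simps
  proof (intro conjI ballI exI[of _ r] allI impI)
    fix i
    assume "i \<in> {1..d}"
    then have i: "1 \<le> i" "i \<le> d" by auto
    show "vp i \<noteq> 0" "ph (d - i + 1) \<noteq> 0"
      "vp i = ph (d - 1 + 1) * vartheta (dual P) i + (th i - th 0) * (st (i - 1) - st d)"
      "ph (d - i + 1) = vp 1 * vartheta (dual P) i + (th i - th 0) * (st (d - i + 1) - st 0)"
      by (fact vp_nz[OF i] *[OF i])+
  next
    fix i
    assume "2 \<le> i \<and> i + 1 \<le> d"
    then show "(st (i - 2) - st (i + 1)) / (st (i - 1) - st i) = r"
      "(th (i - 2) - th (i + 1)) / (th (i - 1) - th i) = r"
      using r[of i] by blast+
  qed (fact param_array_conds)+
qed

lemma leonard_array_dual: "leonard_array (dual P)"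
  using dual_param_array by unfold_locales

end

section \<open>The three-term recurrence in a Newton basis\<close>

text \<open>The relatives $\Phi^{\Downarrow}$ and $\Phi^{\downarrow}$ of a parameter array: the order of
  $\theta$, respectively $\theta^\star$, is reversed.\<close>

definition flip :: "param_array \<Rightarrow> param_array" where
  "flip P = \<lparr> diam = diam P, theta = (\<lambda>i. theta P (diam P - i)), theta_star = theta_star P,
              vphi = phi P, phi = vphi P \<rparr>"

definition down :: "param_array \<Rightarrow> param_array" where
  "down P = dual (flip (dual P))"

lemma diam_down [simp]: "diam (down P) = diam P"
  and theta_down [simp]: "theta (down P) = theta P"
  and theta_star_down [simp]: "theta_star (down P) i = theta_star P (diam P - i)"
  and vphi_down [simp]: "vphi (down P) j = phi P (diam P - j + 1)"
  by (simp_all add: down_def dual_def flip_def)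

context leonard_array
begin

text \<open>Reversing \<theta> exchanges the defining equations of \<open>vp\<close> and
  \<open>ph\<close>. The quotients in vartheta are unchanged because numerator and denominator both
  change sign.\<close>

lemma leonard_array_flip: "leonard_array (flip P)"
proof
  obtain r where r: "\<And>i. 2 \<le> i \<Longrightarrow> i + 1 \<le> d \<Longrightarrow> (th (i - 2) - th (i + 1)) / (th (i - 1) - th i) = r"
    "\<And>i. 2 \<le> i \<Longrightarrow> i + 1 \<le> d \<Longrightarrow> (st (i - 2) - st (i + 1)) / (st (i - 1) - st i) = r"
    using param_array_ratio by blast
  have v: "vartheta (flip P) i = vartheta P i" if "i \<le> d" for i
  proof -
    have "vartheta (flip P) i = (\<Sum>h<i. (th (d - h) - th h) / (th d - th 0))"
      unfolding vartheta_def using that by (intro sum.cong) (auto simp: flip_def)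
    also have "\<dots> = vartheta P i"
      unfolding vartheta_def by (intro sum.cong) (metis minus_diff_eq minus_divide_divide)+
    finally show ?thesis .
  qed
  have f: "diam (flip P) = d" "theta (flip P) = (\<lambda>i. th (d - i))" "theta_star (flip P) = st"
    "vphi (flip P) = ph" "phi (flip P) = vp"
    by (simp_all add: flip_def)
  show "is_param_array (flip P)"
    unfolding is_param_array_def f
  proof (intro conjI ballI exI[of _ r] allI impI)
    fix i
    assume "i \<in> {1..d}"
    then have i: "1 \<le> i" "i \<le> d" by auto
    have *: "d - (i - 1) = d - i + 1" "d - (d - i + 1) = i - 1" using i by auto
    show "ph i \<noteq> 0" "vp i \<noteq> 0" by (fact vp_nz[OF i] ph_nz[OF i])+
    show "ph i = vp 1 * vartheta (flip P) i + (st i - st 0) * (th (d - (i - 1)) - th (d - d))"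
      using ph_eq[OF i] v[OF i(2)] unfolding * by simp
    show "vp i = ph 1 * vartheta (flip P) i + (st i - st 0) * (th (d - (d - i + 1)) - th (d - 0))"
      using vp_eq[OF i] v[OF i(2)] unfolding * by simp
  next
    fix i
    assume i: "2 \<le> i \<and> i + 1 \<le> d"
    then show "(st (i - 2) - st (i + 1)) / (st (i - 1) - st i) = r"
      using r(2)[of i] by blast
    have *: "d - (i - 2) = (d - i + 1) + 1" "d - (i + 1) = (d - i + 1) - 2" "d - (i - 1) = d - i + 1"
      "d - i = (d - i + 1) - 1"
      using i by auto
    have "2 \<le> d - i + 1" "d - i + 1 + 1 \<le> d" using i by linarith+
    then have "(th (d - i + 1 - 2) - th (d - i + 1 + 1)) / (th (d - i + 1 - 1) - th (d - i + 1)) = r"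
      by (rule r(1))
    then have "(th (d - (i + 1)) - th (d - (i - 2))) / (th (d - i) - th (d - (i - 1))) = r"
      using * by metis
    then show "(th (d - (i - 2)) - th (d - (i + 1))) / (th (d - (i - 1)) - th (d - i)) = r"
      by (metis minus_diff_eq minus_divide_divide)
  next
    show "inj_on (\<lambda>i. th (d - i)) {..d}"
      unfolding inj_on_def using th_eq_iff by (metis atMost_iff diff_diff_cancel diff_le_self)
  qed (fact param_array_conds)
qed

lemma leonard_array_down: "leonard_array (down P)"
  unfolding down_def
  by (intro leonard_array.leonard_array_dual leonard_array.leonard_array_flip leonard_array_axioms)

definition tst :: "nat \<Rightarrow> complex \<Rightarrow> complex" where
  "tst k v = (\<Prod>h<k. v - st h)"

lemma tst_0 [simp]: "tst 0 v = 1"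
  and tst_Suc [simp]: "tst (Suc k) v = tst k v * (v - st k)"
  by (simp_all add: tst_def)

lemma tst_eq_0: "i < k \<Longrightarrow> tst k (st i) = 0"
  by (auto simp: tst_def)

lemma tst_nz: "k \<le> i \<Longrightarrow> i \<le> d \<Longrightarrow> tst k (st i) \<noteq> 0"
  by (auto simp: tst_def st_eq_iff)

text \<open>The coefficients of $z\,u_i(z)$, reduced modulo $\prod_h (z-\theta_h)$, with respect to the
  scaled Newton basis $\prod_{h<k}(z-\theta_h)/(\varphi_1\cdots\varphi_k)$.\<close>

definition newton_coeff :: "nat \<Rightarrow> nat \<Rightarrow> complex" where
  "newton_coeff i k = (if k = 0 then th 0 else tst (k - 1) (st i) * (vp k + th k * (st i - st (k - 1))))"

lemma coeff_b_tst:
  "i < d \<Longrightarrow> coeff_b P i * tst (Suc i) (st (Suc i)) = vp (Suc i) * tst i (st i)"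
  using tst_nz[of "Suc i" "Suc i"] by (simp add: coeff_b_def tst_def lessThan_Suc_atMost[symmetric] del: prod.lessThan_Suc)

text \<open>For k \<ge> i the node \<open>st (i - 1)\<close> is a zero of \<open>tst k\<close>, so
  only two unknown coefficients are left: k = i yields a_i, k = i + 1 yields b_i, and for larger k
  all terms vanish. For i = d the entry \<open>st (Suc d)\<close> is multiplied by b_d = 0.\<close>

lemma newton_coeff_three_term_ge:
  assumes i: "i \<le> d" and k: "i \<le> k" "k \<le> d"
  shows "newton_coeff i k = coeff_a P i * tst k (st i) + coeff_b P i * tst k (st (Suc i))"
proof -
  consider "k = i" | "k = Suc i" | "Suc (Suc i) \<le> k" using k by linarith
  then show ?thesis
  proof cases
    case 1
    have b: "(if i < d then vp (i + 1) / (st i - st (i + 1)) else 0) * tst i (st i)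
       + coeff_b P i * tst i (st (Suc i)) = 0"
    proof (cases "i < d")
      case True
      have "coeff_b P i * tst i (st (Suc i)) * (st (Suc i) - st i) = vp (Suc i) * tst i (st i)"
        using coeff_b_tst[OF True] by (simp add: mult.assoc)
      then show ?thesis using True st_eq_iff[of i "Suc i"] by (simp add: field_simps)
    qed (simp add: coeff_b_def)
    have c: "newton_coeff i i = (th i + (if 1 \<le> i then vp i / (st i - st (i - 1)) else 0)) * tst i (st i)"
    proof (cases i)
      case (Suc j)
      then show ?thesis using st_eq_iff[of i j] i
        by (simp add: newton_coeff_def field_simps)
    qed (simp add: newton_coeff_def)
    show ?thesis using b unfolding 1 c coeff_a_def by (simp add: algebra_simps)
  next
    case 2
    then show ?thesis using coeff_b_tst[of i] k tst_eq_0[of i k]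
      by (simp add: newton_coeff_def mult.commute)
  next
    case 3
    then show ?thesis using tst_eq_0[of i k] tst_eq_0[of "Suc i" k] tst_eq_0[of i "k - 1"]
      by (simp add: newton_coeff_def)
  qed
qed

text \<open>The case \<open>i = d\<close>, \<open>k = 0\<close> of the three-term relation. The backward recurrence that gives all
  other cases degenerates here, since the extended value $\theta^\star_{d+1}$ may coincide with
  $\theta^\star_0$.\<close>

lemma newton_coeff_corner:
  assumes "2 \<le> d"
  shows "(th 0 - coeff_a P d) * (st (d - 1) - st 0) = vp 1 + (th 1 - coeff_a P d) * (st d - st 0)"
proof -
  obtain \<beta> \<gamma> \<gamma>' c c' e s R R'
  where *: "rec3 \<beta> \<gamma> e" "rec3 \<beta> \<gamma>' s" "rec3 \<beta> c R" "rec3 \<beta> c' R'"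
    "\<And>i. i \<le> d \<Longrightarrow> e (Suc i) = th i" "\<And>i. i \<le> d \<Longrightarrow> s (Suc i) = st i"
    "\<And>i. i \<le> Suc d \<Longrightarrow> R i = S i" "\<And>i. i \<le> Suc d \<Longrightarrow> R' i = S' i"
    by (rule extended_sequences[OF le_trans[OF one_le_numeral assms]]) blast
  obtain m where m: "d = Suc (Suc m)" using assms by (metis add_2_eq_Suc le_Suc_ex)
  \<comment> \<open>Antisymmetry turns \<open>S (d - 1)\<close> into a sum of two terms, so that the
    Wronskian relation \<open>eq\<close> involves only the two outermost entries at either
    end.\<close>
  have "S (Suc d - 2) = S 2" using sum_reflect(2)[of 2 th] assms by simp
  then have Rm: "R (Suc m) = (th 0 - th d) + (th 1 - th (d - 1))"
    using *(7)[of "Suc m"] m by (simp add: numeral_2_eq_2)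
  have "S (Suc d - 1) = S 1" using sum_reflect(2)[of 1 th] assms by simp
  then have Rd: "R d = th 0 - th d" "R 1 = th 0 - th d"
    using *(7)[of d] *(7)[of 1] m by simp_all
  have "(st 1 - st 0) * R d - (st d - st 0) * R 1 = (st (Suc m) - st 0) * R d - (st d - st 0) * R (Suc m)"
    using rec3_wronskian[OF *(3) _ rec3_shift[OF *(2), of "st 0"], of "Suc m"] * m by simp
  then have eq: "(th 0 - th d) * (st (Suc m) - st 1) = (st d - st 0) * (th 1 - th (Suc m))"
    unfolding Rm Rd using m by (simp add: algebra_simps)
  have a: "(coeff_a P d - th d) * (st d - st (Suc m)) = vp d"
    using st_eq_iff[of d "Suc m"] m by (simp add: coeff_a_def)
  have v: "vp d = vp 1 + (st 1 - st 0) * (th d - th 0) + (st d - st 0) * (th (Suc m) - th d)"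
  proof -
    have "vartheta P d = 1" "d - 1 + 1 = d" "d - 1 = Suc m"
      using vartheta_reflect[of 1] vartheta_1 m by simp_all
    then have "vp d = ph 1 + (st d - st 0) * (th (Suc m) - th d)"
      "ph 1 = vp 1 + (st 1 - st 0) * (th d - th 0)"
      using vp_eq[of d] ph_eq[of 1] vartheta_1 assms m[symmetric] by simp_all
    then show ?thesis by simp
  qed
  have "(th 0 - coeff_a P d) * (st (Suc m) - st 0) = vp 1 + (th 1 - coeff_a P d) * (st d - st 0)"
    using eq a v by algebra
  then show ?thesis using m by simp
qed

text \<open>The values k \<ge> i carry no trace of the term with \<open>st (i - 1)\<close>. Its
  coefficient is therefore fixed by the single value k = i - 1, and its identification with
  \<open>coeff_c P i\<close> is left to a comparison with the reversed array.\<close>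

lemma newton_coeff_three_term_exists:
  assumes i: "1 \<le> i" "i \<le> d"
  obtains c where "\<And>k. k \<le> d \<Longrightarrow> newton_coeff i k = c * tst k (st (i - 1))
    + coeff_a P i * tst k (st i) + coeff_b P i * tst k (st (Suc i))"
proof -
  obtain \<beta> \<gamma> \<gamma>' c0 c' e s R R'
  where *: "rec3 \<beta> \<gamma> e" "rec3 \<beta> \<gamma>' s" "rec3 \<beta> c0 R" "rec3 \<beta> c' R'"
    "\<And>i. i \<le> d \<Longrightarrow> e (Suc i) = th i" "\<And>i. i \<le> d \<Longrightarrow> s (Suc i) = st i"
    "\<And>i. i \<le> Suc d \<Longrightarrow> R i = S i" "\<And>i. i \<le> Suc d \<Longrightarrow> R' i = S' i"
    by (rule extended_sequences[OF le_trans[OF i]]) blast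
  obtain j where j: "i = Suc j" using i by (cases i) auto
  \<comment> \<open>The defining equation of \<open>vp\<close>, read for all indices.
    \<open>F\<close> vanishes at 0 and at d + 1, in accordance with the terms omitted at the
    ends.\<close>
  define F where "F k = ph 1 / (th 0 - th d) * R k + (s (Suc k) - s 1) * (e k - e (Suc d))" for k
  define T where "T = st i"
  have T: "T = s (Suc i)" using * i T_def by simp
  define l where "l k = F k + e (Suc k) * (T - s k)" for k
  have F: "F k = vp k" if "1 \<le> k" "k \<le> d" for k
    using vp_eq[OF that] *(5)[of "k - 1"] * that by (simp add: F_def vartheta_eq)
  have F0: "F 0 = 0" using * by (simp add: F_def)
  have Fd: "F (Suc d) = 0" using * sum_reflect(1)[of th] by (simp add: F_def)
  define E where "E k = (T - s (Suc k)) * l (Suc (Suc k))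
     + (s (Suc (Suc k)) + s (Suc k) - \<beta> * T - \<gamma>') * l (Suc k) + (T - s (Suc (Suc k))) * l k" for k
  have "E (Suc k) = E k" for k
    unfolding E_def l_def F_def
    using askey_wilson_split[OF *(1,2,3), of T k "ph 1 / (th 0 - th d)" "s 1" "e (Suc d)"] .
  then have E0: "E k = E 0" for k by (induction k) auto
  have rT: "\<beta> * T + \<gamma>' = s i + s (Suc (Suc i))"
    using rec3D[OF *(2), of i] T by simp
  have E: "E k = coeff_a P i * ((T - s i) * (T - s (Suc (Suc i))))" for k
  proof -
    \<comment> \<open>At k = i - 1 the node s (k + 2) is T itself. The last term drops out, \<theta>
      at the outer index disappears from the first one, and the middle coefficient becomes T - s (i
      + 2).\<close>
    have "E k = E j" using E0 by metis
    also have "\<dots> = (T - s i) * F (Suc i) + (T - s (Suc (Suc i))) * (F i + th i * (T - s i))"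
    proof -
      have "s (Suc i) + s i - \<beta> * T - \<gamma>' = T - s (Suc (Suc i))"
        using rT T by (simp add: algebra_simps)
      then show ?thesis
        using * i T j unfolding E_def by (simp add: l_def)
    qed
    also have "\<dots> = coeff_a P i * ((T - s i) * (T - s (Suc (Suc i))))"
    proof -
      have si: "T - s i \<noteq> 0" "s i = st j" using * i j T_def st_eq_iff[of i j] by auto
      define u where "u = th i + vp i / (st i - st (i - 1))"
      define w where "w = (if i < d then vp (Suc i) / (st i - st (Suc i)) else 0)"
      have 1: "F i + th i * (T - s i) = u * (T - s i)"
        using si F[of i] i j T_def by (simp add: u_def field_simps)
      have 2: "F (Suc i) = w * (T - s (Suc (Suc i)))"
        using F[of "Suc i"] Fd * i T_def st_eq_iff[of i "Suc i"] by (cases "i = d") (auto simp: w_def)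
      have "coeff_a P i = u + w" using i by (simp add: coeff_a_def u_def w_def)
      then show ?thesis using 1 2 by algebra
    qed
    finally show ?thesis .
  qed
  define t where "t k v = (\<Prod>h<k. v - s (Suc h))" for k and v :: complex
  have t_tst: "t k v = tst k v" if "k \<le> Suc d" for k v
    unfolding t_def tst_def using * that by (intro prod.cong) auto
  define L where "L k = (case k of 0 \<Rightarrow> e 1 | Suc k' \<Rightarrow> t k' T * l k)" for k
  have L: "L k = newton_coeff i k" if "k \<le> d" for k
  proof (cases k)
    case (Suc k')
    then show ?thesis using that * F[of k] t_tst[of k'] T_def
      by (simp add: L_def newton_coeff_def l_def)
  qed (use * in \<open>simp add: L_def newton_coeff_def\<close>)
  have Ll: "(T - s k) * L k = t k T * l k" for k
    by (cases k) (simp_all add: L_def t_def l_def F0)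
  define b where "b = coeff_b P i"
  define c where "c = (newton_coeff i j - coeff_a P i * tst j (st i) - b * tst j (st (Suc i))) / tst j (st j)"
  define v where "v = (if i < d then s (Suc (Suc i)) else 0)"
  define z where "z k = L k - coeff_a P i * t k T - b * t k (s (Suc (Suc i))) - c * t k (s i)" for k
  \<comment> \<open>For i = d the extended value s (d + 2) and the entry \<open>st (Suc d)\<close>
    are unrelated; the factor b = 0 makes this harmless.\<close>
  have b': "b * t k (s (Suc (Suc i))) = b * tst k (st (Suc i))" if "k \<le> Suc d" for k
    using * t_tst[OF that] by (cases "i < d") (auto simp: b_def coeff_b_def)
  have zeq: "z k = newton_coeff i k - coeff_a P i * tst k (st i) - b * tst k (st (Suc i)) - c * tst k (st j)"
    if "k \<le> d" for k
    using that L t_tst * j i T_def b'[of k] by (simp add: z_def)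
  have z_ge: "z k = 0" if "j \<le> k" for k
  proof (cases "k \<le> d")
    case True
    show ?thesis
    proof (cases "k = j")
      case True
      then show ?thesis using zeq[of k] tst_nz[of j j] i j by (simp add: c_def)
    next
      case False
      then show ?thesis
        using zeq[OF True] newton_coeff_three_term_ge[of i k] True that i j tst_eq_0[of j k]
        by (simp add: b_def)
    qed
  next
    case False
    then obtain k' where k': "k = Suc k'" by (cases k) auto
    have "t k T = 0" "t k (s i) = 0"
      using False i j T by (auto simp: t_def intro: bexI[of _ i] bexI[of _ j])
    moreover have "b * t k (s (Suc (Suc i))) = 0"
      using False by (cases "i < d") (auto simp: t_def b_def coeff_b_def intro: bexI[of _ "Suc i"])
    moreover have "L k = 0"
    proof (cases "k' = d \<and> i = d")
      case True
      then show ?thesis using k' Fd T by (simp add: L_def l_def)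
    next
      case c: False
      then have "t k' T = 0" using False k' i T by (auto simp: t_def intro: bexI[of _ i])
      then show ?thesis by (simp add: L_def k')
    qed
    ultimately show ?thesis by (simp add: z_def)
  qed
  \<comment> \<open>By \<open>rec3_symmetric_factor\<close> this operator multiplies
    \<open>t k v\<close> by (v - s i) (v - s (i + 2)). It annihilates the terms at the nodes i - 1
    and i + 1, and by the value of \<open>E\<close> its effects on \<open>L\<close> and on the
    a_i-term cancel.\<close>
  have op: "z (Suc (Suc k)) + (s (Suc (Suc k)) + s (Suc k) - \<beta> * T - \<gamma>') * z (Suc k)
      + (T - s k) * (T - s (Suc (Suc k))) * z k = 0" for k
  proof -
    have opt: "t (Suc (Suc k)) v + (s (Suc (Suc k)) + s (Suc k) - \<beta> * T - \<gamma>') * t (Suc k) v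
      + (T - s k) * (T - s (Suc (Suc k))) * t k v = t k v * ((v - s i) * (v - s (Suc (Suc i))))" for v
    proof -
      have "(v - s (Suc k)) * (v - s (Suc (Suc k)))
        + (s (Suc (Suc k)) + s (Suc k) - \<beta> * T - \<gamma>') * (v - s (Suc k))
        + (T - s k) * (T - s (Suc (Suc k))) = (v - s i) * (v - s (Suc (Suc i)))"
        using rec3_symmetric_factor[OF *(2), of k i] rT T by algebra
      then show ?thesis unfolding t_def by (simp, algebra)
    qed
    have opL: "L (Suc (Suc k)) + (s (Suc (Suc k)) + s (Suc k) - \<beta> * T - \<gamma>') * L (Suc k)
      + (T - s k) * (T - s (Suc (Suc k))) * L k = t k T * E k"
      using Ll[of k] unfolding E_def by (simp add: L_def t_def, algebra)
    show ?thesis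
      using opL[unfolded E] opt[of T] opt[of "s i"] opt[of "s (Suc (Suc i))"]
      unfolding z_def by algebra
  qed
  \<comment> \<open>The recurrence is run backwards. For i < d the coefficient of \<open>z k\<close>
    is (st k - st j) * (st k - st (i + 1)), which is nonzero for k < j. For i = d it is known to be
    nonzero only for k \<ge> 1, because s 0 is the artificial value at index -1.\<close>
  have z_pos: "z k = 0 \<and> z (Suc k) = 0" if "1 \<le> k \<or> i < d" "k \<le> j" for k
    using that(2,1)
  proof (induction k rule: inc_induct)
    case (step k)
    have "(T - s k) * (T - s (Suc (Suc k))) \<noteq> 0"
    proof (cases "i < d")
      case True
      have "(T - s k) * (T - s (Suc (Suc k))) = (st k - st j) * (st k - st (Suc i))"
        using rec3_symmetric_factor[OF *(2), of k i] T * j step True by simp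
      then show ?thesis using st_eq_iff[of k j] st_eq_iff[of k "Suc i"] j step True by simp
    next
      case False
      then have "1 \<le> k" using step by auto
      then obtain k' where "k = Suc k'" by (cases k) auto
      then show ?thesis
        using T_def * st_eq_iff[of i k'] st_eq_iff[of i "Suc k"] i j step by simp
    qed
    moreover have "z (Suc k) = 0" "z (Suc (Suc k)) = 0" using step by auto
    ultimately show ?case using op[of k] by simp
  qed (use z_ge in simp)
  have "z k = 0" if "k \<le> d" for k
  proof (cases "k = 0 \<and> \<not> i < d \<and> j \<noteq> 0")
    case False
    then show ?thesis using z_pos[of k] z_ge[of k] by (cases "j \<le> k") auto
  next
    case True
    \<comment> \<open>What remains is k = 0 with i = d. The relation at k = 1 already determines
      \<open>c\<close>, and by the corner identity the value is the one that k = 0 requires.\<close>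
    then have d: "2 \<le> d" "d = i" using i j by auto
    have "z 1 = 0" using z_pos[of 1] True by simp
    then have "vp 1 + (th 1 - coeff_a P d) * (st d - st 0) = c * (st (d - 1) - st 0)"
      using zeq[of 1] d j by (simp add: newton_coeff_def b_def coeff_b_def algebra_simps)
    then have "c = th 0 - coeff_a P d"
      using newton_coeff_corner[OF d(1)] st_eq_iff[of "d - 1" 0] d by auto
    then show ?thesis using True zeq[of 0] d by (simp add: newton_coeff_def b_def coeff_b_def)
  qed
  with zeq j that[of c] show thesis by (simp add: b_def algebra_simps)
qed

end

section \<open>Recurrence and orthogonality of the matrix p\<close>

context leonard_array
begin

text \<open>Replacing \<open>vp\<close> by \<open>ph\<close> changes the two quotients in a_i by S i
  and -S (i + 1). The difference of these sums is just the change from th i to th (d - i).\<close>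

lemma coeff_a_down:
  assumes "i \<le> d"
  shows "coeff_a (down P) (d - i) = coeff_a P i"
proof -
  have 1: "(if 1 \<le> i then vp i / (st i - st (i - 1)) else 0)
      = (if 1 \<le> i then ph i / (st i - st (i - 1)) else 0) + S i"
  proof (cases "1 \<le> i")
    case True
    have "i - 1 \<le> d" "i - 1 \<noteq> i" using True assms by auto
    then have "st i - st (i - 1) \<noteq> 0" using st_eq_iff[OF assms, of "i - 1"] by auto
    then show ?thesis using vp_minus_ph[OF True assms] True
      by (simp add: field_simps)
  qed (simp add: not_le)
  have 2: "(if i < d then vp (i + 1) / (st i - st (i + 1)) else 0)
      = (if i < d then ph (i + 1) / (st i - st (i + 1)) else 0) - S (Suc i)"
  proof (cases "i < d")
    case True
    have "st i - st (Suc i) \<noteq> 0" using st_eq_iff[of i "Suc i"] True by auto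
    then show ?thesis using vp_minus_ph[of "Suc i"] True
      by (simp add: field_simps)
  next
    case False
    then have "S (Suc i) = 0" using assms sum_reflect(1)[of th] by simp
    then show ?thesis using False by simp
  qed
  have 3: "d - (d - i) = i" "d - (d - i - 1) = (if i < d then i + 1 else d)" "d - (d - i + 1) = i - 1"
    "d - (d - i + 1) + 1 = (if 1 \<le> i then i else 1)" "1 \<le> d - i \<longleftrightarrow> i < d" "d - i < d \<longleftrightarrow> 1 \<le> i"
    using assms by auto
  have "S (Suc i) = S i + (th i - th (d - i))" by simp
  then show ?thesis
    unfolding coeff_a_def 1 2 diam_down theta_down theta_star_down vphi_down 3
    by (auto simp: add.commute)
qed

lemma coeff_b_down:
  assumes "1 \<le> i" "i \<le> d"
  shows "coeff_b (down P) (d - i) = coeff_c P i"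
proof -
  have *: "d - (d - i) = i" "d - (d - i + 1) = i - 1" "d - (d - i + 1) + 1 = i" "d - i < d"
    using assms by auto
  show ?thesis
    unfolding coeff_b_def coeff_c_def diam_down theta_star_down vphi_down * using assms by simp
qed

text \<open>For i < d both P and \<open>down P\<close> have a three-term relation, with b_i known in
  the first and c_i known in the second. Their instances at k = 0 and k = 1 are four equations that
  leave (c - c_i) * (st (i - 1) - st (i + 1)) = 0.\<close>

lemma newton_coeff_three_term:
  assumes i: "i \<le> d" and k: "k \<le> d"
  shows "newton_coeff i k = coeff_c P i * tst k (st (i - 1))
    + coeff_a P i * tst k (st i) + coeff_b P i * tst k (st (Suc i))"
proof (cases "i = 0")
  case True
  then show ?thesis using newton_coeff_three_term_ge[OF i _ k] by (simp add: coeff_c_def)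
next
  case False
  then have i': "1 \<le> i" by simp
  interpret Q: leonard_array "down P" by (rule leonard_array_down)
  obtain c where c: "\<And>k. k \<le> d \<Longrightarrow> newton_coeff i k = c * tst k (st (i - 1))
    + coeff_a P i * tst k (st i) + coeff_b P i * tst k (st (Suc i))"
    using newton_coeff_three_term_exists[OF i' i] by blast
  have c0: "th 0 = c + coeff_a P i + coeff_b P i"
    using c[of 0] by (simp add: newton_coeff_def)
  have c1: "vp 1 + th 1 * (st i - st 0) = c * (st (i - 1) - st 0)
    + coeff_a P i * (st i - st 0) + coeff_b P i * (st (Suc i) - st 0)"
    using c[of 1] i i' by (simp add: newton_coeff_def)
  have "c = coeff_c P i"
  proof (cases "i < d")
    case True
    have m: "1 \<le> d - i" "d - i \<le> Q.d" using True by auto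
    obtain c' where c': "\<And>k. k \<le> Q.d \<Longrightarrow> Q.newton_coeff (d - i) k = c' * Q.tst k (Q.st (d - i - 1))
      + coeff_a (down P) (d - i) * Q.tst k (Q.st (d - i))
      + coeff_b (down P) (d - i) * Q.tst k (Q.st (Suc (d - i)))"
      using Q.newton_coeff_three_term_exists[OF m] by blast
    have c'0: "th 0 = c' + coeff_a P i + coeff_c P i"
      using c'[of 0] by (simp add: Q.newton_coeff_def coeff_a_down[OF i] coeff_b_down[OF i' i])
    have *: "d - (d - i) = i" "d - (d - i - 1) = Suc i" "d - Suc (d - i) = i - 1" "d - 1 + 1 = d"
      using True i' by auto
    have c'1: "ph d + th 1 * (st i - st d) = c' * (st (Suc i) - st d)
      + coeff_a P i * (st i - st d) + coeff_c P i * (st (i - 1) - st d)"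
      using c'[of 1] True
      unfolding Q.newton_coeff_def coeff_a_down[OF i] coeff_b_down[OF i' i] theta_star_down *
      by (simp add: *)
    have "ph d = vp 1 + (st d - st 0) * (th 1 - th 0)"
    proof -
      have "vartheta P d = 1" using vartheta_reflect[of 1] vartheta_1 True by simp
      then show ?thesis using ph_eq[of d] True by simp
    qed
    then have "(c - coeff_c P i) * (st (i - 1) - st (Suc i)) = 0"
      using c0 c1 c'0 c'1 by algebra
    moreover have "st (i - 1) \<noteq> st (Suc i)"
      using st_eq_iff[of "i - 1" "Suc i"] True by simp
    ultimately show ?thesis by simp
  next
    case False
    \<comment> \<open>The corresponding index of \<open>down P\<close> is 0, where the relation
      contains no unknown coefficient.\<close>
    then have "i = d" using i by simp
    then have "th 0 = coeff_a P i + coeff_c P i"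
      using Q.newton_coeff_three_term_ge[of 0 0] coeff_a_down[of d] coeff_b_down[of d] i'
      by (simp add: Q.newton_coeff_def)
    then show ?thesis using c0 \<open>i = d\<close> by (simp add: coeff_b_def)
  qed
  then show ?thesis using c[OF k] by simp
qed

section \<open>The polynomials u_i: recurrence and duality\<close>

definition tth :: "nat \<Rightarrow> complex \<Rightarrow> complex" where
  "tth k z = (\<Prod>h<k. z - th h)"

lemma tth_0 [simp]: "tth 0 v = 1"
  and tth_Suc [simp]: "tth (Suc k) v = tth k v * (v - th k)"
  by (simp_all add: tth_def)

lemma tth_eq_0: "i < k \<Longrightarrow> tth k (th i) = 0"
  by (auto simp: tth_def)

lemma tth_nz: "k \<le> i \<Longrightarrow> i \<le> d \<Longrightarrow> tth k (th i) \<noteq> 0"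
  by (auto simp: tth_def th_eq_iff)

definition vprod :: "nat \<Rightarrow> complex" where
  "vprod k = (\<Prod>j<k. vp (Suc j))"

lemma vprod_0 [simp]: "vprod 0 = 1"
  and vprod_Suc [simp]: "vprod (Suc k) = vprod k * vp (Suc k)"
  by (simp_all add: vprod_def)

lemma vprod_nz: "k \<le> d \<Longrightarrow> vprod k \<noteq> 0"
  using vp_nz by (auto simp: vprod_def)

text \<open>The summands with k > i vanish. With the common upper limit d, the sum is symmetric in
  \<theta> and its dual, and functions with different i can be compared termwise.\<close>

lemma u_fun_eq:
  assumes "i \<le> d"
  shows "u_fun P i z = (\<Sum>k\<le>d. tth k z * tst k (st i) / vprod k)"
proof -
  have "u_fun P i z = (\<Sum>k\<le>i. tth k z * tst k (st i) / vprod k)"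
    unfolding u_fun_def tth_def tst_def vprod_def
    by (simp add: prod.distrib prod_dividef)
  also have "\<dots> = (\<Sum>k\<le>d. tth k z * tst k (st i) / vprod k)"
    using assms tst_eq_0 by (intro sum.mono_neutral_left) auto
  finally show ?thesis .
qed

lemma u_fun_times:
  assumes "i \<le> d" "x \<le> d"
  shows "th x * u_fun P i (th x) = (\<Sum>k\<le>d. tth k (th x) / vprod k * newton_coeff i k)"
proof -
  \<comment> \<open>Multiplication by z raises the Newton degree by one. The excess is a single term
    of degree n + 1, and for n = d it vanishes at every node th x.\<close>
  have "(\<Sum>k\<le>n. z * (tth k z * tst k (st i) / vprod k))
      = (\<Sum>k\<le>n. tth k z / vprod k * newton_coeff i k) + tth (Suc n) z * tst n (st i) / vprod n"
    if "n \<le> d" for n z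
    using that
  proof (induction n)
    case (Suc n)
    have nz: "vprod n \<noteq> 0" "vp (Suc n) \<noteq> 0" using vprod_nz[of n] vp_nz[of "Suc n"] Suc.prems by auto
    show ?case
      using Suc nz by (simp add: newton_coeff_def divide_simps) algebra
  qed (simp add: newton_coeff_def algebra_simps)
  from this[of d "th x"] show ?thesis
    using tth_eq_0[of x "Suc d"] assms by (simp add: u_fun_eq sum_distrib_left del: tth_Suc)
qed

lemma u_fun_three_term:
  assumes "i \<le> d" "x \<le> d"
  shows "th x * u_fun P i (th x) = coeff_c P i * u_fun P (i - 1) (th x)
    + coeff_a P i * u_fun P i (th x) + coeff_b P i * u_fun P (Suc i) (th x)"
proof -
  have "coeff_b P i * u_fun P (Suc i) (th x)
      = coeff_b P i * (\<Sum>k\<le>d. tth k (th x) * tst k (st (Suc i)) / vprod k)"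
    using assms u_fun_eq[of "Suc i"] by (cases "i < d") (simp_all add: coeff_b_def)
  moreover have "u_fun P (i - 1) (th x) = (\<Sum>k\<le>d. tth k (th x) * tst k (st (i - 1)) / vprod k)"
    using assms u_fun_eq[of "i - 1"] by simp
  moreover have "th x * u_fun P i (th x) = (\<Sum>k\<le>d.
      coeff_c P i * (tth k (th x) * tst k (st (i - 1)) / vprod k)
      + coeff_a P i * (tth k (th x) * tst k (st i) / vprod k)
      + coeff_b P i * (tth k (th x) * tst k (st (Suc i)) / vprod k))"
    unfolding u_fun_times[OF assms] using assms
    by (intro sum.cong refl) (simp add: newton_coeff_three_term ring_distribs ac_simps add_divide_distrib)
  ultimately show ?thesis
    using u_fun_eq[OF assms(1)] by (simp only: sum.distrib sum_distrib_left)
qed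

lemma u_fun_0: "u_fun P 0 z = 1"
  by (simp add: u_fun_def)

text \<open>Askey-Wilson duality: passing to the dual array exchanges the two kinds of factors and
  keeps \<open>vp\<close>.\<close>

lemma u_fun_dual:
  assumes "i \<le> d" "x \<le> d"
  shows "u_fun (dual P) x (st i) = u_fun P i (th x)"
proof -
  interpret D: leonard_array "dual P" by (rule leonard_array_dual)
  show ?thesis
    using D.u_fun_eq[of x "st i"] u_fun_eq[of i "th x"] assms
    by (simp add: D.tth_def D.tst_def tth_def tst_def D.vprod_def vprod_def mult.commute)
qed

lemma k_par_0: "k_par P 0 = 1"
proof -
  have "{..d} - {0} = {1..d}" by auto
  moreover have "(\<Prod>h=1..d. st 0 - st h) \<noteq> 0" by (auto simp: st_eq_iff)
  ultimately show ?thesis by (simp add: k_par_def)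
qed

lemma k_par_nz: "i \<le> d \<Longrightarrow> k_par P i \<noteq> 0"
  using vp_nz ph_nz by (auto simp: k_par_def st_eq_iff)

lemma coeff_c_ends: "coeff_c P 0 = 0" "coeff_c P (Suc d) = 0"
  by (simp_all add: coeff_c_def)

lemma coeff_b_nz: "i < d \<Longrightarrow> coeff_b P i \<noteq> 0"
  using vp_nz[of "Suc i"] by (auto simp: coeff_b_def st_eq_iff)

lemma coeff_c_nz: "1 \<le> i \<Longrightarrow> i \<le> d \<Longrightarrow> coeff_c P i \<noteq> 0"
  using ph_nz[of i] by (auto simp: coeff_c_def st_eq_iff)

definition est :: "nat \<Rightarrow> complex \<Rightarrow> complex" where
  "est m v = (\<Prod>h<m. v - st (d - h))"

lemma est_nz: "i \<le> d \<Longrightarrow> m \<le> d - i \<Longrightarrow> est m (st i) \<noteq> 0"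
  by (auto simp: est_def st_eq_iff)

lemma prod_except_split:
  assumes "i \<le> d"
  shows "(\<Prod>h\<in>{..d} - {i}. st i - st h) = tst i (st i) * est (d - i) (st i)"
proof -
  have "{..d} - {i} = {..<i} \<union> {i<..d}" using assms by auto
  then have "(\<Prod>h\<in>{..d} - {i}. st i - st h) = tst i (st i) * (\<Prod>h\<in>{i<..d}. st i - st h)"
    unfolding tst_def by (simp add: prod.union_disjoint Int_def)
  also have "(\<Prod>h\<in>{i<..d}. st i - st h) = est (d - i) (st i)"
    unfolding est_def using assms
    by (intro prod.reindex_bij_witness[of _ "\<lambda>h. d - h" "\<lambda>h. d - h"]) auto
  finally show ?thesis .
qed

text \<open>Detailed balance: the weights k_i symmetrize the tridiagonal matrix with entries b_i,
  a_i, c_i. Consequently \<open>p_par\<close> satisfies the transpose of the recurrence of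
  \<open>u_fun\<close>.\<close>

lemma k_par_balance:
  assumes "i < d"
  shows "k_par P (Suc i) * coeff_c P (Suc i) = k_par P i * coeff_b P i"
proof -
  have c: "coeff_c P (Suc i) = ph (Suc i) * (est (d - Suc i) (st (Suc i)) / est (d - i) (st i))"
  proof -
    have "{..d - Suc i} = {..<d - i}" using assms by auto
    then show ?thesis using assms unfolding coeff_c_def est_def by simp
  qed
  have b: "coeff_b P i = vp (Suc i) * (tst i (st i) / tst (Suc i) (st (Suc i)))"
    using assms unfolding coeff_b_def tst_def by (simp add: lessThan_Suc_atMost[symmetric] del: prod.lessThan_Suc)
  have nz: "tst i (st i) \<noteq> 0" "tst (Suc i) (st (Suc i)) \<noteq> 0" "est (d - i) (st i) \<noteq> 0"
    "est (d - Suc i) (st (Suc i)) \<noteq> 0" "ph (Suc i) \<noteq> 0"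
    using assms tst_nz[of i i] tst_nz[of "Suc i" "Suc i"] est_nz[of i] est_nz[of "Suc i"] ph_nz by auto
  show ?thesis
    unfolding k_par_def b c
    using nz prod_except_split[of i] prod_except_split[of "Suc i"] assms
    by (simp add: prod.nat_ivl_Suc' mult.commute mult.left_commute del: tst_Suc)
qed

lemma p_par_three_term:
  assumes "i \<le> d" "x \<le> d"
  shows "th x * p_par P x i = (if i = 0 then 0 else coeff_b P (i - 1) * p_par P x (i - 1))
    + coeff_a P i * p_par P x i + coeff_c P (Suc i) * p_par P x (Suc i)"
proof -
  define B where "B = (if i = 0 then 0 else coeff_b P (i - 1) * k_par P (i - 1))"
  have 1: "k_par P i * coeff_c P i = B"
    unfolding B_def using k_par_balance[of "i - 1"] assms by (cases i) (auto simp: coeff_c_def)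
  have 2: "k_par P i * coeff_b P i = coeff_c P (Suc i) * k_par P (Suc i)"
  proof (cases "i < d")
    case True
    then show ?thesis using k_par_balance[of i] by (simp only: mult.commute)
  next
    case False
    then show ?thesis using assms by (simp add: coeff_c_def coeff_b_def)
  qed
  have 3: "(if i = 0 then 0 else coeff_b P (i - 1) * p_par P x (i - 1)) = B * u_fun P (i - 1) (th x)"
    by (simp add: B_def p_par_def)
  show ?thesis
    unfolding 3 unfolding p_par_def using u_fun_three_term[OF assms] 1 2 by algebra
qed

text \<open>The recurrence of the dual array read through duality; it runs in the row index, on
  which the factor k_par P j does not depend.\<close>

lemma p_par_difference:
  assumes "y \<le> d" "j \<le> d"
  shows "st j * p_par P y j = coeff_c (dual P) y * p_par P (y - 1) j
    + coeff_a (dual P) y * p_par P y j + coeff_b (dual P) y * p_par P (Suc y) j"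
proof -
  interpret D: leonard_array "dual P" by (rule leonard_array_dual)
  have "coeff_b (dual P) y * u_fun (dual P) (Suc y) (st j) = coeff_b (dual P) y * u_fun P j (th (Suc y))"
    using u_fun_dual[of j "Suc y"] assms by (cases "y < d") (auto simp: coeff_b_def)
  then show ?thesis
    using D.u_fun_three_term[of y j] assms u_fun_dual[of j y] u_fun_dual[of j "y - 1"]
    unfolding p_par_def by (simp, algebra)
qed

section \<open>Orthogonality of p and the value of nu\<close>

lemma sum_shift:
  fixes f u :: "nat \<Rightarrow> complex"
  shows "(\<Sum>i\<le>n. (if i = 0 then 0 else f (i - 1)) * u i) + f n * u (Suc n) = (\<Sum>i\<le>n. f i * u (Suc i))"
  by (induction n) auto

text \<open>Summation by parts: \<open>p_par P x i\<close> is a left and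
  \<open>u_fun P i (th y)\<close> a right eigenvector of the same tridiagonal matrix. Since the
  eigenvalues differ for x \<noteq> y, the pairing \<open>gram\<close> is then zero.\<close>

lemma p_par_adjoint:
  assumes "x \<le> d" "y \<le> d"
  shows "th x * (\<Sum>i\<le>d. p_par P x i * u_fun P i (th y)) = th y * (\<Sum>i\<le>d. p_par P x i * u_fun P i (th y))"
proof -
  define p where "p i = p_par P x i" for i
  define u where "u i = u_fun P i (th y)" for i
  have 1: "(\<Sum>i\<le>d. (if i = 0 then 0 else coeff_b P (i - 1) * p (i - 1)) * u i)
      = (\<Sum>i\<le>d. p i * (coeff_b P i * u (Suc i)))"
    using sum_shift[where n = d and f = "\<lambda>i. coeff_b P i * p i" and u = u] by (simp add: coeff_b_def ac_simps)
  have 2: "(\<Sum>i\<le>d. coeff_c P (Suc i) * p (Suc i) * u i) = (\<Sum>i\<le>d. p i * (coeff_c P i * u (i - 1)))"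
  proof -
    have "(if i = 0 then 0 else u (i - 1)) * (coeff_c P i * p i) = p i * (coeff_c P i * u (i - 1))" for i
      by (cases "i = 0") (simp_all add: coeff_c_ends)
    then have "(\<Sum>i\<le>d. (if i = 0 then 0 else u (i - 1)) * (coeff_c P i * p i))
        = (\<Sum>i\<le>d. p i * (coeff_c P i * u (i - 1)))"
      by (rule sum.cong[OF refl])
    moreover have "(\<Sum>i\<le>d. coeff_c P (Suc i) * p (Suc i) * u i) = (\<Sum>i\<le>d. u i * (coeff_c P (Suc i) * p (Suc i)))"
      by (simp add: mult.commute)
    ultimately show ?thesis
      using sum_shift[where n = d and f = u and u = "\<lambda>i. coeff_c P i * p i"] coeff_c_ends(2)
      by simp
  qed
  have "th x * (\<Sum>i\<le>d. p i * u i) = (\<Sum>i\<le>d. (th x * p i) * u i)"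
    by (simp add: sum_distrib_left mult.assoc)
  also have "\<dots> = (\<Sum>i\<le>d. (if i = 0 then 0 else coeff_b P (i - 1) * p (i - 1)) * u i
      + coeff_a P i * p i * u i + coeff_c P (Suc i) * p (Suc i) * u i)"
    using p_par_three_term assms unfolding p_def by (intro sum.cong) (auto simp: algebra_simps)
  also have "\<dots> = (\<Sum>i\<le>d. p i * (coeff_b P i * u (Suc i)) + coeff_a P i * p i * u i + p i * (coeff_c P i * u (i - 1)))"
    using 1 2 by (simp add: sum.distrib)
  also have "\<dots> = (\<Sum>i\<le>d. p i * (th y * u i))"
    using u_fun_three_term assms unfolding u_def by (intro sum.cong) (auto simp: algebra_simps)
  also have "\<dots> = th y * (\<Sum>i\<le>d. p i * u i)"
    by (simp add: sum_distrib_left ac_simps)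
  finally show ?thesis unfolding p_def u_def .
qed

definition gram :: "nat \<Rightarrow> nat \<Rightarrow> complex" where
  "gram x y = (\<Sum>i\<le>d. p_par P x i * u_fun P i (th y))"

lemma gram_orthogonal: "x \<le> d \<Longrightarrow> y \<le> d \<Longrightarrow> x \<noteq> y \<Longrightarrow> gram x y = 0"
  using p_par_adjoint[of x y] th_eq_iff[of x y] by (simp add: gram_def)

text \<open>The sum of st i * p_par P x i * u_fun P i (th (x + 1)) is evaluated by the difference
  equation in either factor. Orthogonality leaves one term each time, which links consecutive
  diagonal entries by b_x and c_{x + 1} of the dual array, and the balance of the dual weights
  absorbs these.\<close>

lemma gram_diag:
  assumes "x \<le> d"
  shows "gram x x * k_par (dual P) x = gram 0 0"
  using assms
proof (induction x)
  case 0
  show ?case using leonard_array.k_par_0[OF leonard_array_dual] by simp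
next
  case (Suc x)
  interpret D: leonard_array "dual P" by (rule leonard_array_dual)
  have x: "x < d" "x \<le> d" using Suc by auto
  have "(\<Sum>i\<le>d. (st i * p_par P x i) * u_fun P i (th (Suc x)))
      = coeff_c (dual P) x * gram (x - 1) (Suc x) + coeff_a (dual P) x * gram x (Suc x)
        + coeff_b (dual P) x * gram (Suc x) (Suc x)"
    using p_par_difference[OF x(2)]
    by (simp add: gram_def sum_distrib_left sum.distrib[symmetric] algebra_simps)
  also have "\<dots> = coeff_b (dual P) x * gram (Suc x) (Suc x)"
    using gram_orthogonal[of "x - 1" "Suc x"] gram_orthogonal[of x "Suc x"] x by simp
  finally have 1: "(\<Sum>i\<le>d. (st i * p_par P x i) * u_fun P i (th (Suc x))) = coeff_b (dual P) x * gram (Suc x) (Suc x)" .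
  have eq: "st i * u_fun P i (th (Suc x)) = coeff_c (dual P) (Suc x) * u_fun P i (th x)
    + coeff_a (dual P) (Suc x) * u_fun P i (th (Suc x)) + coeff_b (dual P) (Suc x) * u_fun P i (th (Suc (Suc x)))"
    if "i \<le> d" for i
    using p_par_difference[of "Suc x" i] that x k_par_nz[OF that]
    unfolding p_par_def by (simp add: mult.left_commute[of _ "k_par P i"] flip: distrib_left)
  have "(st i * p_par P x i) * u_fun P i (th (Suc x))
    = coeff_c (dual P) (Suc x) * (p_par P x i * u_fun P i (th x))
    + coeff_a (dual P) (Suc x) * (p_par P x i * u_fun P i (th (Suc x)))
    + coeff_b (dual P) (Suc x) * (p_par P x i * u_fun P i (th (Suc (Suc x))))"
    if "i \<le> d" for i
    using eq[OF that] by algebra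
  then have "(\<Sum>i\<le>d. (st i * p_par P x i) * u_fun P i (th (Suc x)))
      = coeff_c (dual P) (Suc x) * gram x x + coeff_a (dual P) (Suc x) * gram x (Suc x)
        + coeff_b (dual P) (Suc x) * gram x (Suc (Suc x))"
    unfolding gram_def sum_distrib_left sum.distrib[symmetric]
    by (intro sum.cong) auto
  also have "\<dots> = coeff_c (dual P) (Suc x) * gram x x"
    using gram_orthogonal[of x "Suc x"] gram_orthogonal[of x "Suc (Suc x)"] x
    by (cases "Suc x < d") (auto simp: coeff_b_def)
  finally have "coeff_b (dual P) x * gram (Suc x) (Suc x) = coeff_c (dual P) (Suc x) * gram x x"
    using 1 by simp
  moreover have "k_par (dual P) (Suc x) * coeff_c (dual P) (Suc x) = k_par (dual P) x * coeff_b (dual P) x"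
    using D.k_par_balance[of x] x by simp
  ultimately have "coeff_b (dual P) x * (gram (Suc x) (Suc x) * k_par (dual P) (Suc x))
      = coeff_b (dual P) x * (gram x x * k_par (dual P) x)"
    by algebra
  then show ?case using D.coeff_b_nz[of x] x Suc.IH by simp
qed

lemma tth_independent:
  assumes "\<And>x. x \<le> d \<Longrightarrow> (\<Sum>k\<le>d. tth k (th x) * w k) = 0" "k \<le> d"
  shows "w k = 0"
  using assms(2)
proof (induction k rule: less_induct)
  case (less k)
  have "(\<Sum>j\<le>d. tth j (th k) * w j) = (\<Sum>j\<in>{k}. tth j (th k) * w j)"
  proof (rule sum.mono_neutral_right)
    show "\<forall>j\<in>{..d} - {k}. tth j (th k) * w j = 0"
    proof
      fix j
      assume "j \<in> {..d} - {k}"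
      then show "tth j (th k) * w j = 0"
        using less.IH[of j] tth_eq_0[of k j] by (cases "j < k") auto
    qed
  qed (use less in auto)
  then show ?case using assms(1)[OF less.prems] tth_nz[of k k] less.prems by simp
qed

text \<open>For \<open>n = d\<close> the right-hand side is the indicator function of \<open>th 0\<close> on the nodes, so this is
  its interpolation polynomial; comparing leading coefficients gives the value of \<open>nu_par\<close>.\<close>

lemma newton_indicator:
  assumes "n \<le> d"
  shows "(\<Sum>k\<le>n. tth k z / (\<Prod>h=1..k. th 0 - th h)) = (\<Prod>h=1..n. (z - th h) / (th 0 - th h))"
  using assms
proof (induction n)
  case (Suc n)
  have nz: "(\<Prod>h=1..n. th 0 - th h) \<noteq> 0" "th 0 - th (Suc n) \<noteq> 0"
    using Suc by (auto simp: th_eq_iff)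
  have t: "tth (Suc n) z = (z - th 0) * (\<Prod>h=1..n. z - th h)"
    unfolding tth_def lessThan_Suc_atMost atMost_atLeast0 by (subst prod.atLeast_Suc_atMost) auto
  have "(\<Sum>k\<le>n. tth k z / (\<Prod>h=1..k. th 0 - th h)) = (\<Prod>h=1..n. (z - th h) / (th 0 - th h))"
    using Suc by simp
  then have "(\<Sum>k\<le>Suc n. tth k z / (\<Prod>h=1..k. th 0 - th h))
    = (\<Prod>h=1..n. z - th h) / (\<Prod>h=1..n. th 0 - th h)
    + (z - th 0) * (\<Prod>h=1..n. z - th h) / ((\<Prod>h=1..n. th 0 - th h) * (th 0 - th (Suc n)))"
    by (simp add: t prod_dividef del: tth_Suc)
  also have "\<dots> = (\<Prod>h=1..Suc n. (z - th h) / (th 0 - th h))"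
    using nz by (simp add: prod_dividef field_simps)
  finally show ?case .
qed simp

lemma gram_0_0: "gram 0 0 = nu_par P"
proof -
  \<comment> \<open>The Newton coefficients of the polynomial that takes the value
    \<open>gram x 0\<close> at th x.\<close>
  define s where "s k = (\<Sum>i\<le>d. k_par P i * tst k (st i)) / vprod k" for k
  define Q where "Q k = (\<Prod>h=1..k. th 0 - th h)" for k
  have Q: "Q k \<noteq> 0" if "k \<le> d" for k using that by (auto simp: Q_def th_eq_iff)
  have "s d - gram 0 0 / Q d = 0"
  proof (rule tth_independent[where w = "\<lambda>k. s k - gram 0 0 / Q k"])
    fix x
    assume x: "x \<le> d"
    have "(\<Sum>k\<le>d. tth k (th x) * s k) = (\<Sum>i\<le>d. \<Sum>k\<le>d. k_par P i * (tth k (th x) * tst k (st i) / vprod k))"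
      unfolding s_def by (subst sum.swap) (simp add: sum_distrib_left sum_divide_distrib ac_simps)
    also have "\<dots> = gram x 0"
      unfolding gram_def p_par_def
    proof (intro sum.cong refl)
      fix i
      assume "i \<in> {..d}"
      then have "u_fun P i (th 0) = 1" "u_fun P i (th x) = (\<Sum>k\<le>d. tth k (th x) * tst k (st i) / vprod k)"
        using u_fun_dual[of i 0] leonard_array.u_fun_0[OF leonard_array_dual] u_fun_eq[of i] by auto
      then show "(\<Sum>k\<le>d. k_par P i * (tth k (th x) * tst k (st i) / vprod k))
          = k_par P i * u_fun P i (th x) * u_fun P i (th 0)"
        by (simp add: sum_distrib_left)
    qed
    also have "\<dots> = gram 0 0 * (\<Prod>h=1..d. (th x - th h) / (th 0 - th h))"
    proof (cases "x = 0")
      case True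
      have "(\<Prod>h=1..d. (th 0 - th h) / (th 0 - th h)) = 1"
        by (rule prod.neutral) (auto simp: th_eq_iff)
      then show ?thesis using True by simp
    next
      case False
      then have "(\<Prod>h=1..d. (th x - th h) / (th 0 - th h)) = 0" using x by (auto simp: th_eq_iff)
      then show ?thesis using gram_orthogonal[of x 0] x False by simp
    qed
    also have "\<dots> = (\<Sum>k\<le>d. tth k (th x) * (gram 0 0 / Q k))"
      unfolding newton_indicator[OF order_refl, symmetric] Q_def
      by (simp add: sum_distrib_left ac_simps)
    finally show "(\<Sum>k\<le>d. tth k (th x) * (s k - gram 0 0 / Q k)) = 0"
      by (simp add: right_diff_distrib sum_subtractf)
  qed simp
  then have "gram 0 0 = s d * Q d" using Q[of d] by (simp add: field_simps)
  \<comment> \<open>In the top coefficient only i = d survives, because the earlier nodes are zeros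
    of \<open>tst d\<close>. This is why nu has a product formula.\<close>
  also have "s d = k_par P d * tst d (st d) / vprod d"
  proof -
    have "(\<Sum>i\<le>d. k_par P i * tst d (st i)) = (\<Sum>i\<in>{d}. k_par P i * tst d (st i))"
      by (rule sum.mono_neutral_right) (auto simp: tst_eq_0)
    then show ?thesis by (simp add: s_def)
  qed
  also have "\<dots> = (\<Prod>h=1..d. (st 0 - st h) / ph h)"
  proof -
    have v: "vprod d = (\<Prod>h=1..d. vp h)"
      unfolding vprod_def by (rule prod.reindex_bij_witness[of _ "\<lambda>h. h - 1" Suc]) auto
    have e: "(\<Prod>h\<in>{..d} - {d}. st d - st h) = tst d (st d)"
      using prod_except_split[of d] by (simp add: est_def)
    have "(\<Prod>h=1..d. vp h) \<noteq> 0" "tst d (st d) \<noteq> 0"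
      using vp_nz tst_nz[of d d] by auto
    then show ?thesis unfolding k_par_def v e by (simp add: prod_dividef)
  qed
  finally show ?thesis
    unfolding nu_par_def Q_def by (simp add: prod.distrib[symmetric] ac_simps)
qed

lemma nu_par_nz: "nu_par P \<noteq> 0"
  using ph_nz by (auto simp: nu_par_def th_eq_iff st_eq_iff)

lemma p_par_dual:
  "i \<le> d \<Longrightarrow> y \<le> d \<Longrightarrow> p_par (dual P) i y = k_par (dual P) y * u_fun P i (th y)"
  using u_fun_dual by (simp add: p_par_def)

lemma p_par_orthogonal:
  assumes "x \<le> d" "y \<le> d"
  shows "(\<Sum>i\<le>d. p_par P x i * p_par (dual P) i y) = (if x = y then nu_par P else 0)"
proof -
  have "(\<Sum>i\<le>d. p_par P x i * p_par (dual P) i y) = gram x y * k_par (dual P) y"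
    unfolding gram_def sum_distrib_right using assms by (intro sum.cong) (auto simp: p_par_dual)
  then show ?thesis using gram_diag gram_0_0 gram_orthogonal assms by auto
qed

lemma nu_par_dual: "nu_par (dual P) = nu_par P"
proof -
  have "(\<Prod>h=1..d. ph (d - h + 1)) = (\<Prod>h=1..d. ph h)"
    by (rule prod.reindex_bij_witness[of _ "\<lambda>h. d - h + 1" "\<lambda>h. d - h + 1"]) auto
  then show ?thesis
    by (simp add: nu_par_def prod_dividef prod.distrib mult.commute)
qed

text \<open>Dualizing twice restores \<open>phi\<close> only at the indices 1..d, so the records
  need not be equal and the identity is stated for the matrix entries.\<close>

lemma p_par_dual_dual:
  assumes "i \<le> d"
  shows "p_par (dual (dual P)) x i = p_par P x i"
proof -
  have "(\<Prod>h=1..i. vp h / ph (d - (d - h + 1) + 1)) = (\<Prod>h=1..i. vp h / ph h)"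
    using assms by (intro prod.cong) auto
  then show ?thesis
    unfolding p_par_def k_par_def u_fun_def by simp
qed

lemma p_par_dual_orthogonal:
  assumes "i \<le> d" "j \<le> d"
  shows "(\<Sum>x\<le>d. p_par (dual P) i x * p_par P x j) = (if i = j then nu_par P else 0)"
  using leonard_array.p_par_orthogonal[OF leonard_array_dual, of i j] assms
  by (simp add: p_par_dual_dual nu_par_dual)

lemma p_par_column_orthogonal:
  assumes "i \<le> d" "j \<le> d"
  shows "(\<Sum>x\<le>d. p_par P x i * p_par P x j * k_par (dual P) x) = (if i = j then k_par P i * nu_par P else 0)"
proof -
  have "(\<Sum>x\<le>d. p_par P x i * p_par P x j * k_par (dual P) x)
      = k_par P i * (\<Sum>x\<le>d. p_par (dual P) i x * p_par P x j)"
    unfolding sum_distrib_left using assms by (intro sum.cong) (auto simp: p_par_dual p_par_def[of P])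
  then show ?thesis using p_par_dual_orthogonal[OF assms] by simp
qed

lemma p_par_columns_independent:
  assumes "\<And>x. x \<le> d \<Longrightarrow> (\<Sum>i\<le>d. w i * p_par P x i) = 0" "j \<le> d"
  shows "w j = 0"
proof -
  have "0 = (\<Sum>x\<le>d. p_par (dual P) j x * (\<Sum>i\<le>d. w i * p_par P x i))"
    using assms by simp
  also have "\<dots> = (\<Sum>i\<le>d. \<Sum>x\<le>d. w i * (p_par (dual P) j x * p_par P x i))"
    unfolding sum_distrib_left by (subst sum.swap) (simp add: ac_simps)
  also have "\<dots> = (\<Sum>i\<le>d. w i * (\<Sum>x\<le>d. p_par (dual P) j x * p_par P x i))"
    by (simp add: sum_distrib_left)
  also have "\<dots> = (\<Sum>i\<le>d. if i = j then w i * nu_par P else 0)"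
    using assms(2) by (intro sum.cong) (auto simp: p_par_dual_orthogonal)
  also have "\<dots> = w j * nu_par P"
    using assms(2) by simp
  finally show ?thesis using nu_par_nz by simp
qed

end

section \<open>Diagonal endomorphisms and orthogonal bases\<close>

locale orthogonal_space =
  complex_space scale V for scale :: "complex \<Rightarrow> 'v::ab_group_add \<Rightarrow> 'v" (infixr "*s" 75) and V +
  fixes form :: "'v \<Rightarrow> 'v \<Rightarrow> complex"
  assumes form: "nondeg_sym_bilinear_form form"
begin

lemmas V_closed [simp] = subspace_0[OF subspace_carrier] subspace_add[OF subspace_carrier]
  subspace_scale[OF subspace_carrier] subspace_diff[OF subspace_carrier]
  subspace_sum[OF subspace_carrier]

lemma form_add: "u \<in> V \<Longrightarrow> v \<in> V \<Longrightarrow> w \<in> V \<Longrightarrow> form (u + v) w = form u w + form v w"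
  and form_scale: "u \<in> V \<Longrightarrow> w \<in> V \<Longrightarrow> form (c *s u) w = c * form u w"
  and form_sym: "u \<in> V \<Longrightarrow> w \<in> V \<Longrightarrow> form u w = form w u"
  using form unfolding nondeg_sym_bilinear_form_def by blast+

lemma form_0: "w \<in> V \<Longrightarrow> form 0 w = 0"
  using form_scale[of w w 0] by simp

lemma form_scale_right: "u \<in> V \<Longrightarrow> w \<in> V \<Longrightarrow> form u (c *s w) = c * form u w"
  using form_scale form_sym by (metis V_closed(3))

lemma form_diff: "u \<in> V \<Longrightarrow> v \<in> V \<Longrightarrow> w \<in> V \<Longrightarrow> form (u - v) w = form u w - form v w"
  using form_add[of "u - v" v w] by simp

lemma form_sum: "(\<And>i. i \<in> A \<Longrightarrow> f i \<in> V) \<Longrightarrow> w \<in> V \<Longrightarrow> form (sum f A) w = (\<Sum>i\<in>A. form (f i) w)"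
  by (induction A rule: infinite_finite_induct) (simp_all add: form_0 form_add)

lemma endos_in: "h \<in> endos \<Longrightarrow> v \<in> V \<Longrightarrow> h v \<in> V"
  and endos_add: "h \<in> endos \<Longrightarrow> u \<in> V \<Longrightarrow> v \<in> V \<Longrightarrow> h (u + v) = h u + h v"
  and endos_scale: "h \<in> endos \<Longrightarrow> v \<in> V \<Longrightarrow> h (c *s v) = c *s h v"
  and endos_outside: "h \<in> endos \<Longrightarrow> v \<notin> V \<Longrightarrow> h v = 0"
  by (simp_all add: endos_def)

lemma endos_0: "h \<in> endos \<Longrightarrow> h 0 = 0"
  using endos_scale[of h 0 0] by simp

lemma endos_sum: "h \<in> endos \<Longrightarrow> (\<And>i. i \<in> A \<Longrightarrow> f i \<in> V) \<Longrightarrow> h (sum f A) = (\<Sum>i\<in>A. h (f i))"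
  by (induction A rule: infinite_finite_induct) (simp_all add: endos_0 endos_add)

lemma endos_lincomb:
  "h \<in> endos \<Longrightarrow> (\<And>i. i \<in> A \<Longrightarrow> f i \<in> V) \<Longrightarrow> h (\<Sum>i\<in>A. c i *s f i) = (\<Sum>i\<in>A. c i *s h (f i))"
  by (simp add: endos_sum endos_scale)

lemma endos_comp: "g \<in> endos \<Longrightarrow> h \<in> endos \<Longrightarrow> g \<circ> h \<in> endos"
  by (auto simp: endos_def endos_0)

lemma subspace_endos: "maps.subspace endos"
  by (rule maps.subspaceI) (auto simp: endos_def plus_fun_def zero_fun_def scale_right_distrib add_ac scale_left_commute)

lemma span_maps_pair:
  "h \<in> maps.span {X, Y} \<longleftrightarrow> (\<exists>a b. h = (\<lambda>v. a *s X v + b *s Y v))"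
proof -
  have "h \<in> maps.span {X, Y} \<longleftrightarrow> (\<exists>a b. h - (\<lambda>v. a *s X v) = (\<lambda>v. b *s Y v))"
    by (auto simp: maps.span_breakdown_eq[of h X] maps.span_singleton)
  also have "\<dots> \<longleftrightarrow> (\<exists>a b. h = (\<lambda>v. a *s X v + b *s Y v))"
    by (auto simp: fun_eq_iff fun_diff_def algebra_simps)
  finally show ?thesis .
qed

text \<open>The form is bilinear over \<complex>, so a nonzero vector may be isotropic. The
  condition on the norms makes the coordinates available as quotients and gives independence without
  a separate argument.\<close>

definition orth_basis :: "('i \<Rightarrow> 'v) \<Rightarrow> 'i set \<Rightarrow> bool" where
  "orth_basis B I \<longleftrightarrow> finite I \<and> (\<forall>l\<in>I. B l \<in> V \<and> form (B l) (B l) \<noteq> 0) \<and>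
     (\<forall>l\<in>I. \<forall>m\<in>I. l \<noteq> m \<longrightarrow> form (B l) (B m) = 0) \<and> V \<subseteq> span (B ` I)"

definition coord :: "('i \<Rightarrow> 'v) \<Rightarrow> 'i \<Rightarrow> 'v \<Rightarrow> complex" where
  "coord B l v = form v (B l) / form (B l) (B l)"

definition ext :: "('i \<Rightarrow> 'v) \<Rightarrow> 'i set \<Rightarrow> ('i \<Rightarrow> 'v) \<Rightarrow> 'v \<Rightarrow> 'v" where
  "ext B I M v = (if v \<in> V then \<Sum>l\<in>I. coord B l v *s M l else 0)"

lemma form_span_eq_0:
  assumes "\<And>b. b \<in> S \<Longrightarrow> b \<in> V \<and> form b w = 0" "w \<in> V" "v \<in> span S"
  shows "v \<in> V \<and> form v w = 0"
  using assms(3)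
proof (induction rule: span_induct_alt)
  case (step c x y)
  then show ?case using assms(1)[of x] assms(2) by (simp add: form_add form_scale)
qed (simp add: form_0 assms)

context
  fixes B :: "'i \<Rightarrow> 'v" and I
  assumes B: "orth_basis B I"
begin

lemma basis_finite: "finite I"
  and basis_in: "l \<in> I \<Longrightarrow> B l \<in> V"
  and basis_norm: "l \<in> I \<Longrightarrow> form (B l) (B l) \<noteq> 0"
  and basis_orth: "l \<in> I \<Longrightarrow> m \<in> I \<Longrightarrow> l \<noteq> m \<Longrightarrow> form (B l) (B m) = 0"
  using B by (auto simp: orth_basis_def)

lemma basis_nz: "l \<in> I \<Longrightarrow> B l \<noteq> 0"
  using basis_norm form_0 basis_in by metis

lemma coord_basis: "l \<in> I \<Longrightarrow> m \<in> I \<Longrightarrow> coord B l (B m) = (if l = m then 1 else 0)"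
  using basis_norm basis_orth by (auto simp: coord_def)

lemma coord_add: "l \<in> I \<Longrightarrow> u \<in> V \<Longrightarrow> v \<in> V \<Longrightarrow> coord B l (u + v) = coord B l u + coord B l v"
  and coord_scale: "l \<in> I \<Longrightarrow> v \<in> V \<Longrightarrow> coord B l (c *s v) = c * coord B l v"
  by (simp_all add: coord_def form_add form_scale basis_in add_divide_distrib)

lemma expansion:
  assumes "v \<in> V"
  shows "v = (\<Sum>l\<in>I. coord B l v *s B l)"
proof -
  let ?S = "{v \<in> V. v = (\<Sum>l\<in>I. coord B l v *s B l)}"
  have "subspace ?S"
  proof (rule subspaceI)
    show "0 \<in> ?S" using basis_in by (simp add: coord_def form_0)
    show "x + y \<in> ?S" if "x \<in> ?S" "y \<in> ?S" for x y
    proof -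
      have V: "x \<in> V" "y \<in> V" using that by auto
      have "(\<Sum>l\<in>I. coord B l (x + y) *s B l) = (\<Sum>l\<in>I. coord B l x *s B l) + (\<Sum>l\<in>I. coord B l y *s B l)"
        using V by (simp add: sum.distrib[symmetric] coord_add scale_left_distrib)
      then show ?thesis using that by auto
    qed
    show "c *s x \<in> ?S" if "x \<in> ?S" for c x
    proof -
      have V: "x \<in> V" using that by auto
      have "(\<Sum>l\<in>I. coord B l (c *s x) *s B l) = c *s (\<Sum>l\<in>I. coord B l x *s B l)"
        using V by (simp add: scale_sum_right coord_scale)
      then show ?thesis using that by auto
    qed
  qed
  moreover have "B ` I \<subseteq> ?S"
  proof
    fix v
    assume "v \<in> B ` I"
    then obtain m where m: "m \<in> I" "v = B m" by blast
    then have "(\<Sum>l\<in>I. coord B l v *s B l) = (\<Sum>l\<in>I. if l = m then B m else 0)"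
      by (intro sum.cong) (auto simp: coord_basis)
    then show "v \<in> ?S" using m basis_finite basis_in by simp
  qed
  ultimately have "span (B ` I) \<subseteq> ?S" by (simp add: span_minimal)
  then show ?thesis using assms B by (auto simp: orth_basis_def)
qed

lemma basis_span: "span (B ` I) = V"
  using B basis_in span_minimal[OF _ subspace_carrier, of "B ` I"] by (auto simp: orth_basis_def)

lemma basis_inj: "inj_on B I"
  using basis_norm basis_orth by (metis inj_onI)

lemma basis_independent: "independent (B ` I)"
proof
  assume "dependent (B ` I)"
  then obtain l where l: "l \<in> I" "B l \<in> span (B ` I - {B l})"
    unfolding dependent_def by blast
  have "form (B l) (B l) = 0"
    using form_span_eq_0[OF _ basis_in[OF l(1)] l(2)] basis_in basis_orth l(1) by auto
  then show False using basis_norm l by blast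
qed

lemma basis_dim: "dim V = card I"
  using dim_span_eq_card_independent[OF basis_independent] basis_span card_image[OF basis_inj] by simp

lemma basis_line_dim: "l \<in> I \<Longrightarrow> dim (span {B l}) = 1"
  using dim_span_eq_card_independent[of "{B l}"] basis_nz by simp

lemma ext_endos:
  assumes "\<And>l. l \<in> I \<Longrightarrow> M l \<in> V"
  shows "ext B I M \<in> endos"
  using assms unfolding endos_def ext_def
  by (auto simp: coord_add coord_scale scale_left_distrib sum.distrib scale_sum_right)

lemma ext_basis:
  assumes "m \<in> I"
  shows "ext B I M (B m) = M m"
proof -
  have "(\<Sum>l\<in>I. coord B l (B m) *s M l) = (\<Sum>l\<in>I. if l = m then M m else 0)"
    using assms by (intro sum.cong) (auto simp: coord_basis)
  then show ?thesis using assms basis_finite basis_in by (simp add: ext_def)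
qed

lemma endos_eqI:
  assumes "g \<in> endos" "h \<in> endos" "\<And>l. l \<in> I \<Longrightarrow> g (B l) = h (B l)"
  shows "g = h"
proof
  fix v
  show "g v = h v"
  proof (cases "v \<in> V")
    case True
    have "g (\<Sum>l\<in>I. coord B l v *s B l) = h (\<Sum>l\<in>I. coord B l v *s B l)"
      using endos_lincomb[OF assms(1), of I B] endos_lincomb[OF assms(2), of I B] assms(3) basis_in
      by simp
    then show ?thesis using expansion[OF True] by simp
  next
    case False
    then show ?thesis using endos_outside[OF assms(1)] endos_outside[OF assms(2)] by simp
  qed
qed

lemma form_basis_eq_0_iff:
  assumes "v \<in> V"
  shows "v = 0 \<longleftrightarrow> (\<forall>l\<in>I. form v (B l) = 0)"
  using expansion[OF assms] basis_in by (auto simp: coord_def form_0)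

lemma line_eqI:
  assumes "v \<in> V" "l \<in> I" "\<And>m. m \<in> I \<Longrightarrow> m \<noteq> l \<Longrightarrow> form v (B m) = 0"
  shows "v \<in> span {B l}"
proof -
  have "v = (\<Sum>m\<in>I. coord B m v *s B m)" by (rule expansion[OF assms(1)])
  also have "\<dots> = (\<Sum>m\<in>{l}. coord B m v *s B m)"
    using assms basis_finite by (intro sum.mono_neutral_right) (auto simp: coord_def)
  finally have "v = coord B l v *s B l" by simp
  then show ?thesis by (metis span_base span_scale singletonI)
qed

section \<open>Separating families of diagonal endomorphisms\<close>

context
  fixes H :: "('v \<Rightarrow> 'v) set" and ev :: "('v \<Rightarrow> 'v) \<Rightarrow> 'i \<Rightarrow> complex"
  assumes H: "H \<subseteq> endos" "\<And>h l. h \<in> H \<Longrightarrow> l \<in> I \<Longrightarrow> h (B l) = ev h l *s B l"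
    and sep: "\<And>l m. l \<in> I \<Longrightarrow> m \<in> I \<Longrightarrow> l \<noteq> m \<Longrightarrow> \<exists>h\<in>H. ev h l \<noteq> ev h m"
begin

lemma form_diagonal:
  assumes "h \<in> H" "v \<in> V" "l \<in> I"
  shows "form (h v) (B l) = ev h l * form v (B l)"
proof -
  have "h v = h (\<Sum>m\<in>I. coord B m v *s B m)" using expansion[OF assms(2)] by simp
  also have "\<dots> = (\<Sum>m\<in>I. coord B m v *s ev h m *s B m)"
    using endos_lincomb[of h I B "\<lambda>m. coord B m v"] assms H basis_in by auto
  finally have "form (h v) (B l) = (\<Sum>m\<in>I. coord B m v * (ev h m * form (B m) (B l)))"
    using basis_in assms by (simp add: form_sum form_scale mult.assoc)
  also have "\<dots> = (\<Sum>m\<in>I. if m = l then ev h l * form v (B l) else 0)"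
    using assms basis_orth basis_norm by (intro sum.cong) (auto simp: coord_def)
  finally show ?thesis using assms basis_finite by simp
qed

lemma eigenspace_eq_line:
  assumes "l \<in> I"
  shows "{v \<in> V. \<forall>h\<in>H. h v = ev h l *s v} = span {B l}"
proof (intro equalityI subsetI)
  fix v
  assume v: "v \<in> {v \<in> V. \<forall>h\<in>H. h v = ev h l *s v}"
  show "v \<in> span {B l}"
  proof (rule line_eqI)
    fix m
    assume m: "m \<in> I" "m \<noteq> l"
    then obtain h where h: "h \<in> H" "ev h l \<noteq> ev h m" using sep assms by metis
    have "v \<in> V" "h v = ev h l *s v" using v h(1) by auto
    then have "ev h l * form v (B m) = ev h m * form v (B m)"
      using form_diagonal[OF h(1), of v m] form_scale[of v "B m"] basis_in[OF m(1)] m by simp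
    then show "form v (B m) = 0" using h by simp
  qed (use v assms in auto)
next
  fix v
  assume "v \<in> span {B l}"
  then obtain k where k: "v = k *s B l" by (auto simp: span_singleton)
  have "h v = ev h l *s v" if h: "h \<in> H" for h
  proof -
    have "h v = k *s h (B l)" unfolding k using h H(1) basis_in[OF assms] by (auto intro: endos_scale)
    then show ?thesis unfolding k H(2)[OF h assms] by (simp add: mult.commute)
  qed
  then show "v \<in> {v \<in> V. \<forall>h\<in>H. h v = ev h l *s v}"
    using k basis_in[OF assms] by simp
qed

lemma common_eigenspace_iff:
  "common_eigenspace H W \<longleftrightarrow> (\<exists>l\<in>I. W = span {B l})"
proof
  assume "common_eigenspace H W"
  then obtain e where W: "W \<noteq> {0}" "W = {v\<in>V. \<forall>h\<in>H. h v = e h *s v}"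
    unfolding common_eigenspace_def by blast
  have "0 \<in> W" using W H by (auto simp: endos_0 subset_iff)
  then obtain v where v: "v \<in> W" "v \<noteq> 0" using W by blast
  then obtain l where l: "l \<in> I" "form v (B l) \<noteq> 0"
    using form_basis_eq_0_iff[of v] W by auto
  have "e h = ev h l" if h: "h \<in> H" for h
  proof -
    have "v \<in> V" "h v = e h *s v" using v W h by auto
    then show ?thesis
      using form_diagonal[OF h _ l(1), of v] form_scale[of v "B l"] basis_in[OF l(1)] l by simp
  qed
  then have "W = {v\<in>V. \<forall>h\<in>H. h v = ev h l *s v}" using W by auto
  then show "\<exists>l\<in>I. W = span {B l}" using eigenspace_eq_line l by auto
next
  assume "\<exists>l\<in>I. W = span {B l}"
  then obtain l where l: "l \<in> I" "W = span {B l}" by blast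
  have "B l \<in> W" using l by (simp add: span_base)
  then have "W \<noteq> {0}" using basis_nz l by auto
  then show "common_eigenspace H W"
    using eigenspace_eq_line[OF l(1)] l(2) unfolding common_eigenspace_def
    by (intro conjI exI[of _ "\<lambda>h. ev h l"]) simp_all
qed

lemma bij_betw_eigenspaces: "bij_betw (\<lambda>l. span {B l}) I {W. common_eigenspace H W}"
proof (rule bij_betw_imageI)
  show "inj_on (\<lambda>l. span {B l}) I"
  proof (rule inj_onI, rule ccontr)
    fix l m
    assume *: "l \<in> I" "m \<in> I" "span {B l} = span {B m}" "l \<noteq> m"
    then have "B l \<in> span {B m}" by (metis span_base singletonI)
    then obtain k where "B l = k *s B m" by (auto simp: span_singleton)
    then have "form (B l) (B l) = k * form (B m) (B l)"
      using form_scale[of "B m" "B l" k] * basis_in by simp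
    then show False using * basis_norm[of l] basis_orth[of m l] by simp
  qed
  show "(\<lambda>l. span {B l}) ` I = {W. common_eigenspace H W}"
    using common_eigenspace_iff by auto
qed

text \<open>The projection onto the line of \<open>B l\<close> is a polynomial in elements of
  \<open>H\<close>. It is applied one factor at a time, each removing one coordinate.\<close>

lemma invariant_subspace_contains:
  assumes W: "subspace W" "W \<subseteq> V" "\<And>h. h \<in> H \<Longrightarrow> h ` W \<subseteq> W"
    and v: "v \<in> W" "form v (B l) \<noteq> 0" and l: "l \<in> I"
  shows "B l \<in> W"
proof -
  have "\<exists>w\<in>W. form w (B l) \<noteq> 0 \<and> (\<forall>m\<in>M. form w (B m) = 0)" if "finite M" "M \<subseteq> I - {l}" for M
    using that
  proof (induction M rule: finite_induct)
    case empty
    then show ?case using v by auto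
  next
    case (insert m M)
    then obtain w where w: "w \<in> W" "form w (B l) \<noteq> 0" "\<forall>m\<in>M. form w (B m) = 0" by auto
    obtain h where h: "h \<in> H" "ev h l \<noteq> ev h m" using sep insert.prems l by blast
    \<comment> \<open>Subtracting the eigenvalue at \<open>m\<close> kills that coordinate,
      multiplies the one at \<open>l\<close> by a nonzero number and preserves the zeros already
      obtained.\<close>
    define w' where "w' = h w - ev h m *s w"
    have hw: "h w \<in> W" "w \<in> V" "h w \<in> V" using W w h by blast+
    have "w' \<in> W" using hw w W(1) by (simp add: w'_def subspace_diff subspace_scale)
    moreover have "form w' (B k) = (ev h k - ev h m) * form w (B k)" if "k \<in> I" for k
      using that hw h basis_in by (simp add: w'_def form_diff form_scale form_diagonal left_diff_distrib)
    ultimately show ?case using w h l insert.prems by (intro bexI[of _ w']) auto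
  qed
  from this[of "I - {l}"] obtain w where w: "w \<in> W" "form w (B l) \<noteq> 0" "\<forall>m\<in>I - {l}. form w (B m) = 0"
    using basis_finite by auto
  then have "w \<in> span {B l}" using line_eqI[of w l] W(2) l by auto
  then obtain k where k: "w = k *s B l" by (auto simp: span_singleton)
  moreover from this w have "k \<noteq> 0" using form_0 basis_in l by auto
  ultimately have "B l = inverse k *s w" by simp
  then show ?thesis using w W(1) by (metis subspace_scale)
qed

end

lemma diagonal_pair_eq:
  assumes "h \<in> maps.span {X, Y}" "l \<in> I" "X (B l) = t l *s B l" "Y (B l) = s l *s B l"
  shows "\<exists>c. h (B l) = c *s B l"
  using assms by (auto simp: span_maps_pair scale_left_distrib[symmetric])

lemma diagonal_pair_in_endos:
  assumes "X \<in> endos" "Y \<in> endos"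
  shows "maps.span {X, Y} \<subseteq> endos"
  using assms by (simp add: maps.span_minimal subspace_endos)

lemma diagonal_pair_plane:
  assumes XY: "X \<in> endos" "Y \<in> endos"
    and X: "\<And>l. l \<in> I \<Longrightarrow> X (B l) = t l *s B l" and Y: "\<And>l. l \<in> I \<Longrightarrow> Y (B l) = s l *s B l"
    and indep: "X \<noteq> Y" "maps.independent {X, Y}"
  shows "diagonalizable_plane (maps.span {X, Y})"
  unfolding diagonalizable_plane_def
proof (intro conjI ballI)
  note H = diagonal_pair_in_endos[OF XY]
  show "maps.span {X, Y} \<subseteq> endos" by (rule H)
  show "maps.subspace (maps.span {X, Y})" by simp
  show "maps.dim (maps.span {X, Y}) = 2"
    using maps.dim_span_eq_card_independent[OF indep(2)] indep(1) by simp
  show "diagonalizable h" if "h \<in> maps.span {X, Y}" for h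
    unfolding diagonalizable_def
  proof (intro exI[of _ "B ` I"] conjI ballI)
    fix b
    assume "b \<in> B ` I"
    then obtain l where "b = B l" "l \<in> I" by blast
    then show "\<exists>c. h b = c *s b" using diagonal_pair_eq[of h X Y l t s] that X Y by simp
  qed (fact basis_independent basis_span)+
  show "g \<circ> h = h \<circ> g" if gh: "g \<in> maps.span {X, Y}" "h \<in> maps.span {X, Y}" for g h
  proof (rule endos_eqI)
    show "g \<circ> h \<in> endos" "h \<circ> g \<in> endos" using gh H endos_comp by blast+
    fix l
    assume l: "l \<in> I"
    obtain a b where "g (B l) = a *s B l" "h (B l) = b *s B l"
      using diagonal_pair_eq[of g X Y l t s] diagonal_pair_eq[of h X Y l t s] gh l X[OF l] Y[OF l] by blast
    moreover have "g (b *s B l) = b *s g (B l)" "h (a *s B l) = a *s h (B l)"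
      using gh H basis_in[OF l] by (auto intro: endos_scale)
    ultimately show "(g \<circ> h) (B l) = (h \<circ> g) (B l)"
      by (simp add: mult.commute)
  qed
qed

text \<open>In a vanishing combination, l and n isolate the coefficient of Y because t agrees there;
  l and m then give that of X. The points used are the corner (0, 0) and its two neighbours, which
  exist since N \<ge> 1.\<close>

lemma diagonal_pair_independent:
  assumes X: "\<And>l. l \<in> I \<Longrightarrow> X (B l) = t l *s B l" and Y: "\<And>l. l \<in> I \<Longrightarrow> Y (B l) = s l *s B l"
    and lmn: "l \<in> I" "m \<in> I" "n \<in> I" "t l \<noteq> t m" "t l = t n" "s l \<noteq> s n"
  shows "X \<noteq> Y" "maps.independent {X, Y}"
proof -
  have *: "a = 0 \<and> b = 0" if "(\<lambda>v. a *s X v + b *s Y v) = (\<lambda>v. 0)" for a b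
  proof -
    have "a * t k + b * s k = 0" if k: "k \<in> I" for k
    proof -
      have "a *s X (B k) + b *s Y (B k) = 0" using \<open>_ = (\<lambda>v. 0)\<close> by meson
      then have "(a * t k + b * s k) *s B k = 0" using X Y k by (simp add: scale_left_distrib)
      then show ?thesis using basis_nz k by simp
    qed
    from this[OF lmn(1)] this[OF lmn(2)] this[OF lmn(3)]
    have "b * (s l - s n) = 0" "a * (t l - t m) + b * (s l - s m) = 0"
      using lmn(5) by algebra+
    then show ?thesis using lmn(4,6) by simp
  qed
  show neq: "X \<noteq> Y"
    using *[of 1 "-1"] by auto
  have "Y \<noteq> 0" using *[of 0 1] by (auto simp: zero_fun_def)
  moreover have "X \<notin> maps.span {Y}"
  proof
    assume "X \<in> maps.span {Y}"
    then obtain k where "X = (\<lambda>v. k *s Y v)" by (auto simp: maps.span_singleton)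
    then have "(\<lambda>v. 1 *s X v + (- k) *s Y v) = (\<lambda>v. 0)" by (simp add: fun_eq_iff)
    then show False using *[of 1 "- k"] by simp
  qed
  ultimately show "maps.independent {X, Y}"
    by (simp add: maps.independent_insert)
qed

text \<open>The eigenvalue of \<open>h \<in> H\<close> at \<open>B l\<close> is written as a coordinate of \<open>h (B l)\<close>, so that no
  eigenvalue function has to be chosen.\<close>

context
  fixes X Y :: "'v \<Rightarrow> 'v" and t s :: "'i \<Rightarrow> complex" and H
  assumes XY: "X \<in> endos" "Y \<in> endos"
    and X: "\<And>l. l \<in> I \<Longrightarrow> X (B l) = t l *s B l" and Y: "\<And>l. l \<in> I \<Longrightarrow> Y (B l) = s l *s B l"
    and sep: "\<And>l m. l \<in> I \<Longrightarrow> m \<in> I \<Longrightarrow> l \<noteq> m \<Longrightarrow> t l \<noteq> t m \<or> s l \<noteq> s m"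
    and H: "{X, Y} \<subseteq> H" "H \<subseteq> maps.span {X, Y}"
begin

lemma diagonal_pair_separates:
  "H \<subseteq> endos" "\<And>h l. h \<in> H \<Longrightarrow> l \<in> I \<Longrightarrow> h (B l) = coord B l (h (B l)) *s B l"
  "\<And>l m. l \<in> I \<Longrightarrow> m \<in> I \<Longrightarrow> l \<noteq> m \<Longrightarrow> \<exists>h\<in>H. coord B l (h (B l)) \<noteq> coord B m (h (B m))"
proof -
  show "H \<subseteq> endos" using H diagonal_pair_in_endos[OF XY] by blast
  show "h (B l) = coord B l (h (B l)) *s B l" if hl: "h \<in> H" "l \<in> I" for h l
  proof -
    obtain c where c: "h (B l) = c *s B l"
      using diagonal_pair_eq[of h X Y l t s] H hl X[OF hl(2)] Y[OF hl(2)] by blast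
    have "coord B l (c *s B l) = c"
      using coord_scale[of l "B l" c] coord_basis[of l l] basis_in hl by simp
    then show ?thesis unfolding c by simp
  qed
  have "coord B l (X (B l)) = t l" "coord B l (Y (B l)) = s l" if l: "l \<in> I" for l
    unfolding X[OF l] Y[OF l] using l coord_scale[of l "B l"] coord_basis[of l l] basis_in by simp_all
  then show "\<exists>h\<in>H. coord B l (h (B l)) \<noteq> coord B m (h (B m))" if "l \<in> I" "m \<in> I" "l \<noteq> m" for l m
    using sep[OF that] that H(1) by (metis insert_subset)
qed

text \<open>\<open>H\<close> may be any set between the pair and its span: the planes are spans,
  whereas the one-dimensionality condition for X and the dual Y concerns the bare pair.\<close>

lemma diagonal_pair_eigenspace_iff: "common_eigenspace H W \<longleftrightarrow> (\<exists>l\<in>I. W = span {B l})"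
  by (rule common_eigenspace_iff[where ev = "\<lambda>h l. coord B l (h (B l))"])
    (rule diagonal_pair_separates(1), erule (1) diagonal_pair_separates(2), erule (2) diagonal_pair_separates(3))

lemma diagonal_pair_eigenspaces: "bij_betw (\<lambda>l. span {B l}) I {W. common_eigenspace H W}"
  by (rule bij_betw_eigenspaces[where ev = "\<lambda>h l. coord B l (h (B l))"])
    (rule diagonal_pair_separates(1), erule (1) diagonal_pair_separates(2), erule (2) diagonal_pair_separates(3))

lemma diagonal_pair_invariant:
  assumes "subspace W" "W \<subseteq> V" "\<And>h. h \<in> H \<Longrightarrow> h ` W \<subseteq> W" "v \<in> W" "form v (B l) \<noteq> 0" "l \<in> I"
  shows "B l \<in> W"
  by (rule invariant_subspace_contains[where ev = "\<lambda>h l. coord B l (h (B l))", OF _ _ _ assms])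
    (rule diagonal_pair_separates(1), erule (1) diagonal_pair_separates(2), erule (2) diagonal_pair_separates(3))

end

end

end

section \<open>Change of basis by a parameter array\<close>

context orthogonal_space
begin

lemma transform_inverse:
  assumes P: "leonard_array P"
    and w: "\<And>j. j \<le> diam P \<Longrightarrow> w j = (\<Sum>y\<le>diam P. p_par P y j *s e y)"
    and y: "y \<le> diam P"
  shows "(\<Sum>j\<le>diam P. (p_par (dual P) j y / nu_par P) *s w j) = e y"
proof -
  interpret leonard_array P by (rule P)
  have "(\<Sum>j\<le>d. (p_par (dual P) j y / nu_par P) *s w j)
      = (\<Sum>j\<le>d. \<Sum>x\<le>d. (p_par P x j * p_par (dual P) j y / nu_par P) *s e x)"
    by (intro sum.cong) (simp_all add: w scale_sum_right mult.commute)
  also have "\<dots> = (\<Sum>x\<le>d. \<Sum>j\<le>d. (p_par P x j * p_par (dual P) j y / nu_par P) *s e x)"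
    by (rule sum.swap)
  also have "\<dots> = (\<Sum>x\<le>d. ((\<Sum>j\<le>d. p_par P x j * p_par (dual P) j y) / nu_par P) *s e x)"
    by (simp add: scale_sum_left sum_divide_distrib)
  also have "\<dots> = (\<Sum>x\<le>d. if x = y then e y else 0)"
    using y nu_par_nz by (intro sum.cong) (auto simp: p_par_orthogonal)
  finally show ?thesis using y by simp
qed

lemma sum_shift_scale:
  fixes u :: "nat \<Rightarrow> 'v"
  shows "(\<Sum>i\<le>n. a i *s (if i = 0 then 0 else b (i - 1) *s u (i - 1)))
    = (\<Sum>i\<le>n. if i < n then (a (Suc i) * b i) *s u i else 0)"
proof (induction n)
  case (Suc n)
  have "(\<Sum>i\<le>n. if i < Suc n then (a (Suc i) * b i) *s u i else 0)
    = (\<Sum>i\<le>n. if i < n then (a (Suc i) * b i) *s u i else 0) + (a (Suc n) * b n) *s u n"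
    by (cases n) (simp_all add: sum.distrib)
  with Suc show ?case by simp
qed simp

lemma sum_shift_scale':
  fixes u :: "nat \<Rightarrow> 'v"
  shows "(\<Sum>i\<le>n. a i *s (if i < n then c (Suc i) *s u (Suc i) else 0))
    = (\<Sum>i\<le>n. if i = 0 then 0 else (a (i - 1) * c i) *s u i)"
proof (induction n)
  case (Suc n)
  have "(\<Sum>i\<le>n. a i *s (if i < Suc n then c (Suc i) *s u (Suc i) else 0))
    = (\<Sum>i\<le>n. a i *s (if i < n then c (Suc i) *s u (Suc i) else 0)) + (a n * c (Suc n)) *s u (Suc n)"
    by (cases n) (simp_all add: sum.distrib)
  with Suc show ?case by simp
qed simp

text \<open>\<open>h\<close> multiplies row y of p by th y, and the recurrence in the column index
  turns this into neighbours of \<open>w j\<close>. It is applied to \<open>YY\<close> with \<Psi>_x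
  and to \<open>XX\<close> with \<Phi>_j.\<close>

lemma transform_diagonal:
  assumes P: "leonard_array P" and h: "h \<in> endos"
    and e: "\<And>y. y \<le> diam P \<Longrightarrow> e y \<in> V" "\<And>y. y \<le> diam P \<Longrightarrow> h (e y) = theta P y *s e y"
    and w: "\<And>j. j \<le> diam P \<Longrightarrow> w j = (\<Sum>y\<le>diam P. p_par P y j *s e y)"
    and j: "j \<le> diam P"
  shows "h (w j) = (if j = 0 then 0 else coeff_b P (j - 1) *s w (j - 1)) + coeff_a P j *s w j
    + (if j < diam P then coeff_c P (Suc j) *s w (Suc j) else 0)"
proof -
  interpret leonard_array P by (rule P)
  have "h (w j) = (\<Sum>y\<le>d. p_par P y j *s h (e y))"
    using w[OF j] endos_lincomb[OF h, of "{..d}" e] e(1) by simp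
  also have "\<dots> = (\<Sum>y\<le>d. (th y * p_par P y j) *s e y)"
    using e(2) by (intro sum.cong) (simp_all add: mult.commute)
  also have "\<dots> = (\<Sum>y\<le>d. (if j = 0 then 0 else coeff_b P (j - 1) * p_par P y (j - 1)) *s e y
     + coeff_a P j *s p_par P y j *s e y + (coeff_c P (Suc j) * p_par P y (Suc j)) *s e y)"
    using j by (intro sum.cong) (simp_all add: p_par_three_term scale_left_distrib)
  also have "\<dots> = (\<Sum>y\<le>d. (if j = 0 then 0 else coeff_b P (j - 1) * p_par P y (j - 1)) *s e y)
      + coeff_a P j *s w j + (\<Sum>y\<le>d. (coeff_c P (Suc j) * p_par P y (Suc j)) *s e y)"
    by (simp add: sum.distrib w[OF j] scale_sum_right)
  also have "(\<Sum>y\<le>d. (if j = 0 then 0 else coeff_b P (j - 1) * p_par P y (j - 1)) *s e y)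
      = (if j = 0 then 0 else coeff_b P (j - 1) *s w (j - 1))"
    using w[of "j - 1"] j by (simp add: scale_sum_right)
  also have "(\<Sum>y\<le>d. (coeff_c P (Suc j) * p_par P y (Suc j)) *s e y)
      = (if j < d then coeff_c P (Suc j) *s w (Suc j) else 0)"
    using w[of "Suc j"] j coeff_c_ends by (cases "j < d") (auto simp: scale_sum_right)
  finally show ?thesis .
qed

text \<open>Reindexing moves the shifts from \<open>e\<close> to the coefficients, where the
  difference equation in the row index adds them up to st j. It is applied to \<open>YYs\<close>
  with \<Psi>_x and to \<open>XXs\<close> with \<Phi>_j.\<close>

lemma transform_tridiagonal:
  assumes P: "leonard_array P" and h: "h \<in> endos"
    and e: "\<And>y. y \<le> diam P \<Longrightarrow> e y \<in> V"
    and he: "\<And>y. y \<le> diam P \<Longrightarrow> h (e y) = (if y = 0 then 0 else coeff_b (dual P) (y - 1) *s e (y - 1))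
      + coeff_a (dual P) y *s e y + (if y < diam P then coeff_c (dual P) (Suc y) *s e (Suc y) else 0)"
    and w: "\<And>j. j \<le> diam P \<Longrightarrow> w j = (\<Sum>y\<le>diam P. p_par P y j *s e y)"
    and j: "j \<le> diam P"
  shows "h (w j) = theta_star P j *s w j"
proof -
  interpret leonard_array P by (rule P)
  let ?b = "coeff_b (dual P)" and ?a = "coeff_a (dual P)" and ?c = "coeff_c (dual P)"
  have "h (w j) = (\<Sum>y\<le>d. p_par P y j *s h (e y))"
    using w[OF j] endos_lincomb[OF h, of "{..d}" e] e(1) by simp
  also have "\<dots> = (\<Sum>y\<le>d. p_par P y j *s (if y = 0 then 0 else ?b (y - 1) *s e (y - 1))
      + p_par P y j *s ?a y *s e y
      + p_par P y j *s (if y < d then ?c (Suc y) *s e (Suc y) else 0))"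
    using he by (intro sum.cong) (simp_all add: scale_right_distrib)
  also have "\<dots> = (\<Sum>y\<le>d. p_par P y j *s (if y = 0 then 0 else ?b (y - 1) *s e (y - 1)))
      + (\<Sum>y\<le>d. p_par P y j *s ?a y *s e y)
      + (\<Sum>y\<le>d. p_par P y j *s (if y < d then ?c (Suc y) *s e (Suc y) else 0))"
    by (simp add: sum.distrib)
  also have "\<dots> = (\<Sum>y\<le>d. (if y < d then (p_par P (Suc y) j * ?b y) *s e y else 0)
      + p_par P y j *s ?a y *s e y + (if y = 0 then 0 else (p_par P (y - 1) j * ?c y) *s e y))"
    using sum_shift_scale[where n = d and a = "\<lambda>y. p_par P y j" and b = ?b and u = e]
      sum_shift_scale'[where n = d and a = "\<lambda>y. p_par P y j" and c = ?c and u = e]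
    by (simp only: sum.distrib)
  also have "\<dots> = (\<Sum>y\<le>d. (st j * p_par P y j) *s e y)"
  proof (intro sum.cong refl)
    fix y
    assume "y \<in> {..d}"
    then have y: "y \<le> d" by simp
    have "(if y < d then (p_par P (Suc y) j * ?b y) *s e y else 0) = (?b y * p_par P (Suc y) j) *s e y"
      using y by (cases "y < d") (simp_all add: coeff_b_def mult.commute)
    moreover have "(if y = 0 then 0 else (p_par P (y - 1) j * ?c y) *s e y) = (?c y * p_par P (y - 1) j) *s e y"
      by (simp add: coeff_c_def mult.commute)
    ultimately show "(if y < d then (p_par P (Suc y) j * ?b y) *s e y else 0)
      + p_par P y j *s ?a y *s e y + (if y = 0 then 0 else (p_par P (y - 1) j * ?c y) *s e y)
      = (st j * p_par P y j) *s e y"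
      using p_par_difference[OF y j] by (simp add: scale_left_distrib add_ac mult.commute)
  qed
  also have "\<dots> = st j *s w j" by (simp add: w[OF j] scale_sum_right)
  finally show ?thesis .
qed

end

text \<open>The equations for the coefficients \<open>C\<close>; those for \<open>D\<close> have the same form after exchanging
  the two coordinates.\<close>

definition ladder ::
    "nat \<Rightarrow> (nat \<Rightarrow> nat \<Rightarrow> nat \<Rightarrow> complex) \<Rightarrow> (nat \<Rightarrow> nat \<Rightarrow> complex) \<Rightarrow> (nat \<Rightarrow> nat \<Rightarrow> complex) \<Rightarrow>
     (nat \<Rightarrow> nat \<Rightarrow> complex) \<Rightarrow> (int \<times> int \<Rightarrow> nat \<times> nat \<Rightarrow> complex) \<Rightarrow> bool" where
  "ladder N q a b c C \<longleftrightarrow>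
     (\<forall>e\<in>A2. \<forall>l\<in>dom2 N. \<not> shift_in N l e \<longrightarrow> C e l = 0) \<and>
     (\<forall>(i, j)\<in>dom2 N.
        (\<forall>x. x + j + 1 \<le> N \<longrightarrow>
           c x (j + 1) * q j x i = (\<Sum>e\<in>{-1, 0}. C (e, 1) (i, j) * q (j + 1) x (nat (int i + e)))) \<and>
        (\<forall>x. x + j \<le> N \<longrightarrow>
           a x j * q j x i = (\<Sum>e\<in>{-1, 0, 1}. C (e, 0) (i, j) * q j x (nat (int i + e)))) \<and>
        (\<forall>x. 1 \<le> j \<and> x + j \<le> N + 1 \<longrightarrow>
           b x (j - 1) * q j x i = (\<Sum>e\<in>{0, 1}. C (e, -1) (i, j) * q (j - 1) x (nat (int i + e)))))"

section \<open>Uniqueness of the coefficients and the action they describe\<close>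

lemma A2_split: "A2 = (\<lambda>e. (e, 1)) ` {-1, 0} \<union> (\<lambda>e. (e, 0)) ` {-1, 0, 1} \<union> (\<lambda>e. (e, -1)) ` {0, 1}"
  by (auto simp: A2_def)

lemma sum_A2:
  fixes f :: "int \<times> int \<Rightarrow> 'a::comm_monoid_add"
  shows "sum f A2 = (\<Sum>e\<in>{-1, 0}. f (e, 1)) + (\<Sum>e\<in>{-1, 0, 1}. f (e, 0)) + (\<Sum>e\<in>{0, 1}. f (e, -1))"
  by (simp add: A2_def add_ac)

text \<open>Coefficients at shifts outside 0..n are zero by convention. The others are the
  coefficients of a linear relation between distinct columns of \<open>q\<close>.\<close>

lemma independent_shifts:
  assumes S: "finite S"
    and supp: "\<And>e. e \<in> S \<Longrightarrow> \<not> (0 \<le> int i + e \<and> int i + e \<le> int n) \<Longrightarrow> c e = 0"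
    and eq: "\<And>x. x \<le> n \<Longrightarrow> (\<Sum>e\<in>S. c e * q x (nat (int i + e))) = 0"
    and indep: "\<And>w k. (\<And>x. x \<le> n \<Longrightarrow> (\<Sum>k\<le>n. w k * q x k) = 0) \<Longrightarrow> k \<le> n \<Longrightarrow> w k = 0"
    and e: "e \<in> S"
  shows "c e = (0 :: complex)"
proof (cases "0 \<le> int i + e \<and> int i + e \<le> int n")
  case True
  define w where "w k = (if int k - int i \<in> S then c (int k - int i) else 0)" for k
  have "w (nat (int i + e)) = 0"
  proof (rule indep)
    fix x
    assume x: "x \<le> n"
    have "(\<Sum>e\<in>S. c e * q x (nat (int i + e)))
        = (\<Sum>e\<in>{e\<in>S. 0 \<le> int i + e \<and> int i + e \<le> int n}. c e * q x (nat (int i + e)))"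
      using S supp by (intro sum.mono_neutral_right) auto
    also have "\<dots> = (\<Sum>k\<in>{k. k \<le> n \<and> int k - int i \<in> S}. c (int k - int i) * q x k)"
      by (rule sum.reindex_bij_witness[of _ "\<lambda>k. int k - int i" "\<lambda>e. nat (int i + e)"]) auto
    also have "\<dots> = (\<Sum>k\<in>{k. k \<le> n \<and> int k - int i \<in> S}. w k * q x k)"
      by (intro sum.cong) (auto simp: w_def)
    also have "\<dots> = (\<Sum>k\<le>n. w k * q x k)"
      by (intro sum.mono_neutral_left) (auto simp: w_def)
    finally show "(\<Sum>k\<le>n. w k * q x k) = 0" using eq[OF x] by simp
  qed (use True in auto)
  then show ?thesis using True e by (simp add: w_def)
qed (use supp e in blast)

lemma ladder_unique:
  assumes C: "ladder N q a b c C" and C': "ladder N q a b c C'"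
    and indep: "\<And>j w k. j \<le> N \<Longrightarrow> (\<And>x. x \<le> N - j \<Longrightarrow> (\<Sum>k\<le>N - j. w k * q j x k) = 0) \<Longrightarrow> k \<le> N - j \<Longrightarrow> w k = 0"
    and "e \<in> A2" "l \<in> dom2 N"
  shows "C' e l = C e l"
proof -
  obtain i j where l: "l = (i, j)" "(i, j) \<in> dom2 N" using assms(5) by (cases l) auto
  then have ij: "i + j \<le> N" by (simp add: dom2_def)
  note L = C[unfolded ladder_def] and L' = C'[unfolded ladder_def]
  define c' where "c' e = C' e l - C e l" for e
  have supp: "c' e = 0" if "e \<in> A2" "\<not> shift_in N l e" for e
    using L L' that assms(5) by (simp add: c'_def)
  consider (up) f where "e = (f, 1)" "f \<in> {-1, 0}" | (mid) f where "e = (f, 0)" "f \<in> {-1, 0, 1}"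
    | (down) f where "e = (f, -1)" "f \<in> {0, 1}"
    using \<open>e \<in> A2\<close> unfolding A2_split by auto
  then have "c' e = 0"
  proof cases
    case up
    show ?thesis
    proof (cases "j < N")
      case True
      show ?thesis unfolding up(1)
      proof (rule independent_shifts[where S = "{-1, 0}" and i = i and n = "N - (j + 1)" and c = "\<lambda>f. c' (f, 1)" and q = "q (j + 1)"])
        fix x
        assume x: "x \<le> N - (j + 1)"
        have "(\<Sum>e\<in>{-1, 0}. C' (e, 1) (i, j) * q (j + 1) x (nat (int i + e)))
          = (\<Sum>e\<in>{-1, 0}. C (e, 1) (i, j) * q (j + 1) x (nat (int i + e)))"
          using L L' l x True by fastforce
        then show "(\<Sum>e\<in>{-1, 0}. c' (e, 1) * q (j + 1) x (nat (int i + e))) = 0"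
          by (simp add: c'_def l left_diff_distrib sum_subtractf)
      next
        fix f :: int
        assume "f \<in> {-1, 0}" "\<not> (0 \<le> int i + f \<and> int i + f \<le> int (N - (j + 1)))"
        then show "c' (f, 1) = 0"
          using True by (intro supp) (auto simp: A2_def shift_in_def l)
      qed (use up True indep[of "j + 1"] in auto)
    next
      case False
      then show ?thesis using ij up by (intro supp) (auto simp: A2_def shift_in_def l)
    qed
  next
    case mid
    show ?thesis unfolding mid(1)
    proof (rule independent_shifts[where S = "{-1, 0, 1}" and i = i and n = "N - j" and c = "\<lambda>f. c' (f, 0)" and q = "q j"])
      fix x
      assume x: "x \<le> N - j"
      have "(\<Sum>e\<in>{-1, 0, 1}. C' (e, 0) (i, j) * q j x (nat (int i + e)))
        = (\<Sum>e\<in>{-1, 0, 1}. C (e, 0) (i, j) * q j x (nat (int i + e)))"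
        using L L' l x ij by fastforce
      then show "(\<Sum>e\<in>{-1, 0, 1}. c' (e, 0) * q j x (nat (int i + e))) = 0"
        by (simp add: c'_def l left_diff_distrib sum_subtractf)
    next
      fix f :: int
      assume "f \<in> {-1, 0, 1}" "\<not> (0 \<le> int i + f \<and> int i + f \<le> int (N - j))"
      then show "c' (f, 0) = 0"
        using ij by (intro supp) (auto simp: A2_def shift_in_def l)
    qed (use mid ij indep[of j] in auto)
  next
    case down
    show ?thesis
    proof (cases "1 \<le> j")
      case True
      show ?thesis unfolding down(1)
      proof (rule independent_shifts[where S = "{0, 1}" and i = i and n = "N - (j - 1)" and c = "\<lambda>f. c' (f, -1)" and q = "q (j - 1)"])
        fix x
        assume x: "x \<le> N - (j - 1)"
        have "(\<Sum>e\<in>{0, 1}. C' (e, -1) (i, j) * q (j - 1) x (nat (int i + e)))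
          = (\<Sum>e\<in>{0, 1}. C (e, -1) (i, j) * q (j - 1) x (nat (int i + e)))"
          using L L' l x True ij by fastforce
        then show "(\<Sum>e\<in>{0, 1}. c' (e, -1) * q (j - 1) x (nat (int i + e))) = 0"
          by (simp add: c'_def l left_diff_distrib sum_subtractf)
      next
        fix f :: int
        assume "f \<in> {0, 1}" "\<not> (0 \<le> int i + f \<and> int i + f \<le> int (N - (j - 1)))"
        then show "c' (f, -1) = 0"
          using True ij by (intro supp) (auto simp: A2_def shift_in_def l)
      qed (use down ij indep[of "j - 1"] in auto)
    next
      case False
      then show ?thesis using ij down by (intro supp) (auto simp: A2_def shift_in_def l)
    qed
  qed
  then show ?thesis by (simp add: c'_def)
qed

text \<open>\<open>h (B (i, j))\<close> has components in the rows j + 1, j and j - 1 of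
  \<open>W\<close>. The ladder equations express each of them through columns of \<open>q\<close>,
  which reassemble to shifted vectors of \<open>B\<close>.\<close>

lemma (in orthogonal_space) ladder_action:
  assumes L: "ladder N q a b c C" and h: "h \<in> endos"
    and W: "\<And>x j. x + j \<le> N \<Longrightarrow> W (x, j) \<in> V"
    and hW: "\<And>x j. x + j \<le> N \<Longrightarrow> h (W (x, j)) = (if j = 0 then 0 else b x (j - 1) *s W (x, j - 1))
      + a x j *s W (x, j) + (if x + j < N then c x (Suc j) *s W (x, Suc j) else 0)"
    and b0: "\<And>x. x \<le> N \<Longrightarrow> b x (N - x) = 0"
    and B: "\<And>i j. i + j \<le> N \<Longrightarrow> B (i, j) = (\<Sum>x\<le>N - j. q j x i *s W (x, j))"
    and ij: "(i, j) \<in> dom2 N"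
  shows "h (B (i, j)) = (\<Sum>e\<in>A2. C e (i, j) *s shifted N B (i, j) e)"
proof -
  have ij': "i + j \<le> N" using ij by (simp add: dom2_def)
  note L = L[unfolded ladder_def]
  \<comment> \<open>The shifted basis vector as a sum, without the test on the index; where the test
    fails, its coefficient is zero.\<close>
  define T where "T e = (\<Sum>x\<le>N - nat (int j + snd e). q (nat (int j + snd e)) x (nat (int i + fst e))
      *s W (x, nat (int j + snd e)))" for e
  have T: "C e (i, j) *s shifted N B (i, j) e = C e (i, j) *s T e" if "e \<in> A2" for e
  proof (cases "shift_in N (i, j) e")
    case True
    then have "nat (int i + fst e) + nat (int j + snd e) \<le> N"
      by (auto simp: shift_in_def)
    then show ?thesis using True B by (simp add: shifted_def T_def)
  next
    case False
    then show ?thesis using L that ij by simp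
  qed
  have 1: "(\<Sum>x\<le>N - j. q j x i *s (if x + j < N then c x (Suc j) *s W (x, Suc j) else 0))
      = (\<Sum>e\<in>{-1, 0}. C (e, 1) (i, j) *s T (e, 1))"
  proof (cases "j < N")
    case True
    have "(\<Sum>x\<le>N - j. q j x i *s (if x + j < N then c x (Suc j) *s W (x, Suc j) else 0))
        = (\<Sum>x\<le>N - (j + 1). (c x (j + 1) * q j x i) *s W (x, Suc j))"
      using True by (intro sum.mono_neutral_cong_right) (auto simp: mult.commute)
    also have "\<dots> = (\<Sum>x\<le>N - (j + 1). (\<Sum>e\<in>{-1, 0}. C (e, 1) (i, j) * q (j + 1) x (nat (int i + e))) *s W (x, Suc j))"
      using L ij True by (intro sum.cong arg_cong2[where f = scale] refl) fastforce
    also have "\<dots> = (\<Sum>e\<in>{-1, 0}. C (e, 1) (i, j) *s T (e, 1))"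
      by (simp add: T_def scale_left_distrib sum.distrib scale_sum_right nat_add_distrib)
    finally show ?thesis .
  next
    case False
    have "C (e, 1) (i, j) = 0" if "e \<in> {-1, 0}" for e
      using L that ij False by (auto simp: A2_def shift_in_def)
    then show ?thesis using False by simp
  qed
  have 2: "(\<Sum>x\<le>N - j. q j x i *s a x j *s W (x, j)) = (\<Sum>e\<in>{-1, 0, 1}. C (e, 0) (i, j) *s T (e, 0))"
  proof -
    have "(\<Sum>x\<le>N - j. q j x i *s a x j *s W (x, j)) = (\<Sum>x\<le>N - j. (a x j * q j x i) *s W (x, j))"
      by (simp add: mult.commute)
    also have "\<dots> = (\<Sum>x\<le>N - j. (\<Sum>e\<in>{-1, 0, 1}. C (e, 0) (i, j) * q j x (nat (int i + e))) *s W (x, j))"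
      using L ij ij' by (intro sum.cong arg_cong2[where f = scale] refl) fastforce
    also have "\<dots> = (\<Sum>e\<in>{-1, 0, 1}. C (e, 0) (i, j) *s T (e, 0))"
      by (simp add: T_def scale_left_distrib sum.distrib scale_sum_right)
    finally show ?thesis .
  qed
  have 3: "(\<Sum>x\<le>N - j. q j x i *s (if j = 0 then 0 else b x (j - 1) *s W (x, j - 1)))
      = (\<Sum>e\<in>{0, 1}. C (e, -1) (i, j) *s T (e, -1))"
  proof (cases "1 \<le> j")
    case True
    \<comment> \<open>Row j - 1 has one more entry than row j, namely x = N - j + 1. There
      \<open>b\<close> vanishes by \<open>b0\<close>, so the sum may be extended, and the ladder
      equation holds at this x as well.\<close>
    have Suc: "N - (j - 1) = Suc (N - j)" "N - Suc (N - j) = j - 1" using True ij' by auto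
    then have "b (Suc (N - j)) (j - 1) = 0" using b0[of "Suc (N - j)"] ij' True by auto
    then have "(\<Sum>x\<le>N - j. q j x i *s (if j = 0 then 0 else b x (j - 1) *s W (x, j - 1)))
        = (\<Sum>x\<le>N - (j - 1). (b x (j - 1) * q j x i) *s W (x, j - 1))"
      using True by (subst Suc(1)) (simp add: mult.commute)
    also have "\<dots> = (\<Sum>x\<le>N - (j - 1). (\<Sum>e\<in>{0, 1}. C (e, -1) (i, j) * q (j - 1) x (nat (int i + e))) *s W (x, j - 1))"
      using L ij True ij' by (intro sum.cong arg_cong2[where f = scale] refl) fastforce
    also have "\<dots> = (\<Sum>e\<in>{0, 1}. C (e, -1) (i, j) *s T (e, -1))"
    proof -
      have "nat (int j - 1) = j - 1" using True by simp
      then show ?thesis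
        by (simp add: T_def scale_left_distrib sum.distrib scale_sum_right)
    qed
    finally show ?thesis .
  next
    case False
    have "C (e, -1) (i, j) = 0" if "e \<in> {0, 1}" for e
      using L that ij False by (auto simp: A2_def shift_in_def)
    then show ?thesis using False by simp
  qed
  have WV: "W (x, j) \<in> V" if "x \<in> {..N - j}" for x using that ij' by (intro W) auto
  have "h (B (i, j)) = (\<Sum>x\<le>N - j. q j x i *s h (W (x, j)))"
    unfolding B[OF ij'] by (rule endos_lincomb[OF h WV])
  also have "\<dots> = (\<Sum>x\<le>N - j. q j x i *s (if j = 0 then 0 else b x (j - 1) *s W (x, j - 1))
      + q j x i *s a x j *s W (x, j) + q j x i *s (if x + j < N then c x (Suc j) *s W (x, Suc j) else 0))"
    using hW ij' by (intro sum.cong refl) (simp add: scale_right_distrib)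
  also have "\<dots> = (\<Sum>e\<in>A2. C e (i, j) *s T e)"
    unfolding sum.distrib 1 2 3 sum_A2 by (simp add: add_ac)
  finally show ?thesis by (simp add: T)
qed

section \<open>The endomorphisms of a compatible pair\<close>

lemma (in orthogonal_space) form_lincomb:
  "(\<And>i. i \<in> A \<Longrightarrow> f i \<in> V) \<Longrightarrow> w \<in> V \<Longrightarrow> form (\<Sum>i\<in>A. c i *s f i) w = (\<Sum>i\<in>A. c i * form (f i) w)"
  by (simp add: form_sum form_scale)

locale compatible_pair =
  fixes N :: nat
    and t ths :: "nat \<Rightarrow> complex" and ts th :: "nat \<Rightarrow> nat \<Rightarrow> complex"
    and \<Phi> \<Psi> :: "nat \<Rightarrow> param_array"
    and C D :: "int \<times> int \<Rightarrow> nat \<times> nat \<Rightarrow> complex"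
    and F G :: "nat \<times> nat \<Rightarrow> complex"
  assumes N: "N \<ge> 1"
    and \<Phi>_diam: "\<And>j. diam (\<Phi> j) = N - j" and \<Phi>_theta: "\<And>j. theta (\<Phi> j) = t"
    and \<Phi>_theta_star: "\<And>i j. theta_star (\<Phi> j) i = ts i j"
    and \<Psi>_diam: "\<And>x. diam (\<Psi> x) = N - x" and \<Psi>_theta: "\<And>x y. theta (\<Psi> x) y = th y x"
    and \<Psi>_theta_star: "\<And>x. theta_star (\<Psi> x) = ths"
    and \<Phi>_array: "\<And>j. j \<le> N \<Longrightarrow> leonard_array (\<Phi> j)"
    and \<Psi>_array: "\<And>x. x \<le> N \<Longrightarrow> leonard_array (\<Psi> x)"
    and coeffs: "compat_coeffs N \<Phi> \<Psi> C D"
    and F_nz: "\<And>l. l \<in> dom2 N \<Longrightarrow> F l \<noteq> 0"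
    and FG: "\<And>x y i j. (x, y) \<in> dom2 N \<Longrightarrow> (i, j) \<in> dom2 N \<Longrightarrow> x + j \<le> N \<Longrightarrow>
           k_par (\<Phi> j) i / k_par (dual (\<Phi> j)) x * (k_par (\<Psi> x) j / k_par (dual (\<Psi> x)) y) * F (x, y)
           = G (i, j) / (nu_par (\<Psi> x) * nu_par (\<Phi> j))"
begin

lemma dom2_iff [simp]: "(x, y) \<in> dom2 N \<longleftrightarrow> x + y \<le> N"
  by (simp add: dom2_def)

lemma finite_dom2 [simp]: "finite (dom2 N)"
  by (rule finite_subset[of _ "{..N} \<times> {..N}"]) (auto simp: dom2_def)

lemma sum_dom2: "sum f (dom2 N) = (\<Sum>x\<le>N. \<Sum>y\<le>N - x. f (x, y))"
proof -
  have "dom2 N = Sigma {..N} (\<lambda>x. {..N - x})" by (auto simp: dom2_def)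
  then show ?thesis by (simp add: sum.Sigma)
qed

lemma card_dom2: "card (dom2 N) = (N + 2) choose 2"
proof -
  have "dom2 n = Sigma {..n} (\<lambda>x. {..n - x})" for n by (auto simp: dom2_def)
  then have "card (dom2 N) = (\<Sum>x\<le>N. Suc (N - x))" by simp
  also have "\<dots> = (\<Sum>x<Suc N. Suc x)"
    using sum.nat_diff_reindex[of Suc "Suc N"] by (simp add: lessThan_Suc_atMost)
  also have "\<dots> = (N + 2) choose 2"
    by (induction N) (simp_all add: choose_two numeral_2_eq_2)
  finally show ?thesis .
qed

lemma k_par_\<Phi>_nz: "i + j \<le> N \<Longrightarrow> k_par (\<Phi> j) i \<noteq> 0"
  and k_par_\<Psi>_nz: "x + j \<le> N \<Longrightarrow> k_par (\<Psi> x) j \<noteq> 0"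
  and k_par_\<Psi>_dual_nz: "x + j \<le> N \<Longrightarrow> k_par (dual (\<Psi> x)) j \<noteq> 0"
  and nu_\<Phi>_nz: "j \<le> N \<Longrightarrow> nu_par (\<Phi> j) \<noteq> 0"
  and nu_\<Psi>_nz: "x \<le> N \<Longrightarrow> nu_par (\<Psi> x) \<noteq> 0"
  using leonard_array.k_par_nz[OF \<Phi>_array, of j i] leonard_array.k_par_nz[OF \<Psi>_array, of x j]
    leonard_array.k_par_nz[OF leonard_array.leonard_array_dual[OF \<Psi>_array], of x j]
    leonard_array.nu_par_nz[OF \<Phi>_array, of j] leonard_array.nu_par_nz[OF \<Psi>_array, of x]
  by (auto simp: \<Phi>_diam \<Psi>_diam)

text \<open>\<open>UU\<close> and \<open>UUs\<close> are the bases $V_{x,y}$ and $V^\star_{i,j}$. The intermediate basis \<open>WW\<close> consists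
  of the common eigenvectors of $X$ and $Y^\star$. The weights \<open>nn\<close> of the form are chosen such that \<open>WW\<close>
  is orthogonal by the orthogonality relation of $\Psi_x$; the compatibility condition on $F$ and $G$
  then makes \<open>UUs\<close> orthogonal.\<close>

definition "VV = {v :: ambient. \<forall>l. l \<notin> dom2 N \<longrightarrow> v l = 0}"

definition nn :: "nat \<times> nat \<Rightarrow> complex" where
  "nn = (\<lambda>(x, y). F (x, 0) * k_par (dual (\<Psi> x)) y)"

definition fm :: "ambient \<Rightarrow> ambient \<Rightarrow> complex" where
  "fm v w = (\<Sum>l\<in>dom2 N. nn l * v l * w l)"

definition UU :: "nat \<times> nat \<Rightarrow> ambient" where
  "UU l = (\<lambda>m. if m = l then 1 else 0)"

lemma UU_apply: "UU l m = (if m = l then 1 else 0)"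
  by (simp add: UU_def)

lemma nn_nz: "l \<in> dom2 N \<Longrightarrow> nn l \<noteq> 0"
  using F_nz[of "(fst l, 0)"] k_par_\<Psi>_dual_nz[of "fst l" "snd l"] by (auto simp: nn_def dom2_def split: prod.splits)

lemma UU_in: "l \<in> dom2 N \<Longrightarrow> UU l \<in> VV"
  by (auto simp: UU_def VV_def)

lemma fm_UU: "l \<in> dom2 N \<Longrightarrow> fm v (UU l) = nn l * v l"
  by (simp add: fm_def UU_def if_distrib cong: if_cong)

lemma complex_space_VV: "complex_space ascale VV"
proof -
  interpret vector_space ascale by (rule vector_space_ascale)
  show ?thesis
    by unfold_locales (rule subspaceI; simp add: VV_def ascale_def zero_fun_def)
qed

sublocale orthogonal_space ascale VV fm
proof -
  interpret complex_space ascale VV by (rule complex_space_VV)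
  show "orthogonal_space ascale VV fm"
  proof
    have "u = 0" if "u \<in> VV" "\<forall>w\<in>VV. fm u w = 0" for u
    proof
      fix l
      show "u l = 0 l"
      proof (cases "l \<in> dom2 N")
        case True
        then show ?thesis using that UU_in fm_UU nn_nz by (metis mult_eq_0_iff zero_fun_def)
      next
        case False
        then have "u l = 0" using that(1) unfolding VV_def by blast
        then show ?thesis by simp
      qed
    qed
    then show "nondeg_sym_bilinear_form fm"
      unfolding nondeg_sym_bilinear_form_def
      by (auto simp: fm_def ascale_def sum.distrib sum_distrib_left algebra_simps)
  qed
qed

lemma sum_fun_apply: "(sum f A) l = (\<Sum>i\<in>A. f i l)" for f :: "'b \<Rightarrow> ambient"
  by (induction A rule: infinite_finite_induct) auto

lemma ascale_apply: "(c *a v) l = c * v l"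
  by (simp add: ascale_def)

lemma UU_basis: "orth_basis UU (dom2 N)"
  unfolding orth_basis_def
proof (intro conjI ballI impI subsetI)
  fix v
  assume v: "v \<in> VV"
  have "v = (\<Sum>l\<in>dom2 N. v l *a UU l)"
    using v by (auto simp: fun_eq_iff sum_fun_apply ascale_apply UU_def VV_def if_distrib cong: if_cong)
  also have "\<dots> \<in> span (UU ` dom2 N)"
    by (intro span_sum span_scale span_base) auto
  finally show "v \<in> span (UU ` dom2 N)" .
qed (simp_all add: UU_in fm_UU nn_nz UU_apply)

section \<open>The intermediate basis and orthogonality of the three bases\<close>

definition WW :: "nat \<times> nat \<Rightarrow> ambient" where
  "WW = (\<lambda>(x, j). \<Sum>y\<le>N - x. p_par (\<Psi> x) y j *a UU (x, y))"

definition UUs :: "nat \<times> nat \<Rightarrow> ambient" where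
  "UUs = (\<lambda>(i, j). \<Sum>x\<le>N - j. p_par (\<Phi> j) x i *a WW (x, j))"

lemma WW_eq: "WW (x, j) = (\<Sum>y\<le>diam (\<Psi> x). p_par (\<Psi> x) y j *a UU (x, y))"
  by (simp add: WW_def \<Psi>_diam)

lemma UUs_eq: "UUs (i, j) = (\<Sum>x\<le>diam (\<Phi> j). p_par (\<Phi> j) x i *a WW (x, j))"
  by (simp add: UUs_def \<Phi>_diam)

lemma WW_in: "x \<le> N \<Longrightarrow> WW (x, j) \<in> VV"
  unfolding WW_def prod.case by (intro V_closed(5) V_closed(3) UU_in) auto

lemma UUs_in: "j \<le> N \<Longrightarrow> UUs (i, j) \<in> VV"
  unfolding UUs_def prod.case by (intro V_closed(5) V_closed(3) WW_in) auto

lemma UU_from_WW: "x + y \<le> N \<Longrightarrow>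
    (\<Sum>j\<le>N - x. (p_par (dual (\<Psi> x)) j y / nu_par (\<Psi> x)) *a WW (x, j)) = UU (x, y)"
  using transform_inverse[OF \<Psi>_array, of x "\<lambda>j. WW (x, j)" "\<lambda>y. UU (x, y)" y]
  by (simp add: WW_eq \<Psi>_diam)

lemma WW_from_UUs: "x + j \<le> N \<Longrightarrow>
    (\<Sum>i\<le>N - j. (p_par (dual (\<Phi> j)) i x / nu_par (\<Phi> j)) *a UUs (i, j)) = WW (x, j)"
  using transform_inverse[OF \<Phi>_array, of j "\<lambda>i. UUs (i, j)" "\<lambda>x. WW (x, j)" x]
  by (simp add: UUs_eq \<Phi>_diam)

lemma WW_apply: "x + y \<le> N \<Longrightarrow> WW (x', j) (x, y) = (if x = x' then p_par (\<Psi> x) y j else 0)"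
  by (auto simp: WW_def sum_fun_apply ascale_apply UU_def if_distrib cong: if_cong)

definition rr :: "nat \<Rightarrow> nat \<Rightarrow> complex" where
  "rr x j = F (x, 0) * k_par (\<Psi> x) j * nu_par (\<Psi> x)"

lemma rr_nz: "x + j \<le> N \<Longrightarrow> rr x j \<noteq> 0"
  using F_nz[of "(x, 0)"] k_par_\<Psi>_nz nu_\<Psi>_nz by (simp add: rr_def)

text \<open>The condition on F and G at y = 0 and i = 0, where two of the weights are 1. It rewrites
  the norm of \<open>WW (x, j)\<close> so that x enters only through the dual weight of \<Phi>_j,
  for which the columns of p(\<Phi>_j) are orthogonal.\<close>

lemma rr_eq: "x + j \<le> N \<Longrightarrow> rr x j = G (0, j) / nu_par (\<Phi> j) * k_par (dual (\<Phi> j)) x"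
proof -
  assume xj: "x + j \<le> N"
  have "k_par (\<Phi> j) 0 = 1" "k_par (dual (\<Psi> x)) 0 = 1" "k_par (dual (\<Phi> j)) x \<noteq> 0"
    using leonard_array.k_par_0[OF \<Phi>_array] xj
      leonard_array.k_par_0[OF leonard_array.leonard_array_dual[OF \<Psi>_array]]
      leonard_array.k_par_nz[OF leonard_array.leonard_array_dual[OF \<Phi>_array], of j x]
    by (auto simp: \<Phi>_diam)
  then show ?thesis
    using FG[of x 0 0 j] xj nu_\<Phi>_nz[of j] nu_\<Psi>_nz[of x] by (simp add: rr_def field_simps)
qed

lemma G_nz: "j \<le> N \<Longrightarrow> G (0, j) \<noteq> 0"
  using rr_nz[of 0 j] rr_eq[of 0 j] by auto

lemma fm_WW:
  assumes "x + j \<le> N" "x' + j' \<le> N"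
  shows "fm (WW (x, j)) (WW (x', j')) = (if (x, j) = (x', j') then rr x j else 0)"
proof -
  have "fm (WW (x, j)) (WW (x', j')) = (\<Sum>a\<le>N. \<Sum>b\<le>N - a. if a = x \<and> a = x' then
      F (x, 0) * (p_par (\<Psi> x) b j * p_par (\<Psi> x) b j' * k_par (dual (\<Psi> x)) b) else 0)"
    unfolding fm_def sum_dom2 by (intro sum.cong refl) (auto simp: WW_apply nn_def)
  also have "\<dots> = (\<Sum>a\<le>N. if a = x then (if x = x' then
      F (x, 0) * (\<Sum>b\<le>diam (\<Psi> x). p_par (\<Psi> x) b j * p_par (\<Psi> x) b j' * k_par (dual (\<Psi> x)) b) else 0) else 0)"
    by (intro sum.cong refl) (auto simp: sum_distrib_left \<Psi>_diam)
  also have "\<dots> = (if x = x' then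
      F (x, 0) * (\<Sum>b\<le>diam (\<Psi> x). p_par (\<Psi> x) b j * p_par (\<Psi> x) b j' * k_par (dual (\<Psi> x)) b) else 0)"
    using assms by simp
  also have "\<dots> = (if (x, j) = (x', j') then rr x j else 0)"
  proof (cases "x = x'")
    case True
    then have "x \<le> N" "j \<le> diam (\<Psi> x)" "j' \<le> diam (\<Psi> x)" using assms by (auto simp: \<Psi>_diam)
    then show ?thesis using leonard_array.p_par_column_orthogonal[OF \<Psi>_array, of x j j'] True
      by (simp add: rr_def)
  qed simp
  finally show ?thesis .
qed

lemma fm_WW_UUs:
  assumes "x + j \<le> N" "i' + j' \<le> N"
  shows "fm (WW (x, j)) (UUs (i', j')) = (if j = j' then p_par (\<Phi> j) x i' * rr x j else 0)"
proof -
  have "fm (WW (x, j)) (UUs (i', j')) = fm (UUs (i', j')) (WW (x, j))"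
    using assms by (intro form_sym) (auto intro: WW_in UUs_in)
  also have "\<dots> = (\<Sum>x'\<le>N - j'. p_par (\<Phi> j') x' i' * fm (WW (x', j')) (WW (x, j)))"
    unfolding UUs_def prod.case using assms by (intro form_lincomb WW_in) auto
  also have "\<dots> = (\<Sum>x'\<le>N - j'. if x' = x then (if j = j' then p_par (\<Phi> j) x i' * rr x j else 0) else 0)"
    using assms by (intro sum.cong refl) (auto simp: fm_WW)
  finally show ?thesis using assms by auto
qed

lemma fm_UUs:
  assumes "i + j \<le> N" "i' + j' \<le> N"
  shows "fm (UUs (i, j)) (UUs (i', j')) = (if (i, j) = (i', j') then G (0, j) * k_par (\<Phi> j) i else 0)"
proof -
  have "fm (UUs (i, j)) (UUs (i', j')) = (\<Sum>x\<le>N - j. p_par (\<Phi> j) x i * fm (WW (x, j)) (UUs (i', j')))"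
  proof -
    have "fm (UUs (i, j)) w = (\<Sum>x\<le>N - j. p_par (\<Phi> j) x i * fm (WW (x, j)) w)" if "w \<in> VV" for w
      unfolding UUs_def prod.case using that by (intro form_lincomb WW_in) auto
    then show ?thesis using assms UUs_in by simp
  qed
  also have "\<dots> = (\<Sum>x\<le>N - j. if j = j' then G (0, j) / nu_par (\<Phi> j) *
      (p_par (\<Phi> j) x i * p_par (\<Phi> j) x i' * k_par (dual (\<Phi> j)) x) else 0)"
    using assms by (intro sum.cong refl) (auto simp: fm_WW_UUs rr_eq)
  also have "\<dots> = (if j = j' then G (0, j) / nu_par (\<Phi> j) *
      (\<Sum>x\<le>diam (\<Phi> j). p_par (\<Phi> j) x i * p_par (\<Phi> j) x i' * k_par (dual (\<Phi> j)) x) else 0)"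
    by (simp add: sum_distrib_left \<Phi>_diam)
  also have "\<dots> = (if (i, j) = (i', j') then G (0, j) * k_par (\<Phi> j) i else 0)"
  proof (cases "j = j'")
    case True
    then have "j \<le> N" "i \<le> diam (\<Phi> j)" "i' \<le> diam (\<Phi> j)" using assms by (auto simp: \<Phi>_diam)
    then show ?thesis using leonard_array.p_par_column_orthogonal[OF \<Phi>_array, of j i i'] nu_\<Phi>_nz[of j] True
      by simp
  qed simp
  finally show ?thesis .
qed

lemma WW_basis: "orth_basis WW (dom2 N)"
proof -
  have "UU l \<in> span (WW ` dom2 N)" if "l \<in> dom2 N" for l
  proof -
    from that obtain x y where l: "l = (x, y)" "x + y \<le> N" by (cases l) simp
    show ?thesis
      unfolding l(1) UU_from_WW[OF l(2), symmetric] using l(2)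
      by (intro span_sum span_scale span_base) auto
  qed
  then have "span (UU ` dom2 N) \<subseteq> span (WW ` dom2 N)" by (intro span_minimal) auto
  then show ?thesis
    using basis_span[OF UU_basis] rr_nz unfolding orth_basis_def by (auto simp: fm_WW WW_in split: if_splits)
qed

lemma UUs_basis: "orth_basis UUs (dom2 N)"
proof -
  have "WW l \<in> span (UUs ` dom2 N)" if "l \<in> dom2 N" for l
  proof -
    from that obtain x j where l: "l = (x, j)" "x + j \<le> N" by (cases l) simp
    show ?thesis
      unfolding l(1) WW_from_UUs[OF l(2), symmetric] using l(2)
      by (intro span_sum span_scale span_base) auto
  qed
  then have "span (WW ` dom2 N) \<subseteq> span (UUs ` dom2 N)" by (intro span_minimal) auto
  then show ?thesis
    using basis_span[OF WW_basis] k_par_\<Phi>_nz G_nz unfolding orth_basis_def by (auto simp: fm_UUs UUs_in split: if_splits)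
qed

lemma shifted_down: "x + y \<le> N \<Longrightarrow> shifted N B (x, y) (0, -1) = (if y = 0 then 0 else B (x, y - 1))"
  and shifted_up: "x + y \<le> N \<Longrightarrow> shifted N B (x, y) (0, 1) = (if x + y < N then B (x, Suc y) else 0)"
  and shifted_left: "x + y \<le> N \<Longrightarrow> shifted N B (x, y) (-1, 0) = (if x = 0 then 0 else B (x - 1, y))"
  and shifted_right: "x + y \<le> N \<Longrightarrow> shifted N B (x, y) (1, 0) = (if x + y < N then B (Suc x, y) else 0)"
  for B :: "nat \<times> nat \<Rightarrow> ambient"
  by (auto simp: shifted_def shift_in_def nat_diff_distrib nat_add_distrib)

lemma shifted_in:
  assumes "\<And>l. l \<in> dom2 N \<Longrightarrow> B l \<in> VV"
  shows "shifted N B l e \<in> VV"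
  unfolding shifted_def using assms V_closed(1) by (auto simp: shift_in_def dom2_def)

section \<open>The four endomorphisms and their action on the bases\<close>

definition XX :: "ambient \<Rightarrow> ambient" where
  "XX = ext UU (dom2 N) (\<lambda>(x, y). t x *a UU (x, y))"

definition YY :: "ambient \<Rightarrow> ambient" where
  "YY = ext UU (dom2 N) (\<lambda>(x, y). th y x *a UU (x, y))"

definition YYs :: "ambient \<Rightarrow> ambient" where
  "YYs = ext UU (dom2 N) (\<lambda>(x, y). coeff_b (dual (\<Psi> x)) (y - 1) *a shifted N UU (x, y) (0, -1)
            + coeff_a (dual (\<Psi> x)) y *a UU (x, y)
            + coeff_c (dual (\<Psi> x)) (y + 1) *a shifted N UU (x, y) (0, 1))"

text \<open>\<open>XXs\<close> preserves each row j of \<open>WW\<close>, where it is given by the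
  dual of \<Phi>_j. From there the diagonal action on \<open>UUs\<close> and the action on
  \<open>UU\<close> with coefficients D can both be reached.\<close>

definition XXs :: "ambient \<Rightarrow> ambient" where
  "XXs = ext WW (dom2 N) (\<lambda>(x, j). coeff_b (dual (\<Phi> j)) (x - 1) *a shifted N WW (x, j) (-1, 0)
            + coeff_a (dual (\<Phi> j)) x *a WW (x, j)
            + coeff_c (dual (\<Phi> j)) (x + 1) *a shifted N WW (x, j) (1, 0))"

lemma WW_in': "l \<in> dom2 N \<Longrightarrow> WW l \<in> VV" and UUs_in': "l \<in> dom2 N \<Longrightarrow> UUs l \<in> VV"
  by (cases l; simp add: WW_in UUs_in)+

lemma endos_all: "XX \<in> endos" "YY \<in> endos" "XXs \<in> endos" "YYs \<in> endos"
  unfolding XX_def YY_def XXs_def YYs_def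
  by (intro ext_endos[OF UU_basis] ext_endos[OF WW_basis]; clarsimp;
      intro V_closed shifted_in UU_in WW_in' ; simp)+

lemma XX_UU: "x + y \<le> N \<Longrightarrow> XX (UU (x, y)) = t x *a UU (x, y)"
  unfolding XX_def by (subst ext_basis[OF UU_basis]) (simp_all only: dom2_iff prod.case)

lemma YY_UU: "x + y \<le> N \<Longrightarrow> YY (UU (x, y)) = th y x *a UU (x, y)"
  unfolding YY_def by (subst ext_basis[OF UU_basis]) (simp_all only: dom2_iff prod.case)

lemma YYs_UU: "x + y \<le> N \<Longrightarrow> YYs (UU (x, y)) =
    coeff_b (dual (\<Psi> x)) (y - 1) *a shifted N UU (x, y) (0, -1)
    + coeff_a (dual (\<Psi> x)) y *a UU (x, y)
    + coeff_c (dual (\<Psi> x)) (y + 1) *a shifted N UU (x, y) (0, 1)"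
  unfolding YYs_def by (subst ext_basis[OF UU_basis]) (simp_all only: dom2_iff prod.case)

lemma XXs_WW: "x + j \<le> N \<Longrightarrow> XXs (WW (x, j)) =
    coeff_b (dual (\<Phi> j)) (x - 1) *a shifted N WW (x, j) (-1, 0)
    + coeff_a (dual (\<Phi> j)) x *a WW (x, j)
    + coeff_c (dual (\<Phi> j)) (x + 1) *a shifted N WW (x, j) (1, 0)"
  unfolding XXs_def by (subst ext_basis[OF WW_basis]) (simp_all only: dom2_iff prod.case)

lemma XX_WW: "x + j \<le> N \<Longrightarrow> XX (WW (x, j)) = t x *a WW (x, j)"
proof -
  assume "x + j \<le> N"
  then have "XX (WW (x, j)) = (\<Sum>y\<le>N - x. p_par (\<Psi> x) y j *a XX (UU (x, y)))"
    unfolding WW_def prod.case by (intro endos_lincomb endos_all UU_in) auto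
  also have "\<dots> = (\<Sum>y\<le>N - x. t x *a p_par (\<Psi> x) y j *a UU (x, y))"
    using \<open>x + j \<le> N\<close> by (intro sum.cong refl) (simp add: XX_UU mult.commute)
  finally show ?thesis by (simp add: WW_def scale_sum_right)
qed

lemma YY_WW: "x + j \<le> N \<Longrightarrow> YY (WW (x, j)) = (if j = 0 then 0 else coeff_b (\<Psi> x) (j - 1) *a WW (x, j - 1))
    + coeff_a (\<Psi> x) j *a WW (x, j) + (if x + j < N then coeff_c (\<Psi> x) (Suc j) *a WW (x, Suc j) else 0)"
  using transform_diagonal[OF \<Psi>_array endos_all(2), of x "\<lambda>y. UU (x, y)" "\<lambda>j. WW (x, j)" j]
  by (auto simp: \<Psi>_diam WW_eq[of x] YY_UU \<Psi>_theta UU_in less_diff_conv add.commute)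

lemma YYs_WW: "x + j \<le> N \<Longrightarrow> YYs (WW (x, j)) = ths j *a WW (x, j)"
proof -
  assume xj: "x + j \<le> N"
  have "YYs (WW (x, j)) = theta_star (\<Psi> x) j *a WW (x, j)"
  proof (rule transform_tridiagonal[OF \<Psi>_array endos_all(4), where e = "\<lambda>y. UU (x, y)" and w = "\<lambda>j. WW (x, j)"])
    fix y
    assume "y \<le> diam (\<Psi> x)"
    then have "x + y \<le> N" "y < diam (\<Psi> x) \<longleftrightarrow> x + y < N" using xj by (auto simp: \<Psi>_diam)
    then show "YYs (UU (x, y)) = (if y = 0 then 0 else coeff_b (dual (\<Psi> x)) (y - 1) *a UU (x, y - 1))
      + coeff_a (dual (\<Psi> x)) y *a UU (x, y)
      + (if y < diam (\<Psi> x) then coeff_c (dual (\<Psi> x)) (Suc y) *a UU (x, Suc y) else 0)"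
      by (simp add: YYs_UU shifted_down shifted_up)
  qed (use xj in \<open>auto simp: \<Psi>_diam WW_eq[of x] UU_in\<close>)
  then show ?thesis by (simp add: \<Psi>_theta_star)
qed

lemma XX_UUs: "i + j \<le> N \<Longrightarrow> XX (UUs (i, j)) = coeff_b (\<Phi> j) (i - 1) *a shifted N UUs (i, j) (-1, 0)
            + coeff_a (\<Phi> j) i *a UUs (i, j)
            + coeff_c (\<Phi> j) (i + 1) *a shifted N UUs (i, j) (1, 0)"
  using transform_diagonal[OF \<Phi>_array endos_all(1), of j "\<lambda>x. WW (x, j)" "\<lambda>i. UUs (i, j)" i]
  by (auto simp: \<Phi>_diam UUs_eq[of _ j] XX_WW \<Phi>_theta WW_in less_diff_conv shifted_left shifted_right)

lemma XXs_UUs: "i + j \<le> N \<Longrightarrow> XXs (UUs (i, j)) = ts i j *a UUs (i, j)"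
proof -
  assume ij: "i + j \<le> N"
  have "XXs (UUs (i, j)) = theta_star (\<Phi> j) i *a UUs (i, j)"
  proof (rule transform_tridiagonal[OF \<Phi>_array endos_all(3), where e = "\<lambda>x. WW (x, j)" and w = "\<lambda>i. UUs (i, j)"])
    fix x
    assume "x \<le> diam (\<Phi> j)"
    then have "x + j \<le> N" "x < diam (\<Phi> j) \<longleftrightarrow> x + j < N" using ij by (auto simp: \<Phi>_diam)
    then show "XXs (WW (x, j)) = (if x = 0 then 0 else coeff_b (dual (\<Phi> j)) (x - 1) *a WW (x - 1, j))
      + coeff_a (dual (\<Phi> j)) x *a WW (x, j)
      + (if x < diam (\<Phi> j) then coeff_c (dual (\<Phi> j)) (Suc x) *a WW (Suc x, j) else 0)"
      by (simp add: XXs_WW shifted_left shifted_right)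
  qed (use ij in \<open>auto simp: \<Phi>_diam UUs_eq[of _ j] WW_in\<close>)
  then show ?thesis by (simp add: \<Phi>_theta_star)
qed

lemma YYs_UUs: "i + j \<le> N \<Longrightarrow> YYs (UUs (i, j)) = ths j *a UUs (i, j)"
proof -
  assume ij: "i + j \<le> N"
  then have "YYs (UUs (i, j)) = (\<Sum>x\<le>N - j. p_par (\<Phi> j) x i *a YYs (WW (x, j)))"
    unfolding UUs_def prod.case by (intro endos_lincomb endos_all WW_in) auto
  also have "\<dots> = (\<Sum>x\<le>N - j. ths j *a p_par (\<Phi> j) x i *a WW (x, j))"
    using ij by (intro sum.cong refl) (simp add: YYs_WW mult.commute)
  finally show ?thesis by (simp add: UUs_def scale_sum_right)
qed

lemma ladder_C:
  assumes "compat_coeffs N \<Phi> \<Psi> C' D'"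
  shows "ladder N (\<lambda>j. p_par (\<Phi> j)) (\<lambda>x. coeff_a (\<Psi> x)) (\<lambda>x. coeff_b (\<Psi> x)) (\<lambda>x. coeff_c (\<Psi> x)) C'"
  using assms unfolding compat_coeffs_def ladder_def by blast

lemma YY_UUs: "i + j \<le> N \<Longrightarrow> YY (UUs (i, j)) = (\<Sum>e\<in>A2. C e (i, j) *a shifted N UUs (i, j) e)"
  by (rule ladder_action[OF ladder_C[OF coeffs] endos_all(2), where W = WW])
    (auto simp: WW_in YY_WW UUs_def coeff_b_def \<Psi>_diam)

definition DD :: "(int \<times> int \<Rightarrow> nat \<times> nat \<Rightarrow> complex) \<Rightarrow> int \<times> int \<Rightarrow> nat \<times> nat \<Rightarrow> complex" where
  "DD D' e l = D' (prod.swap e) (prod.swap l)"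

lemma A2_swap: "prod.swap e \<in> A2 \<longleftrightarrow> e \<in> A2"
  by (cases e) (auto simp: A2_def)

lemma shift_in_swap: "shift_in N (prod.swap l) (prod.swap e) \<longleftrightarrow> shift_in N l e"
  by (auto simp: shift_in_def add.commute)

lemma dom2_swap: "prod.swap l \<in> dom2 N \<longleftrightarrow> l \<in> dom2 N"
  by (cases l) auto

text \<open>Division by \<nu>(\<Psi>_x) absorbs the quotients of \<nu> in the equations for D. The
  resulting \<open>q\<close> consists of the coefficients of \<open>UU\<close> in \<open>WW\<close>,
  so \<open>ladder_action\<close> applies with the coordinates exchanged.\<close>

lemma ladder_D:
  assumes "compat_coeffs N \<Phi> \<Psi> C' D'"
  shows "ladder N (\<lambda>x j y. p_par (dual (\<Psi> x)) j y / nu_par (\<Psi> x)) (\<lambda>j. coeff_a (dual (\<Phi> j)))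
    (\<lambda>j. coeff_b (dual (\<Phi> j))) (\<lambda>j. coeff_c (dual (\<Phi> j))) (DD D')"
  unfolding ladder_def
proof (intro conjI ballI impI)
  fix e l
  assume "e \<in> A2" "l \<in> dom2 N" "\<not> shift_in N l e"
  then show "DD D' e l = 0"
    using assms A2_swap dom2_swap shift_in_swap unfolding compat_coeffs_def DD_def by blast
next
  fix l
  assume "l \<in> dom2 N"
  then obtain x y where l: "l = (y, x)" and xy: "(x, y) \<in> dom2 N" by (cases l) auto
  have x: "x \<le> N" using xy by simp
  have E: "\<forall>j. j + x + 1 \<le> N \<longrightarrow>
           coeff_c (dual (\<Phi> j)) (x + 1) * p_par (dual (\<Psi> x)) j y =
           nu_par (\<Psi> x) / nu_par (\<Psi> (x + 1)) *
           (\<Sum>e\<in>{-1, 0}. D' (1, e) (x, y) * p_par (dual (\<Psi> (x + 1))) j (nat (int y + e)))"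
    "\<forall>j. j + x \<le> N \<longrightarrow>
           coeff_a (dual (\<Phi> j)) x * p_par (dual (\<Psi> x)) j y =
           (\<Sum>e\<in>{-1, 0, 1}. D' (0, e) (x, y) * p_par (dual (\<Psi> x)) j (nat (int y + e)))"
    "\<forall>j. 1 \<le> x \<and> j + x \<le> N + 1 \<longrightarrow>
           coeff_b (dual (\<Phi> j)) (x - 1) * p_par (dual (\<Psi> x)) j y =
           nu_par (\<Psi> x) / nu_par (\<Psi> (x - 1)) *
           (\<Sum>e\<in>{0, 1}. D' (-1, e) (x, y) * p_par (dual (\<Psi> (x - 1))) j (nat (int y + e)))"
    using assms xy unfolding compat_coeffs_def by blast+
  have s: "DD D' (e, f) (y, x) = D' (f, e) (x, y)" for e f by (simp add: DD_def)
  have nz: "nu_par (\<Psi> x) \<noteq> 0" by (rule nu_\<Psi>_nz[OF x])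
  show "case l of (i, j) \<Rightarrow>
        (\<forall>xa. xa + j + 1 \<le> N \<longrightarrow>
           coeff_c (dual (\<Phi> xa)) (j + 1) * (p_par (dual (\<Psi> j)) xa i / nu_par (\<Psi> j)) =
           (\<Sum>e\<in>{-1, 0}. DD D' (e, 1) (i, j) * (p_par (dual (\<Psi> (j + 1))) xa (nat (int i + e)) / nu_par (\<Psi> (j + 1))))) \<and>
        (\<forall>xa. xa + j \<le> N \<longrightarrow>
           coeff_a (dual (\<Phi> xa)) j * (p_par (dual (\<Psi> j)) xa i / nu_par (\<Psi> j)) =
           (\<Sum>e\<in>{-1, 0, 1}. DD D' (e, 0) (i, j) * (p_par (dual (\<Psi> j)) xa (nat (int i + e)) / nu_par (\<Psi> j)))) \<and>
        (\<forall>xa. 1 \<le> j \<and> xa + j \<le> N + 1 \<longrightarrow>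
           coeff_b (dual (\<Phi> xa)) (j - 1) * (p_par (dual (\<Psi> j)) xa i / nu_par (\<Psi> j)) =
           (\<Sum>e\<in>{0, 1}. DD D' (e, -1) (i, j) * (p_par (dual (\<Psi> (j - 1))) xa (nat (int i + e)) / nu_par (\<Psi> (j - 1)))))"
    unfolding l prod.case s times_divide_eq_right sum_divide_distrib[symmetric]
  proof (intro conjI allI impI)
    fix j
    assume "j + x + 1 \<le> N"
    with E(1) show "coeff_c (dual (\<Phi> j)) (x + 1) * p_par (dual (\<Psi> x)) j y / nu_par (\<Psi> x) =
      (\<Sum>e\<in>{-1, 0}. D' (1, e) (x, y) * p_par (dual (\<Psi> (x + 1))) j (nat (int y + e))) / nu_par (\<Psi> (x + 1))"
      using nz by simp
  next
    fix j
    assume "j + x \<le> N"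
    with E(2) show "coeff_a (dual (\<Phi> j)) x * p_par (dual (\<Psi> x)) j y / nu_par (\<Psi> x) =
      (\<Sum>e\<in>{-1, 0, 1}. D' (0, e) (x, y) * p_par (dual (\<Psi> x)) j (nat (int y + e))) / nu_par (\<Psi> x)"
      by simp
  next
    fix j
    assume "1 \<le> x \<and> j + x \<le> N + 1"
    with E(3) show "coeff_b (dual (\<Phi> j)) (x - 1) * p_par (dual (\<Psi> x)) j y / nu_par (\<Psi> x) =
      (\<Sum>e\<in>{0, 1}. D' (-1, e) (x, y) * p_par (dual (\<Psi> (x - 1))) j (nat (int y + e))) / nu_par (\<Psi> (x - 1))"
      using nz by simp
  qed
qed

lemma XXs_UU:
  assumes "x + y \<le> N"
  shows "XXs (UU (x, y)) = (\<Sum>e\<in>A2. D e (x, y) *a shifted N UU (x, y) e)"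
proof -
  have "XXs ((UU \<circ> prod.swap) (y, x)) = (\<Sum>e\<in>A2. DD D e (y, x) *a shifted N (UU \<circ> prod.swap) (y, x) e)"
  proof (rule ladder_action[OF ladder_D[OF coeffs] endos_all(3), where W = "WW \<circ> prod.swap"])
    fix j x
    assume jx: "j + x \<le> N"
    then show "XXs ((WW \<circ> prod.swap) (j, x)) =
        (if x = 0 then 0 else coeff_b (dual (\<Phi> j)) (x - 1) *a (WW \<circ> prod.swap) (j, x - 1))
        + coeff_a (dual (\<Phi> j)) x *a (WW \<circ> prod.swap) (j, x)
        + (if j + x < N then coeff_c (dual (\<Phi> j)) (Suc x) *a (WW \<circ> prod.swap) (j, Suc x) else 0)"
      by (simp add: XXs_WW shifted_left shifted_right add.commute)
  qed (use assms in \<open>auto simp: WW_in coeff_b_def \<Phi>_diam UU_from_WW add.commute\<close>)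
  also have "\<dots> = (\<Sum>e\<in>A2. D e (x, y) *a shifted N UU (x, y) e)"
    by (rule sum.reindex_bij_witness[of _ prod.swap prod.swap])
      (auto simp: A2_swap DD_def shifted_def shift_in_def add.commute)
  finally show ?thesis by simp
qed

lemma coeffs_unique:
  assumes C': "compat_coeffs N \<Phi> \<Psi> C' D'" and e: "e \<in> A2" and l: "l \<in> dom2 N"
  shows "C' e l = C e l \<and> D' e l = D e l"
proof
  show "C' e l = C e l"
  proof (rule ladder_unique[OF ladder_C[OF coeffs] ladder_C[OF C'] _ e l])
    fix j w k
    assume "j \<le> N" "\<And>x. x \<le> N - j \<Longrightarrow> (\<Sum>k\<le>N - j. w k * p_par (\<Phi> j) x k) = 0" "k \<le> N - j"
    then show "w k = 0"
      using leonard_array.p_par_columns_independent[OF \<Phi>_array, of j w k] by (simp add: \<Phi>_diam)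
  qed
  have "DD D' (prod.swap e) (prod.swap l) = DD D (prod.swap e) (prod.swap l)"
  proof (rule ladder_unique[OF ladder_D[OF coeffs] ladder_D[OF C']])
    fix x w k
    assume x: "x \<le> N" and *: "\<And>j. j \<le> N - x \<Longrightarrow> (\<Sum>k\<le>N - x. w k * (p_par (dual (\<Psi> x)) j k / nu_par (\<Psi> x))) = 0"
      and k: "k \<le> N - x"
    have "(\<Sum>k\<le>N - x. w k * p_par (dual (\<Psi> x)) j k) = 0" if "j \<le> N - x" for j
      using *[OF that] nu_\<Psi>_nz[OF x] by (simp add: sum_divide_distrib[symmetric])
    then show "w k = 0"
      using leonard_array.p_par_columns_independent[OF leonard_array.leonard_array_dual[OF \<Psi>_array], of x w k] x k
      by (simp add: \<Psi>_diam)
  qed (use e l A2_swap dom2_swap in auto)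
  then show "D' e l = D e l" by (simp add: DD_def)
qed

end

section \<open>The Leonard pair\<close>

context orthogonal_space
begin

lemma image_line_subset:
  assumes "X \<in> endos" "Y \<in> endos" "h \<in> maps.span {X, Y}" "b \<in> V"
    and "subspace S" "X b \<in> S" "Y b \<in> S"
  shows "h ` span {b} \<subseteq> S"
proof -
  have "h b \<in> S" using assms by (auto simp: span_maps_pair subspace_add subspace_scale)
  moreover have "h \<in> endos" using assms maps.span_minimal[OF _ subspace_endos, of "{X, Y}"] by auto
  ultimately show ?thesis
    using assms by (auto simp: span_singleton endos_scale subspace_scale)
qed

lemma not_form_nonzero_lines:
  assumes "b \<in> V" "c \<in> V" "form b c = 0"
  shows "\<not> form_nonzero form (span {b}) (span {c})"
  using assms by (auto simp: form_nonzero_def span_singleton form_scale form_scale_right)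

lemma form_nonzero_linesI:
  assumes "form b (X c) \<noteq> 0"
  shows "form_nonzero form (span {b}) (X ` span {c})"
  unfolding form_nonzero_def using assms by (meson imageI singletonI span_base)

end

lemma connected_chain:
  assumes "\<And>k. k < n \<Longrightarrow> Q k \<longleftrightarrow> Q (Suc k)" "Q k" "k \<le> n" "k' \<le> n"
  shows "Q k'"
proof -
  have "m \<le> n \<Longrightarrow> Q m \<longleftrightarrow> Q 0" for m
    by (induction m) (use assms(1) in auto)
  then show ?thesis using assms by blast
qed

context compatible_pair
begin

lemma t_inj: "x \<le> N \<Longrightarrow> x' \<le> N \<Longrightarrow> t x = t x' \<longleftrightarrow> x = x'"
  using leonard_array.th_eq_iff[OF \<Phi>_array, of 0 x x'] by (simp add: \<Phi>_diam \<Phi>_theta)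

lemma ths_inj: "j \<le> N \<Longrightarrow> j' \<le> N \<Longrightarrow> ths j = ths j' \<longleftrightarrow> j = j'"
  using leonard_array.st_eq_iff[OF \<Psi>_array, of 0 j j'] by (simp add: \<Psi>_diam \<Psi>_theta_star)

lemma th_inj: "x + y \<le> N \<Longrightarrow> x + y' \<le> N \<Longrightarrow> th y x = th y' x \<longleftrightarrow> y = y'"
  using leonard_array.th_eq_iff[OF \<Psi>_array, of x y y'] by (auto simp: \<Psi>_diam \<Psi>_theta)

lemma ts_inj: "i + j \<le> N \<Longrightarrow> i' + j \<le> N \<Longrightarrow> ts i j = ts i' j \<longleftrightarrow> i = i'"
  using leonard_array.st_eq_iff[OF \<Phi>_array, of j i i'] by (auto simp: \<Phi>_diam \<Phi>_theta_star)

lemma diag_UU: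
  "l \<in> dom2 N \<Longrightarrow> XX (UU l) = t (fst l) *a UU l"
  "l \<in> dom2 N \<Longrightarrow> YY (UU l) = th (snd l) (fst l) *a UU l"
  by (cases l; simp add: XX_UU YY_UU)+

lemma diag_UUs:
  "l \<in> dom2 N \<Longrightarrow> XXs (UUs l) = ts (fst l) (snd l) *a UUs l"
  "l \<in> dom2 N \<Longrightarrow> YYs (UUs l) = ths (snd l) *a UUs l"
  by (cases l; simp add: XXs_UUs YYs_UUs)+

lemma diag_WW:
  "l \<in> dom2 N \<Longrightarrow> XX (WW l) = t (fst l) *a WW l"
  "l \<in> dom2 N \<Longrightarrow> YYs (WW l) = ths (snd l) *a WW l"
  by (cases l; simp add: XX_WW YYs_WW)+

lemma sep_UU: "l \<in> dom2 N \<Longrightarrow> m \<in> dom2 N \<Longrightarrow> l \<noteq> m \<Longrightarrow>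
    t (fst l) \<noteq> t (fst m) \<or> th (snd l) (fst l) \<noteq> th (snd m) (fst m)"
  by (cases l; cases m) (auto simp: t_inj th_inj)

lemma sep_UUs: "l \<in> dom2 N \<Longrightarrow> m \<in> dom2 N \<Longrightarrow> l \<noteq> m \<Longrightarrow>
    ts (fst l) (snd l) \<noteq> ts (fst m) (snd m) \<or> ths (snd l) \<noteq> ths (snd m)"
  by (cases l; cases m) (auto simp: ts_inj ths_inj)

lemma sep_WW: "l \<in> dom2 N \<Longrightarrow> m \<in> dom2 N \<Longrightarrow> l \<noteq> m \<Longrightarrow>
    t (fst l) \<noteq> t (fst m) \<or> ths (snd l) \<noteq> ths (snd m)"
  by (cases l; cases m) (auto simp: t_inj ths_inj)

abbreviation "HH \<equiv> maps.span {XX, YY}"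
abbreviation "HHs \<equiv> maps.span {XXs, YYs}"

lemma XX_in_HH: "XX \<in> HH" "YY \<in> HH" and XXs_in_HHs: "XXs \<in> HHs" "YYs \<in> HHs"
  by (auto intro: maps.span_base)

lemma maps_independent: "XX \<noteq> YY" "maps.independent {XX, YY}" "XXs \<noteq> YYs" "maps.independent {XXs, YYs}"
proof -
  show "XX \<noteq> YY" "maps.independent {XX, YY}"
    using diagonal_pair_independent[OF UU_basis diag_UU, of "(0, 0)" "(1, 0)" "(0, 1)"] N
    by (auto simp: t_inj th_inj)
  \<comment> \<open>The roles are exchanged: on \<open>UUs\<close> it is \<open>YYs\<close> whose
    eigenvalue depends on one coordinate only.\<close>
  show "XXs \<noteq> YYs" "maps.independent {XXs, YYs}"
    using diagonal_pair_independent[OF UUs_basis diag_UUs(2,1), of "(0, 0)" "(0, 1)" "(1, 0)"] N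
    by (auto simp: ths_inj ts_inj insert_commute)
qed

lemma planes: "diagonalizable_plane HH" "diagonalizable_plane HHs"
  using diagonal_pair_plane[OF UU_basis endos_all(1,2) diag_UU maps_independent(1,2)]
    diagonal_pair_plane[OF UUs_basis endos_all(3,4) diag_UUs maps_independent(3,4)] by auto

lemma shifted_in_adjacent:
  assumes "e \<in> A2" "l \<in> dom2 N"
  shows "shifted N B l e \<in> span (\<Union>m\<in>{m \<in> dom2 N. adjacent m l}. span {B m})"
proof (cases "shift_in N l e")
  case True
  define m where "m = (nat (int (fst l) + fst e), nat (int (snd l) + snd e))"
  have "m \<in> dom2 N" "adjacent m l"
    using True assms by (auto simp: m_def shift_in_def adjacent_def)
  then have "B m \<in> (\<Union>m\<in>{m \<in> dom2 N. adjacent m l}. span {B m})"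
    by (intro UN_I[of m]) (simp_all add: span_base)
  moreover have "shifted N B l e = B m"
    using True by (simp add: shifted_def m_def)
  ultimately show ?thesis by (simp only: span_base)
next
  case False
  then show ?thesis using span_zero by (simp add: shifted_def)
qed

lemma shifted_0: "l \<in> dom2 N \<Longrightarrow> shifted N B l (0, 0) = B l" for B :: "nat \<times> nat \<Rightarrow> ambient"
  by (cases l) (auto simp: shifted_def shift_in_def)

lemma HHs_UU:
  assumes "l \<in> dom2 N" "h \<in> HHs"
  shows "h ` span {UU l} \<subseteq> span (\<Union>m\<in>{m \<in> dom2 N. adjacent m l}. span {UU m})"
proof (rule image_line_subset[OF endos_all(3,4) assms(2) UU_in[OF assms(1)] subspace_span])
  obtain x y where l: "l = (x, y)" "x + y \<le> N" using assms(1) by (cases l) auto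
  note sh = shifted_in_adjacent[OF _ assms(1), of _ UU]
  show "XXs (UU l) \<in> span (\<Union>m\<in>{m \<in> dom2 N. adjacent m l}. span {UU m})"
    using sh unfolding l(1) XXs_UU[OF l(2)] by (intro span_sum span_scale) auto
  have "UU l \<in> span (\<Union>m\<in>{m \<in> dom2 N. adjacent m l}. span {UU m})"
    using sh[of "(0, 0)"] shifted_0[OF assms(1), of UU] by (simp add: A2_def)
  then show "YYs (UU l) \<in> span (\<Union>m\<in>{m \<in> dom2 N. adjacent m l}. span {UU m})"
    using sh[of "(0, 1)"] sh[of "(0, -1)"] unfolding l(1) YYs_UU[OF l(2)]
    by (intro span_add span_scale) (auto simp: A2_def)
qed

lemma HH_UUs:
  assumes "l \<in> dom2 N" "h \<in> HH"
  shows "h ` span {UUs l} \<subseteq> span (\<Union>m\<in>{m \<in> dom2 N. adjacent m l}. span {UUs m})"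
proof (rule image_line_subset[OF endos_all(1,2) assms(2) UUs_in'[OF assms(1)] subspace_span])
  obtain i j where l: "l = (i, j)" "i + j \<le> N" using assms(1) by (cases l) auto
  note sh = shifted_in_adjacent[OF _ assms(1), of _ UUs]
  show "YY (UUs l) \<in> span (\<Union>m\<in>{m \<in> dom2 N. adjacent m l}. span {UUs m})"
    using sh unfolding l(1) YY_UUs[OF l(2)] by (intro span_sum span_scale) auto
  have "UUs l \<in> span (\<Union>m\<in>{m \<in> dom2 N. adjacent m l}. span {UUs m})"
    using sh[of "(0, 0)"] shifted_0[OF assms(1), of UUs] by (simp add: A2_def)
  then show "XX (UUs l) \<in> span (\<Union>m\<in>{m \<in> dom2 N. adjacent m l}. span {UUs m})"
    using sh[of "(1, 0)"] sh[of "(-1, 0)"] unfolding l(1) XX_UUs[OF l(2)]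
    by (intro span_add span_scale) (auto simp: A2_def)
qed

lemma UU_norm: "l \<in> dom2 N \<Longrightarrow> fm (UU l) (UU l) \<noteq> 0"
  and UU_orth: "l \<in> dom2 N \<Longrightarrow> m \<in> dom2 N \<Longrightarrow> l \<noteq> m \<Longrightarrow> fm (UU l) (UU m) = 0"
  using UU_basis unfolding orth_basis_def by blast+

lemma UUs_norm: "l \<in> dom2 N \<Longrightarrow> fm (UUs l) (UUs l) \<noteq> 0"
  and UUs_orth: "l \<in> dom2 N \<Longrightarrow> m \<in> dom2 N \<Longrightarrow> l \<noteq> m \<Longrightarrow> fm (UUs l) (UUs m) = 0"
  using UUs_basis unfolding orth_basis_def by blast+

lemma coeffs_nz:
  "x + y < N \<Longrightarrow> coeff_c (dual (\<Psi> x)) (Suc y) \<noteq> 0" "x + y < N \<Longrightarrow> coeff_b (dual (\<Psi> x)) y \<noteq> 0"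
  "i + j < N \<Longrightarrow> coeff_c (\<Phi> j) (Suc i) \<noteq> 0" "i + j < N \<Longrightarrow> coeff_b (\<Phi> j) i \<noteq> 0"
  using leonard_array.coeff_c_nz[OF leonard_array.leonard_array_dual[OF \<Psi>_array], of x "Suc y"]
    leonard_array.coeff_b_nz[OF leonard_array.leonard_array_dual[OF \<Psi>_array], of x y]
    leonard_array.coeff_c_nz[OF \<Phi>_array, of j "Suc i"] leonard_array.coeff_b_nz[OF \<Phi>_array, of j i]
  by (auto simp: \<Phi>_diam \<Psi>_diam)

text \<open>Orthogonality isolates one coefficient c or b times a norm. The result serves both the
  condition on neighbouring eigenspaces and irreducibility.\<close>

lemma fm_neighbours_UU:
  assumes "x + y < N"
  shows "fm (YYs (UU (x, y))) (UU (x, Suc y)) \<noteq> 0" "fm (YYs (UU (x, Suc y))) (UU (x, y)) \<noteq> 0"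
  using assms coeffs_nz(1,2)[of x y] UU_norm[of "(x, y)"] UU_norm[of "(x, Suc y)"]
  by (auto simp: YYs_UU shifted_up shifted_down form_add form_scale form_0 UU_in UU_orth)

lemma fm_neighbours_UUs:
  assumes "i + j < N"
  shows "fm (XX (UUs (i, j))) (UUs (Suc i, j)) \<noteq> 0" "fm (XX (UUs (Suc i, j))) (UUs (i, j)) \<noteq> 0"
  using assms coeffs_nz(3,4)[of i j] UUs_norm[of "(i, j)"] UUs_norm[of "(Suc i, j)"]
  by (auto simp: XX_UUs shifted_left shifted_right form_add form_scale form_0 UUs_in UUs_orth)

text \<open>\<open>YYs\<close> links only vectors \<open>UU (x, y)\<close> with equal x, and
  \<open>XX\<close> only vectors \<open>UUs (i, j)\<close> with equal j. Different x are linked by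
  \<open>WW (x, 0)\<close>, which lies in the span of column x of \<open>UU\<close> and also in that
  of row 0 of \<open>UUs\<close>; this row yields \<open>WW (x', 0)\<close> for every x'.\<close>

lemma irreducible:
  assumes Z: "subspace Z" "Z \<subseteq> VV" "Z \<noteq> {0}" "\<And>h. h \<in> HH \<union> HHs \<Longrightarrow> h ` Z \<subseteq> Z"
  shows "Z = VV"
proof -
  have inU: "UU l \<in> Z" if "v \<in> Z" "fm v (UU l) \<noteq> 0" "l \<in> dom2 N" for v l
    by (rule diagonal_pair_invariant[OF UU_basis endos_all(1,2) diag_UU sep_UU maps.span_superset order_refl Z(1,2) _ that])
      (use Z(4) in auto)
  have inUs: "UUs l \<in> Z" if "v \<in> Z" "fm v (UUs l) \<noteq> 0" "l \<in> dom2 N" for v l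
    by (rule diagonal_pair_invariant[OF UUs_basis endos_all(3,4) diag_UUs sep_UUs maps.span_superset order_refl Z(1,2) _ that])
      (use Z(4) in auto)
  have mapZ: "XX v \<in> Z" "YYs v \<in> Z" if "v \<in> Z" for v
    using Z(4) XX_in_HH XXs_in_HHs that by blast+
  have colU: "UU (x, y') \<in> Z" if "UU (x, y) \<in> Z" "x + y \<le> N" "x + y' \<le> N" for x y y'
  proof (rule connected_chain[where Q = "\<lambda>y. UU (x, y) \<in> Z" and n = "N - x" and k = y])
    show "UU (x, k) \<in> Z \<longleftrightarrow> UU (x, Suc k) \<in> Z" if "k < N - x" for k
      using that fm_neighbours_UU[of x k] mapZ(2) inU[of "YYs (UU (x, k))" "(x, Suc k)"]
        inU[of "YYs (UU (x, Suc k))" "(x, k)"] by auto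
  qed (use that in auto)
  have colUs: "UUs (i', j) \<in> Z" if "UUs (i, j) \<in> Z" "i + j \<le> N" "i' + j \<le> N" for i i' j
  proof (rule connected_chain[where Q = "\<lambda>i. UUs (i, j) \<in> Z" and n = "N - j" and k = i])
    show "UUs (k, j) \<in> Z \<longleftrightarrow> UUs (Suc k, j) \<in> Z" if "k < N - j" for k
      using that fm_neighbours_UUs[of k j] mapZ(1) inUs[of "XX (UUs (k, j))" "(Suc k, j)"]
        inUs[of "XX (UUs (Suc k, j))" "(k, j)"] by auto
  qed (use that in auto)
  obtain v where v: "v \<in> Z" "v \<noteq> 0" using Z(3) subspace_0[OF Z(1)] by blast
  then obtain l where l: "l \<in> dom2 N" "fm v (UU l) \<noteq> 0"
    using form_basis_eq_0_iff[OF UU_basis, of v] Z(2) by blast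
  obtain x y where xy: "x + y \<le> N" "UU (x, y) \<in> Z"
    using inU[OF v(1) l(2,1)] l(1) by (cases l) auto
  have W0: "WW (x, 0) \<in> Z"
    unfolding WW_def prod.case using colU[OF xy(2,1)] xy(1)
    by (intro subspace_sum[OF Z(1)] subspace_scale[OF Z(1)]) auto
  have "WW (x, 0) \<in> VV" "WW (x, 0) \<noteq> 0"
    using xy(1) basis_nz[OF WW_basis, of "(x, 0)"] by (auto simp: WW_in)
  then obtain m where m: "m \<in> dom2 N" "fm (WW (x, 0)) (UUs m) \<noteq> 0"
    using form_basis_eq_0_iff[OF UUs_basis] by blast
  \<comment> \<open>\<open>WW (x, 0)\<close> is orthogonal to every other row of \<open>UUs\<close>,
    so \<open>m\<close> lies in row 0.\<close>
  then obtain i where i: "m = (i, 0)" "i \<le> N"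
    using xy(1) by (cases m) (auto simp: fm_WW_UUs split: if_splits)
  have Us0: "UUs (i', 0) \<in> Z" if "i' \<le> N" for i'
    using colUs[of i 0 i'] inUs[OF W0 m(2,1)] i that by simp
  have Wx: "WW (x', 0) \<in> Z" if "x' \<le> N" for x'
  proof -
    have "WW (x', 0) = (\<Sum>i\<le>N - 0. (p_par (dual (\<Phi> 0)) i x' / nu_par (\<Phi> 0)) *a UUs (i, 0))"
      using WW_from_UUs[of x' 0] that by simp
    also have "\<dots> \<in> Z"
      using Us0 by (intro subspace_sum[OF Z(1)] subspace_scale[OF Z(1)]) auto
    finally show ?thesis .
  qed
  have "UU l \<in> Z" if l: "l \<in> dom2 N" for l
  proof -
    from l obtain x' y' where l': "l = (x', y')" "x' + y' \<le> N" by (cases l) simp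
    have "WW (x', 0) \<in> VV" "WW (x', 0) \<noteq> 0"
      using l' basis_nz[OF WW_basis, of "(x', 0)"] by (auto simp: WW_in)
    then obtain m where m: "m \<in> dom2 N" "fm (WW (x', 0)) (UU m) \<noteq> 0"
      using form_basis_eq_0_iff[OF UU_basis] by blast
    then obtain y where "m = (x', y)" "x' + y \<le> N"
      by (cases m) (auto simp: fm_UU WW_apply split: if_splits)
    then show ?thesis
      using colU[of x' y y'] inU[OF Wx m(2,1)] l' by simp
  qed
  then have "span (UU ` dom2 N) \<subseteq> Z" by (intro span_minimal Z(1)) auto
  then show ?thesis using Z(2) basis_span[OF UU_basis] by blast
qed

lemma leonard_pair: "A2_leonard_pair N HH HHs (\<lambda>l. span {UU l}) (\<lambda>l. span {UUs l}) fm"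
  unfolding A2_leonard_pair_def
proof (intro conjI ballI impI)
  show "diagonalizable_plane HH" "diagonalizable_plane HHs" by (fact planes)+
  show "bij_betw (\<lambda>l. span {UU l}) (dom2 N) {W. common_eigenspace HH W}"
    by (rule diagonal_pair_eigenspaces[OF UU_basis endos_all(1,2) diag_UU sep_UU maps.span_superset order_refl])
  show "bij_betw (\<lambda>l. span {UUs l}) (dom2 N) {W. common_eigenspace HHs W}"
    by (rule diagonal_pair_eigenspaces[OF UUs_basis endos_all(3,4) diag_UUs sep_UUs maps.span_superset order_refl])
  show "\<not> (\<exists>W. subspace W \<and> W \<subseteq> VV \<and> W \<noteq> {0} \<and> W \<noteq> VV \<and> (\<forall>h\<in>HH \<union> HHs. h ` W \<subseteq> W))"
    using irreducible by blast
  show "nondeg_sym_bilinear_form fm" by (rule form)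
  show "h ` span {UU l} \<subseteq> span (\<Union>m\<in>{m \<in> dom2 N. adjacent m l}. span {UU m})"
    if "l \<in> dom2 N" "h \<in> HHs" for l h using that by (rule HHs_UU)
  show "h ` span {UUs l} \<subseteq> span (\<Union>m\<in>{m \<in> dom2 N. adjacent m l}. span {UUs m})"
    if "l \<in> dom2 N" "h \<in> HH" for l h using that by (rule HH_UUs)
  show "dim (span {UU l}) = 1" "dim (span {UUs l}) = 1" if "l \<in> dom2 N" for l
    using that by (rule basis_line_dim[OF UU_basis], rule basis_line_dim[OF UUs_basis])
  show "\<not> form_nonzero fm (span {UU l}) (span {UU m})" "\<not> form_nonzero fm (span {UUs l}) (span {UUs m})"
    if "l \<in> dom2 N" "m \<in> dom2 N" "l \<noteq> m" for l m
    by (rule not_form_nonzero_lines, (rule UU_in UUs_in' that)+, rule UU_orth UUs_orth, (rule that)+)+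
qed

lemma factorized_pair:
  "factorized_A2_leonard_pair N HH HHs XX YY XXs YYs (\<lambda>l. span {UU l}) (\<lambda>l. span {UUs l})"
  unfolding factorized_A2_leonard_pair_def
proof (intro exI[of _ fm] conjI allI impI)
  show "A2_leonard_pair N HH HHs (\<lambda>l. span {UU l}) (\<lambda>l. span {UUs l}) fm" by (rule leonard_pair)
  show "XX \<noteq> YY" "maps.independent {XX, YY}" "XXs \<noteq> YYs" "maps.independent {XXs, YYs}"
    by (fact maps_independent)+
  show "HH = HH" "HHs = HHs" by (rule refl)+
  show "\<exists>t. inj_on t {..N} \<and> (\<forall>(x, y)\<in>dom2 N. \<forall>v\<in>span {UU (x, y)}. XX v = t x *a v)"
    using endos_all(1) by (intro exI[of _ t])
      (auto simp: inj_on_def t_inj span_singleton endos_scale UU_in XX_UU mult.commute)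
  show "\<exists>s. inj_on s {..N} \<and> (\<forall>(i, j)\<in>dom2 N. \<forall>v\<in>span {UUs (i, j)}. YYs v = s j *a v)"
    using endos_all(4) by (intro exI[of _ ths])
      (auto simp: inj_on_def ths_inj span_singleton endos_scale UUs_in YYs_UUs mult.commute)
  show "XX \<circ> YYs = YYs \<circ> XX"
  proof (rule endos_eqI[OF WW_basis])
    show "XX \<circ> YYs \<in> endos" "YYs \<circ> XX \<in> endos" by (intro endos_comp endos_all)+
    show "(XX \<circ> YYs) (WW l) = (YYs \<circ> XX) (WW l)" if "l \<in> dom2 N" for l
      using endos_scale[OF endos_all(1) WW_in'[OF that]] endos_scale[OF endos_all(4) WW_in'[OF that]] that
      by (simp add: diag_WW mult.commute)
  qed
  show "dim W = 1" if "common_eigenspace {XX, YYs} W" for W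
  proof -
    have "common_eigenspace {XX, YYs} W \<longleftrightarrow> (\<exists>l\<in>dom2 N. W = span {WW l})"
      by (rule diagonal_pair_eigenspace_iff[OF WW_basis endos_all(1,4) diag_WW sep_WW order_refl maps.span_superset])
    then show ?thesis using that basis_line_dim[OF WW_basis] by auto
  qed
next
  fix i j
  assume "(i, j) \<in> dom2 N \<and> (i + 1, j) \<in> dom2 N"
  then have ij: "i + j < N" by simp
  then have "XX (UUs (i, j)) \<in> VV" "XX (UUs (Suc i, j)) \<in> VV" "UUs (i, j) \<in> VV" "UUs (Suc i, j) \<in> VV"
    using endos_in[OF endos_all(1)] UUs_in by auto
  then show "form_nonzero fm (span {UUs (i + 1, j)}) (XX ` span {UUs (i, j)})"
    "form_nonzero fm (span {UUs (i, j)}) (XX ` span {UUs (i + 1, j)})"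
    using fm_neighbours_UUs[OF ij] form_sym by (auto intro!: form_nonzero_linesI)
next
  fix x y
  assume "(x, y) \<in> dom2 N \<and> (x, y + 1) \<in> dom2 N"
  then have xy: "x + y < N" by simp
  then have "YYs (UU (x, y)) \<in> VV" "YYs (UU (x, Suc y)) \<in> VV" "UU (x, y) \<in> VV" "UU (x, Suc y) \<in> VV"
    using endos_in[OF endos_all(4)] UU_in by auto
  then show "form_nonzero fm (span {UU (x, y + 1)}) (YYs ` span {UU (x, y)})"
    "form_nonzero fm (span {UU (x, y)}) (YYs ` span {UU (x, y + 1)})"
    using fm_neighbours_UU[OF xy] form_sym by (auto intro!: form_nonzero_linesI)
qed

lemma UUs_expansion:
  "UUs (i, j) = (\<Sum>x\<le>N - j. \<Sum>y\<le>N - x. (p_par (\<Phi> j) x i * p_par (\<Psi> x) y j) *a UU (x, y))"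
  by (simp add: UUs_def WW_def scale_sum_right)

lemma basis_families: "basis_family UU (dom2 N)" "basis_family UUs (dom2 N)"
  unfolding basis_family_def
  using basis_inj basis_independent basis_span UU_basis UUs_basis by blast+

lemma dim_VV: "dim VV = (N + 2) choose 2"
  using basis_dim[OF UU_basis] card_dom2 by simp

end

theorem theorem4p3:
  fixes N :: nat
    and t ths :: "nat \<Rightarrow> complex"
    and ts f g th vph ph :: "nat \<Rightarrow> nat \<Rightarrow> complex"
    and \<Phi> \<Psi> :: "nat \<Rightarrow> param_array"
  assumes N: "N \<ge> 1"
    and \<Phi>: "\<And>j. \<Phi> j = \<lparr> diam = N - j, theta = t, theta_star = (\<lambda>x. ts x j),
                         vphi = (\<lambda>x. f x j), phi = (\<lambda>x. g x j) \<rparr>"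
    and \<Psi>: "\<And>x. \<Psi> x = \<lparr> diam = N - x, theta = (\<lambda>j. th j x), theta_star = ths,
                         vphi = (\<lambda>j. vph j x), phi = (\<lambda>j. ph j x) \<rparr>"
    and arrays: "\<forall>j\<le>N. is_param_array (\<Phi> j)" "\<forall>x\<le>N. is_param_array (\<Psi> x)"
    and compat: "compatible N \<Phi> \<Psi>"
  shows "\<exists>C D. compat_coeffs N \<Phi> \<Psi> C D \<and>
    (\<forall>C' D'. compat_coeffs N \<Phi> \<Psi> C' D' \<longrightarrow>
       (\<forall>e\<in>A2. \<forall>l\<in>dom2 N. C' e l = C e l \<and> D' e l = D e l)) \<and>
    (\<exists>(V :: ambient set) X Y Xs Ys (U :: nat \<times> nat \<Rightarrow> ambient) (Us :: nat \<times> nat \<Rightarrow> ambient).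
       complex_space ascale V \<and>
       vector_space.dim ascale V = (N + 2) choose 2 \<and>
       {X, Y, Xs, Ys} \<subseteq> complex_space.endos ascale V \<and>
       complex_space.basis_family ascale V U (dom2 N) \<and>
       complex_space.basis_family ascale V Us (dom2 N) \<and>
       complex_space.factorized_A2_leonard_pair ascale V N
         (module.span (\<lambda>c h v. c *a h v) {X, Y}) (module.span (\<lambda>c h v. c *a h v) {Xs, Ys})
         X Y Xs Ys (\<lambda>l. module.span ascale {U l}) (\<lambda>l. module.span ascale {Us l}) \<and>
       (\<forall>(x, y)\<in>dom2 N.
          X (U (x, y)) = t x *a U (x, y) \<and>
          Y (U (x, y)) = th y x *a U (x, y) \<and>
          Xs (U (x, y)) = (\<Sum>e\<in>A2. D e (x, y) *a shifted N U (x, y) e) \<and>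
          Ys (U (x, y)) =
            coeff_b (dual (\<Psi> x)) (y - 1) *a shifted N U (x, y) (0, -1)
            + coeff_a (dual (\<Psi> x)) y *a U (x, y)
            + coeff_c (dual (\<Psi> x)) (y + 1) *a shifted N U (x, y) (0, 1)) \<and>
       (\<forall>(i, j)\<in>dom2 N.
          X (Us (i, j)) =
            coeff_b (\<Phi> j) (i - 1) *a shifted N Us (i, j) (-1, 0)
            + coeff_a (\<Phi> j) i *a Us (i, j)
            + coeff_c (\<Phi> j) (i + 1) *a shifted N Us (i, j) (1, 0) \<and>
          Y (Us (i, j)) = (\<Sum>e\<in>A2. C e (i, j) *a shifted N Us (i, j) e) \<and>
          Xs (Us (i, j)) = ts i j *a Us (i, j) \<and>
          Ys (Us (i, j)) = ths j *a Us (i, j)) \<and>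
       (\<forall>(i, j)\<in>dom2 N.
          Us (i, j) =
            (\<Sum>x\<le>N - j. \<Sum>y\<le>N - x. (p_par (\<Phi> j) x i * p_par (\<Psi> x) y j) *a U (x, y))))"
proof -
  obtain C D where CD: "compat_coeffs N \<Phi> \<Psi> C D"
    using compat unfolding compatible_def by blast
  obtain F G :: "nat \<times> nat \<Rightarrow> complex" where FG: "\<forall>l\<in>dom2 N. F l \<noteq> 0"
    "\<forall>(x, y)\<in>dom2 N. \<forall>(i, j)\<in>dom2 N. x + j \<le> N \<longrightarrow>
       k_par (\<Phi> j) i / k_par (dual (\<Phi> j)) x * (k_par (\<Psi> x) j / k_par (dual (\<Psi> x)) y) * F (x, y)
       = G (i, j) / (nu_par (\<Psi> x) * nu_par (\<Phi> j))"
    using compat unfolding compatible_def by blast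
  \<comment> \<open>Any witnesses of compatibility may be taken: \<open>coeffs_unique\<close>
    compares C and D with every other choice.\<close>
  interpret compatible_pair N t ths ts th \<Phi> \<Psi> C D F G
  proof
    show "1 \<le> N" by (rule N)
    show "is_param_array (\<Phi> j)" if "j \<le> N" for j using arrays(1) that by blast
    show "is_param_array (\<Psi> x)" if "x \<le> N" for x using arrays(2) that by blast
    show "compat_coeffs N \<Phi> \<Psi> C D" by (rule CD)
    show "F l \<noteq> 0" if "l \<in> dom2 N" for l using FG(1) that by blast
    show "k_par (\<Phi> j) i / k_par (dual (\<Phi> j)) x * (k_par (\<Psi> x) j / k_par (dual (\<Psi> x)) y) * F (x, y)
       = G (i, j) / (nu_par (\<Psi> x) * nu_par (\<Phi> j))"
      if "(x, y) \<in> dom2 N" "(i, j) \<in> dom2 N" "x + j \<le> N" for x y i j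
      using FG(2) that by blast
  qed (simp_all add: \<Phi> \<Psi>)
  have unique: "\<forall>C' D'. compat_coeffs N \<Phi> \<Psi> C' D' \<longrightarrow>
       (\<forall>e\<in>A2. \<forall>l\<in>dom2 N. C' e l = C e l \<and> D' e l = D e l)"
    using coeffs_unique by blast
  show ?thesis
  proof (rule exI[of _ C], rule exI[of _ D], rule conjI[OF CD conjI[OF unique]],
      rule exI[of _ VV], rule exI[of _ XX], rule exI[of _ YY], rule exI[of _ XXs],
      rule exI[of _ YYs], rule exI[of _ UU], rule exI[of _ UUs], intro conjI)
    show "complex_space ascale VV" by (rule complex_space_VV)
    show "dim VV = (N + 2) choose 2" by (rule dim_VV)
    show "{XX, YY, XXs, YYs} \<subseteq> endos" using endos_all by simp
    show "basis_family UU (dom2 N)" "basis_family UUs (dom2 N)" by (fact basis_families)+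
    show "factorized_A2_leonard_pair N HH HHs XX YY XXs YYs (\<lambda>l. span {UU l}) (\<lambda>l. span {UUs l})"
      by (rule factorized_pair)
    show "\<forall>(i, j)\<in>dom2 N. UUs (i, j) =
        (\<Sum>x\<le>N - j. \<Sum>y\<le>N - x. (p_par (\<Phi> j) x i * p_par (\<Psi> x) y j) *a UU (x, y))"
      using UUs_expansion by blast
  qed (clarsimp simp: XX_UU YY_UU XXs_UU YYs_UU XX_UUs YY_UUs XXs_UUs YYs_UUs)+
qed

end
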